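(* Let $q(y,z|x)$ be an irreducible broadcast channel with finite alphabets such that $q(y|x)>0$ and $q(z|x)>0$ for all $x,y,z$, and let $\lambda\in[0,1]$. Let $T_\lambda$ be the maximum over all finite-alphabet $p(u,v,w,x)$ of $\lambda I(W;Y)+(1-\lambda)I(W;Z)+I(U;Y|W)+I(V;Z|W)-I(U;V|W)$, with $(U,V,W,X,Y,Z)\sim p(u,v,w,x)q(y,z|x)$. Then $T_\lambda$ is attained by some $p(u,v,w,x)$ simultaneously satisfying: (1) $|\mathcal U|\le\min(|\mathcal X|,|\mathcal Y|)$, $|\mathcal V|\le\min(|\mathcal X|,|\mathcal Z|)$, $|\mathcal W|\le|\mathcal X|$. (2) $H(X|UVW)=0$; for each $w$ with $p(w)>0$ write $x=\xi^{(w)}(u,v)$ for the resulting deterministic mapping $\mathcal U_w\times\mathcal V_w\to\mathcal X$, where $\mathcal U_w=\{u:p(u|w)>0\}$ and $\mathcal V_w=\{v:p(v|w)>0\}$. (3) For every $w$ with $p(w)>0$, the profile vector $\overrightarrow{v_{\xi^{(w)}}}$ cannot be written as $\sum_{t=1}^M\alpha_t\overrightarrow{v_{\xi_t}}$ with $\xi_1,\dots,\xi_M$ deterministic mappings $\mathcal U_w\times\mathcal V_w\to\mathcal X$ all different from $\xi^{(w)}$ and $\alpha_t\ge0$, $\sum_t\alpha_t=1$. (4) For every $w$ with $p(w)>0$, defining $f_{u,w}(x)=\sum_y q(y|x)\log p(u,y|w)$ for $u\in\mathcal U_w$, $g_{v,w}(x)=\sum_z q(z|x)\log p(v,z|w)$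 for $v\in\mathcal V_w$, and $h_w(x)=\min_{u'\in\mathcal U_w,v'\in\mathcal V_w}\big(\log p(u',v'|w)-f_{u',w}(x)-g_{v',w}(x)\big)$ (these are finite), we have for all $u\in\mathcal U_w$, $v\in\mathcal V_w$: $\log p(u,v|w)=\max_x[f_{u,w}(x)+g_{v,w}(x)+h_w(x)]$, and if $p(x_0|u,v,w)=1$ then $x_0\in\arg\max_x[f_{u,w}(x)+g_{v,w}(x)+h_w(x)]$. (5) For every $w$ (with $p(w)>0$), the random variables $(U_w,V_w,X_w,Y_w,Z_w)$ distributed according to $p(u,v,x,y,z|w)$ satisfy $I(\overline U;Y_w)\ge I(\overline U;V_wZ_w)$ for every $\overline U$ with $\overline U\to U_w\to (V_w,X_w,Y_w,Z_w)$ a Markov chain, and $I(\overline V;Z_w)\ge I(\overline V;U_wY_w)$ for every $\overline V$ with $\overline V\to V_w\to(U_w,X_w,Y_w,Z_w)$ a Markov chain.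
   Context: Input symbols $x_0,x_1$ are indistinguishable if $q(y|x_0)=q(y|x_1)$ for all $y$ and $q(z|x_0)=q(z|x_1)$ for all $z$; the channel is irreducible if no two distinct input symbols are indistinguishable. For finite sets $\mathcal A=\{a_1,\dots,a_m\}$, $\mathcal B=\{b_1,\dots,b_\ell\}$, $\mathcal X=\{x_1,\dots,x_{|\mathcal X|}\}$ and a mapping $\xi:\mathcal A\times\mathcal B\to\mathcal X$, the profile of row $i$ is the vector in $\mathbb R^{|\mathcal X|}$ whose $k$-th entry is $|\{j:\xi(a_i,b_j)=x_k\}|$; the profile of column $j$ is defined analogously with $|\{i:\xi(a_i,b_j)=x_k\}|$; the profile vector $\overrightarrow{v_\xi}\in\mathbb R^{(m+\ell)|\mathcal X|}$ is the concatenation of all row profiles and all column profiles. *)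

theory Defs
  imports Complex_Main
begin

definition supp :: "('s \<Rightarrow> real) \<Rightarrow> 's set" where
  "supp \<mu> = {s. \<mu> s \<noteq> 0}"

definition is_dist :: "('s \<Rightarrow> real) \<Rightarrow> bool" where
  "is_dist \<mu> \<longleftrightarrow> (\<forall>s. 0 \<le> \<mu> s) \<and> finite (supp \<mu>) \<and> sum \<mu> (supp \<mu>) = 1"

definition prb :: "('s \<Rightarrow> real) \<Rightarrow> ('s \<Rightarrow> bool) \<Rightarrow> real" where
  "prb \<mu> E = sum \<mu> {s \<in> supp \<mu>. E s}"

definition cmi :: "('s \<Rightarrow> real) \<Rightarrow> ('s \<Rightarrow> 'a) \<Rightarrow> ('s \<Rightarrow> 'b) \<Rightarrow> ('s \<Rightarrow> 'c) \<Rightarrow> real" where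
  "cmi \<mu> A B C = (\<Sum>s\<in>supp \<mu>. \<mu> s *
     ln (prb \<mu> (\<lambda>s'. A s' = A s \<and> B s' = B s \<and> C s' = C s) * prb \<mu> (\<lambda>s'. C s' = C s)
       / (prb \<mu> (\<lambda>s'. A s' = A s \<and> C s' = C s) * prb \<mu> (\<lambda>s'. B s' = B s \<and> C s' = C s))))"

definition mi :: "('s \<Rightarrow> real) \<Rightarrow> ('s \<Rightarrow> 'a) \<Rightarrow> ('s \<Rightarrow> 'b) \<Rightarrow> real" where
  "mi \<mu> A B = cmi \<mu> A B (\<lambda>_. ())"

definition cent :: "('s \<Rightarrow> real) \<Rightarrow> ('s \<Rightarrow> 'a) \<Rightarrow> ('s \<Rightarrow> 'c) \<Rightarrow> real" where
  "cent \<mu> A C = (\<Sum>s\<in>supp \<mu>. \<mu> s *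
     - ln (prb \<mu> (\<lambda>s'. A s' = A s \<and> C s' = C s) / prb \<mu> (\<lambda>s'. C s' = C s)))"

definition qY :: "('x \<Rightarrow> 'y \<Rightarrow> 'z::finite \<Rightarrow> real) \<Rightarrow> 'x \<Rightarrow> 'y \<Rightarrow> real" where
  "qY q x y = (\<Sum>z\<in>UNIV. q x y z)"

definition qZ :: "('x \<Rightarrow> 'y::finite \<Rightarrow> 'z \<Rightarrow> real) \<Rightarrow> 'x \<Rightarrow> 'z \<Rightarrow> real" where
  "qZ q x z = (\<Sum>y\<in>UNIV. q x y z)"

definition is_bc :: "('x::finite \<Rightarrow> 'y::finite \<Rightarrow> 'z::finite \<Rightarrow> real) \<Rightarrow> bool" where
  "is_bc q \<longleftrightarrow> (\<forall>x y z. 0 \<le> q x y z) \<and> (\<forall>x. (\<Sum>y\<in>UNIV. \<Sum>z\<in>UNIV. q x y z) = 1)"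

definition indistinguishable :: "('x \<Rightarrow> 'y::finite \<Rightarrow> 'z::finite \<Rightarrow> real) \<Rightarrow> 'x \<Rightarrow> 'x \<Rightarrow> bool" where
  "indistinguishable q x0 x1 \<longleftrightarrow> (\<forall>y. qY q x0 y = qY q x1 y) \<and> (\<forall>z. qZ q x0 z = qZ q x1 z)"

definition irreducible_bc :: "('x \<Rightarrow> 'y::finite \<Rightarrow> 'z::finite \<Rightarrow> real) \<Rightarrow> bool" where
  "irreducible_bc q \<longleftrightarrow> (\<forall>x0 x1. x0 \<noteq> x1 \<longrightarrow> \<not> indistinguishable q x0 x1)"

definition joint :: "(nat \<times> nat \<times> nat \<times> 'x \<Rightarrow> real) \<Rightarrow> ('x \<Rightarrow> 'y \<Rightarrow> 'z \<Rightarrow> real)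
    \<Rightarrow> ((nat \<times> nat \<times> nat \<times> 'x) \<times> 'y \<times> 'z) \<Rightarrow> real" where
  "joint p q = (\<lambda>((u,v,w,x),y,z). p (u,v,w,x) * q x y z)"

definition rvU :: "((nat \<times> nat \<times> nat \<times> 'x) \<times> 'y \<times> 'z) \<Rightarrow> nat" where "rvU = (\<lambda>((u,v,w,x),y,z). u)"
definition rvV :: "((nat \<times> nat \<times> nat \<times> 'x) \<times> 'y \<times> 'z) \<Rightarrow> nat" where "rvV = (\<lambda>((u,v,w,x),y,z). v)"
definition rvW :: "((nat \<times> nat \<times> nat \<times> 'x) \<times> 'y \<times> 'z) \<Rightarrow> nat" where "rvW = (\<lambda>((u,v,w,x),y,z). w)"
definition rvX :: "((nat \<times> nat \<times> nat \<times> 'x) \<times> 'y \<times> 'z) \<Rightarrow> 'x" where "rvX = (\<lambda>((u,v,w,x),y,z). x)"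
definition rvY :: "((nat \<times> nat \<times> nat \<times> 'x) \<times> 'y \<times> 'z) \<Rightarrow> 'y" where "rvY = (\<lambda>((u,v,w,x),y,z). y)"
definition rvZ :: "((nat \<times> nat \<times> nat \<times> 'x) \<times> 'y \<times> 'z) \<Rightarrow> 'z" where "rvZ = (\<lambda>((u,v,w,x),y,z). z)"

definition objective :: "real \<Rightarrow> ('x \<Rightarrow> 'y \<Rightarrow> 'z \<Rightarrow> real) \<Rightarrow> (nat \<times> nat \<times> nat \<times> 'x \<Rightarrow> real) \<Rightarrow> real" where
  "objective lam q p =
     (let J = joint p q in
      lam * mi J rvW rvY + (1 - lam) * mi J rvW rvZ + cmi J rvU rvY rvW + cmi J rvV rvZ rvW
      - cmi J rvU rvV rvW)"

definition alphU :: "(nat \<times> nat \<times> nat \<times> 'x \<Rightarrow> real) \<Rightarrow> nat set" where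
  "alphU p = {u. 0 < prb p (\<lambda>(u',v',w',x'). u' = u)}"
definition alphV :: "(nat \<times> nat \<times> nat \<times> 'x \<Rightarrow> real) \<Rightarrow> nat set" where
  "alphV p = {v. 0 < prb p (\<lambda>(u',v',w',x'). v' = v)}"
definition alphW :: "(nat \<times> nat \<times> nat \<times> 'x \<Rightarrow> real) \<Rightarrow> nat set" where
  "alphW p = {w. 0 < prb p (\<lambda>(u',v',w',x'). w' = w)}"

definition pW :: "(nat \<times> nat \<times> nat \<times> 'x \<Rightarrow> real) \<Rightarrow> nat \<Rightarrow> real" where
  "pW p w = prb p (\<lambda>(u',v',w',x'). w' = w)"

definition Uw :: "(nat \<times> nat \<times> nat \<times> 'x \<Rightarrow> real) \<Rightarrow> nat \<Rightarrow> nat set" where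
  "Uw p w = {u. 0 < prb p (\<lambda>(u',v',w',x'). u' = u \<and> w' = w) / pW p w}"
definition Vw :: "(nat \<times> nat \<times> nat \<times> 'x \<Rightarrow> real) \<Rightarrow> nat \<Rightarrow> nat set" where
  "Vw p w = {v. 0 < prb p (\<lambda>(u',v',w',x'). v' = v \<and> w' = w) / pW p w}"

definition pUVw :: "(nat \<times> nat \<times> nat \<times> 'x \<Rightarrow> real) \<Rightarrow> nat \<Rightarrow> nat \<Rightarrow> nat \<Rightarrow> real" where
  "pUVw p w u v = prb p (\<lambda>(u',v',w',x'). u' = u \<and> v' = v \<and> w' = w) / pW p w"
definition pUXw :: "(nat \<times> nat \<times> nat \<times> 'x \<Rightarrow> real) \<Rightarrow> nat \<Rightarrow> nat \<Rightarrow> 'x \<Rightarrow> real" where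
  "pUXw p w u x = prb p (\<lambda>(u',v',w',x'). u' = u \<and> w' = w \<and> x' = x) / pW p w"
definition pVXw :: "(nat \<times> nat \<times> nat \<times> 'x \<Rightarrow> real) \<Rightarrow> nat \<Rightarrow> nat \<Rightarrow> 'x \<Rightarrow> real" where
  "pVXw p w v x = prb p (\<lambda>(u',v',w',x'). v' = v \<and> w' = w \<and> x' = x) / pW p w"
definition pXgUVW :: "(nat \<times> nat \<times> nat \<times> 'x \<Rightarrow> real) \<Rightarrow> nat \<Rightarrow> nat \<Rightarrow> nat \<Rightarrow> 'x \<Rightarrow> real" where
  "pXgUVW p u v w x = p (u,v,w,x) / prb p (\<lambda>(u',v',w',x'). u' = u \<and> v' = v \<and> w' = w)"

definition xi :: "(nat \<times> nat \<times> nat \<times> 'x \<Rightarrow> real) \<Rightarrow> nat \<Rightarrow> nat \<Rightarrow> nat \<Rightarrow> 'x" where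
  "xi p w u v = (THE x. 0 < p (u,v,w,x))"

definition row_prof :: "nat set \<Rightarrow> (nat \<Rightarrow> nat \<Rightarrow> 'x) \<Rightarrow> nat \<Rightarrow> 'x \<Rightarrow> nat" where
  "row_prof V \<xi> u x = card {v \<in> V. \<xi> u v = x}"
definition col_prof :: "nat set \<Rightarrow> (nat \<Rightarrow> nat \<Rightarrow> 'x) \<Rightarrow> nat \<Rightarrow> 'x \<Rightarrow> nat" where
  "col_prof U \<xi> v x = card {u \<in> U. \<xi> u v = x}"

definition profile_not_convex_comb :: "nat set \<Rightarrow> nat set \<Rightarrow> (nat \<Rightarrow> nat \<Rightarrow> 'x) \<Rightarrow> bool" where
  "profile_not_convex_comb U V \<xi>0 \<longleftrightarrow>
     \<not> (\<exists>(M::nat) (\<alpha>::nat \<Rightarrow> real) (\<xi>s::nat \<Rightarrow> nat \<Rightarrow> nat \<Rightarrow> 'x).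
          (\<forall>t<M. \<exists>u\<in>U. \<exists>v\<in>V. \<xi>s t u v \<noteq> \<xi>0 u v) \<and>
          (\<forall>t<M. 0 \<le> \<alpha> t) \<and> (\<Sum>t<M. \<alpha> t) = 1 \<and>
          (\<forall>u\<in>U. \<forall>x. real (row_prof V \<xi>0 u x) = (\<Sum>t<M. \<alpha> t * real (row_prof V (\<xi>s t) u x))) \<and>
          (\<forall>v\<in>V. \<forall>x. real (col_prof U \<xi>0 v x) = (\<Sum>t<M. \<alpha> t * real (col_prof U (\<xi>s t) v x))))"

definition fUw :: "('x::finite \<Rightarrow> 'y::finite \<Rightarrow> 'z::finite \<Rightarrow> real) \<Rightarrow> (nat \<times> nat \<times> nat \<times> 'x \<Rightarrow> real)
    \<Rightarrow> nat \<Rightarrow> nat \<Rightarrow> 'x \<Rightarrow> real" where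
  "fUw q p u w x = (\<Sum>y\<in>UNIV. qY q x y * ln (\<Sum>x'\<in>UNIV. pUXw p w u x' * qY q x' y))"
definition gVw :: "('x::finite \<Rightarrow> 'y::finite \<Rightarrow> 'z::finite \<Rightarrow> real) \<Rightarrow> (nat \<times> nat \<times> nat \<times> 'x \<Rightarrow> real)
    \<Rightarrow> nat \<Rightarrow> nat \<Rightarrow> 'x \<Rightarrow> real" where
  "gVw q p v w x = (\<Sum>z\<in>UNIV. qZ q x z * ln (\<Sum>x'\<in>UNIV. pVXw p w v x' * qZ q x' z))"
definition hw :: "('x::finite \<Rightarrow> 'y::finite \<Rightarrow> 'z::finite \<Rightarrow> real) \<Rightarrow> (nat \<times> nat \<times> nat \<times> 'x \<Rightarrow> real)
    \<Rightarrow> nat \<Rightarrow> 'x \<Rightarrow> real" where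
  "hw q p w x = Min {ln (pUVw p w u' v') - fUw q p u' w x - gVw q p v' w x | u' v'.
                      u' \<in> Uw p w \<and> v' \<in> Vw p w}"

definition cond4 :: "('x::finite \<Rightarrow> 'y::finite \<Rightarrow> 'z::finite \<Rightarrow> real) \<Rightarrow> (nat \<times> nat \<times> nat \<times> 'x \<Rightarrow> real)
    \<Rightarrow> nat \<Rightarrow> bool" where
  "cond4 q p w \<longleftrightarrow>
     (\<forall>u\<in>Uw p w. \<forall>v\<in>Vw p w.
        (let F = (\<lambda>x. fUw q p u w x + gVw q p v w x + hw q p w x) in
          0 < pUVw p w u v \<and>
          ln (pUVw p w u v) = Max (range F) \<and>
          (\<forall>x0. pXgUVW p u v w x0 = 1 \<longrightarrow> (\<forall>x. F x \<le> F x0))))"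

text \<open>Law of (Ubar, U_w, V_w, X_w, Y_w, Z_w) given W = w, with Ubar generated from U_w
  through the channel r(ubar|u) (Markov chain Ubar - U_w - (V_w,X_w,Y_w,Z_w)).\<close>
definition condU :: "(nat \<times> nat \<times> nat \<times> 'x \<Rightarrow> real) \<Rightarrow> ('x \<Rightarrow> 'y \<Rightarrow> 'z \<Rightarrow> real) \<Rightarrow> nat
    \<Rightarrow> (nat \<Rightarrow> nat \<Rightarrow> real) \<Rightarrow> (nat \<times> nat \<times> nat \<times> 'x \<times> 'y \<times> 'z) \<Rightarrow> real" where
  "condU p q w r = (\<lambda>(ub,u,v,x,y,z). p (u,v,w,x) / pW p w * q x y z * r u ub)"
definition condV :: "(nat \<times> nat \<times> nat \<times> 'x \<Rightarrow> real) \<Rightarrow> ('x \<Rightarrow> 'y \<Rightarrow> 'z \<Rightarrow> real) \<Rightarrow> nat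
    \<Rightarrow> (nat \<Rightarrow> nat \<Rightarrow> real) \<Rightarrow> (nat \<times> nat \<times> nat \<times> 'x \<times> 'y \<times> 'z) \<Rightarrow> real" where
  "condV p q w r = (\<lambda>(vb,u,v,x,y,z). p (u,v,w,x) / pW p w * q x y z * r v vb)"

definition cond5 :: "(nat \<times> nat \<times> nat \<times> 'x \<Rightarrow> real) \<Rightarrow> ('x \<Rightarrow> 'y \<Rightarrow> 'z \<Rightarrow> real) \<Rightarrow> nat \<Rightarrow> bool" where
  "cond5 p q w \<longleftrightarrow>
     (\<forall>r::nat \<Rightarrow> nat \<Rightarrow> real. (\<forall>u. is_dist (r u)) \<longrightarrow>
        mi (condU p q w r) (\<lambda>(ub,u,v,x,y,z). ub) (\<lambda>(ub,u,v,x,y,z). y)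
        \<ge> mi (condU p q w r) (\<lambda>(ub,u,v,x,y,z). ub) (\<lambda>(ub,u,v,x,y,z). (v,z))) \<and>
     (\<forall>r::nat \<Rightarrow> nat \<Rightarrow> real. (\<forall>v. is_dist (r v)) \<longrightarrow>
        mi (condV p q w r) (\<lambda>(vb,u,v,x,y,z). vb) (\<lambda>(vb,u,v,x,y,z). z)
        \<ge> mi (condV p q w r) (\<lambda>(vb,u,v,x,y,z). vb) (\<lambda>(vb,u,v,x,y,z). (u,y)))"

end

theory Submission
  imports Defs "HOL-Library.Cardinality" "HOL-Analysis.Function_Topology" "HOL-Real_Asymp.Real_Asymp"
begin

text \<open>
  Write \<open>\<eta>(t) = t ln t\<close>. Up to entropies of \<open>W\<close>, \<open>(U, W)\<close> and \<open>(V, W)\<close> that cancel, the objective equals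
  \<open>\<Sum>\<^sub>w F(p\<^sub>w) + \<lambda> H(Y) + (1 - \<lambda>) H(Z)\<close>, where \<open>p\<^sub>w\<close> is the unnormalised law of \<open>(U, V, X)\<close> on \<open>W = w\<close> and
  \<open>F\<close> combines \<open>\<eta>\<close>-sums over the marginals \<open>(u,y)\<close>, \<open>(v,z)\<close>, \<open>(u,v)\<close>, \<open>y\<close>, \<open>z\<close>; it is homogeneous of degree one.

  Cardinalities: the objective is convex along each of the lines \<open>p (1 + \<epsilon> L(u, w))\<close> with \<open>E[L | Y, W] = 0\<close>,
  \<open>p (1 + \<epsilon> L(w))\<close> with \<open>E[L | X] = 0\<close>, and \<open>p + \<epsilon> d\<close> with \<open>\<Sum>\<^sub>x d(u, v, w, x) = 0\<close>. Moving to an end of such a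
  line shrinks the support, and nonzero \<open>L\<close> or \<open>d\<close> exist as long as (1) or (2) fails. Compactness then
  yields a maximiser.

  For a maximiser, a block \<open>p\<^sub>w\<close> cannot be improved by any finite family of blocks with the same total law of
  \<open>X\<close>. Moving a small mass from \<open>(u\<^sub>0, v\<^sub>0, x)\<close> to \<open>(u\<^sub>1, v\<^sub>1, x)\<close> gives (4). If the profile of \<open>\<xi>\<close> were a
  convex combination of others, adding a small multiple of that combination would keep all \<open>(u,x)\<close>-,
  \<open>(v,x)\<close>- and \<open>(u,v)\<close>-marginals and give a nondeterministic optimal block, which irreducibility and strict
  convexity exclude; this is (3). Splitting the block along a degraded version \<open>U'\<close> of \<open>U\<close> gives
  \<open>I(U';VZ) \<le> (1 - \<lambda>) I(U';Y) + \<lambda> I(U';Z)\<close>, whence (5) when \<open>\<lambda> < 1\<close>; when \<open>\<lambda> = 1\<close>, \<open>U\<close> can be absorbed into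
  \<open>W\<close> beforehand, so that (5) is trivial for \<open>U\<close>. The case of \<open>V\<close> is symmetric under \<open>\<lambda> \<mapsto> 1 - \<lambda>\<close>.
\<close>

section \<open>Convexity of t ln t\<close>

text \<open>Blocks stay unnormalised: by homogeneity the weights p(w) disappear, and concavification
  over W becomes a comparison of sums of nonnegative arrays. The obstacle to convexity is the term
  -I(U;V|W). Along the three families of lines it is neutralised: the (u,v) law is fixed, or its
  change is matched by that of the (u,y) law, or whole blocks are rescaled. The resulting bounds for
  U and V hold for each w separately, while (1) counts symbols over all w; a relabelling that
  depends on w closes this gap. The slope of t ln t is infinite at 0, so (4) cannot be read off from
  derivatives at cells with p(u,v|w) = 0. That an optimal block has no such cells is itself a
  consequence of optimality and is obtained together with (4). Profiles enter because
  \<open>F\<close> sees a block only through its (u,x)-, (v,x)- and (u,v)-marginals: a perturbation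
  with the same weight on every cell has row and column profiles as its first two marginals.\<close>

definition xlnx :: "real \<Rightarrow> real" where
  "xlnx t = t * ln t"

lemma xlnx_0 [simp]: "xlnx 0 = 0" and xlnx_1 [simp]: "xlnx 1 = 0"
  by (simp_all add: xlnx_def)

lemma xlnx_mult: "0 \<le> s \<Longrightarrow> 0 \<le> t \<Longrightarrow> xlnx (s * t) = s * xlnx t + xlnx s * t"
  by (cases "s = 0"; cases "t = 0") (auto simp: xlnx_def ln_mult algebra_simps)

lemma continuous_on_xlnx: "continuous_on UNIV xlnx"
proof -
  have "isCont xlnx t" for t
  proof (cases "t = 0")
    case True
    have "((\<lambda>t::real. t * ln t) \<longlongrightarrow> 0) (at_right 0)" by real_asymp
    \<comment> \<open>The library \<open>ln\<close> satisfies ln(-t) = ln t, so \<open>xlnx\<close>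
      is odd and the left limit reduces to the right one. Continuity on the whole line spares sign
      conditions in the compactness argument.\<close>
    moreover have "((\<lambda>t::real. t * ln t) \<longlongrightarrow> 0) (at_left 0)"
    proof -
      have "((\<lambda>t::real. - (t * ln t)) \<longlongrightarrow> 0) (at_right 0)" by real_asymp
      then show ?thesis
        by (subst at_left_minus) (simp add: filterlim_filtermap ln_minus)
    qed
    ultimately have "((\<lambda>t::real. t * ln t) \<longlongrightarrow> 0) (at 0)"
      by (simp add: filterlim_split_at)
    then show ?thesis
      using True by (simp add: isCont_def xlnx_def[abs_def])
  next
    case False
    then show ?thesis
      unfolding xlnx_def[abs_def] by (intro continuous_intros) auto
  qed
  then show ?thesis by (simp add: continuous_at_imp_continuous_on)
qed

lemma DERIV_xlnx: "0 < t \<Longrightarrow> (xlnx has_real_derivative ln t + 1) (at t)"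
  unfolding xlnx_def[abs_def] by (auto intro!: derivative_eq_intros)

text \<open>This is \<open>ln r <= r - 1\<close> at r = s / t. The point t = 0 is allowed although
  the slope is infinite there, so perturbations may start or end at a vanishing coordinate as long
  as the tangent is taken at the other end.\<close>

lemma xlnx_tangent:
  assumes "0 < s" "0 \<le> t"
  shows "xlnx s + (t - s) * (ln s + 1) \<le> xlnx t"
proof (cases "t = 0")
  case True
  then show ?thesis using assms by (simp add: xlnx_def algebra_simps)
next
  case False
  with assms have t: "0 < t" by simp
  have "ln (s / t) \<le> s / t - 1" using assms t by (intro ln_le_minus_one) simp
  then have "t * (ln s - ln t) \<le> s - t"
    using assms t by (simp add: ln_div field_simps)
  then show ?thesis by (simp add: xlnx_def algebra_simps)
qed

text \<open>The log sum inequality. The bound of \<open>m\<close> by \<open>n\<close> guarantees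
  \<open>n i > 0\<close> wherever \<open>m i > 0\<close>, so no convention for ln 0
  interferes.\<close>

lemma log_sum:
  fixes m n :: "'i \<Rightarrow> real"
  assumes "finite I" "\<And>i. i \<in> I \<Longrightarrow> 0 \<le> m i" "\<And>i. i \<in> I \<Longrightarrow> m i \<le> n i"
  shows "(\<Sum>i\<in>I. m i * (ln (n i) - ln (m i))) \<le> sum m I * (ln (sum n I) - ln (sum m I))"
proof (cases "sum m I = 0")
  case True
  then have "\<forall>i\<in>I. m i = 0" using assms sum_nonneg_eq_0_iff[of I m] by auto
  then show ?thesis by simp
next
  case False
  define M N where "M = sum m I" and "N = sum n I"
  have M: "M > 0" using False assms(2) by (simp add: M_def less_le sum_nonneg)
  have "M \<le> N" unfolding M_def N_def by (intro sum_mono assms)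
  with M have N: "N > 0" by simp
  \<comment> \<open>\<open>ln r <= r - 1\<close> at r = n_i M / (m_i N). The linear corrections add
    up to N (M / N) - M = 0.\<close>
  have "m i * (ln (n i) - ln (m i)) \<le> m i * (ln N - ln M) + (n i * (M / N) - m i)" if "i \<in> I" for i
  proof (cases "m i = 0")
    case True
    then show ?thesis using assms(2,3)[OF that] M N by simp
  next
    case False
    with assms(2,3)[OF that] have p: "0 < m i" "0 < n i" by auto
    have "ln ((n i * M) / (m i * N)) \<le> (n i * M) / (m i * N) - 1"
      using p M N by (intro ln_le_minus_one) simp
    then have "m i * ln ((n i * M) / (m i * N)) \<le> n i * (M / N) - m i"
      using p M N by (simp add: field_simps)
    moreover have "ln ((n i * M) / (m i * N)) = ln (n i) + ln M - ln (m i) - ln N"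
      using p M N by (simp add: ln_mult ln_div)
    ultimately have "m i * (ln (n i) + ln M - ln (m i) - ln N) \<le> n i * (M / N) - m i" by simp
    then show ?thesis by (simp add: algebra_simps)
  qed
  then have "(\<Sum>i\<in>I. m i * (ln (n i) - ln (m i)))
      \<le> (\<Sum>i\<in>I. m i * (ln N - ln M) + (n i * (M / N) - m i))"
    by (rule sum_mono)
  also have "\<dots> = M * (ln N - ln M) + (N * (M / N) - M)"
    unfolding sum.distrib sum_subtractf sum_distrib_right[symmetric] by (simp add: M_def N_def)
  finally show ?thesis using N by (simp add: M_def N_def)
qed

text \<open>Minus the Shannon entropy of the normalised vector, times its total mass. Summed over
  the values of a second variable it is minus a conditional entropy.\<close>

definition psi :: "'i set \<Rightarrow> ('i \<Rightarrow> real) \<Rightarrow> real" where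
  "psi I m = (\<Sum>i\<in>I. xlnx (m i)) - xlnx (sum m I)"

lemma psi_scale:
  assumes "0 \<le> c" "\<And>i. i \<in> I \<Longrightarrow> 0 \<le> m i"
  shows "psi I (\<lambda>i. c * m i) = c * psi I m"
proof -
  have "(\<Sum>i\<in>I. xlnx (c * m i)) = (\<Sum>i\<in>I. c * xlnx (m i) + xlnx c * m i)"
    by (intro sum.cong refl xlnx_mult assms)
  moreover have "xlnx (\<Sum>i\<in>I. c * m i) = c * xlnx (sum m I) + xlnx c * sum m I"
    unfolding sum_distrib_left[symmetric] by (intro xlnx_mult assms sum_nonneg)
  ultimately show ?thesis
    by (simp add: psi_def sum.distrib sum_distrib_left algebra_simps)
qed

text \<open>Concavity of entropy in homogeneous form: the log sum inequality for \<open>m\<close>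
  against \<open>m + n\<close>, and for \<open>n\<close> against \<open>m + n\<close>. Together with
  \<open>psi_scale\<close> it gives convexity.\<close>

lemma psi_add:
  assumes "finite I" "\<And>i. i \<in> I \<Longrightarrow> 0 \<le> m i" "\<And>i. i \<in> I \<Longrightarrow> 0 \<le> n i"
  shows "psi I (\<lambda>i. m i + n i) \<le> psi I m + psi I n"
proof -
  let ?N = "sum m I + sum n I"
  have eq: "xlnx (a + b) - xlnx a - xlnx b = a * (ln (a + b) - ln a) + b * (ln (a + b) - ln b)"
    for a b by (simp add: xlnx_def algebra_simps)
  have "(\<Sum>i\<in>I. m i * (ln (m i + n i) - ln (m i))) \<le> sum m I * (ln ?N - ln (sum m I))"
    "(\<Sum>i\<in>I. n i * (ln (m i + n i) - ln (n i))) \<le> sum n I * (ln ?N - ln (sum n I))"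
    using log_sum[of I m "\<lambda>i. m i + n i"] log_sum[of I n "\<lambda>i. m i + n i"] assms
    by (simp_all add: sum.distrib)
  then have "(\<Sum>i\<in>I. xlnx (m i + n i) - xlnx (m i) - xlnx (n i))
      \<le> xlnx ?N - xlnx (sum m I) - xlnx (sum n I)"
    unfolding eq by (simp add: sum.distrib)
  then show ?thesis by (simp add: psi_def sum.distrib sum_subtractf)
qed

lemma psi_sum:
  assumes "finite I" "finite J" "\<And>i j. i \<in> I \<Longrightarrow> j \<in> J \<Longrightarrow> 0 \<le> m j i"
  shows "psi I (\<lambda>i. \<Sum>j\<in>J. m j i) \<le> (\<Sum>j\<in>J. psi I (m j))"
  using assms(2,3)
proof (induction J)
  case empty
  then show ?case by (simp add: psi_def)
next
  case (insert j J)
  have "psi I (\<lambda>i. \<Sum>j\<in>insert j J. m j i) \<le> psi I (m j) + psi I (\<lambda>i. \<Sum>j\<in>J. m j i)"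
    using insert psi_add[of I "m j" "\<lambda>i. \<Sum>j\<in>J. m j i"] assms(1) by (simp add: sum_nonneg)
  then show ?case using insert by force
qed

lemma psi_convex:
  assumes "finite I" "0 \<le> t" "t \<le> 1" "\<And>i. i \<in> I \<Longrightarrow> 0 \<le> m i" "\<And>i. i \<in> I \<Longrightarrow> 0 \<le> n i"
  shows "psi I (\<lambda>i. t * m i + (1 - t) * n i) \<le> t * psi I m + (1 - t) * psi I n"
  using psi_add[of I "\<lambda>i. t * m i" "\<lambda>i. (1 - t) * n i"] assms by (simp add: psi_scale)

text \<open>The second difference with step h has derivative ln(1 - h^2 / t^2) < 0 in t: t ln t
  loses curvature as t grows. This is the source of strictness in condition (3).\<close>

lemma xlnx_gap_strict:
  assumes "0 < r" "h < t" "- h < t" "h \<noteq> 0"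
  shows "xlnx (t + r + h) + xlnx (t + r - h) - 2 * xlnx (t + r)
       < xlnx (t + h) + xlnx (t - h) - 2 * xlnx t"
proof -
  let ?k = "\<lambda>t. xlnx (t + h) + xlnx (t - h) - 2 * xlnx t"
  have d: "\<exists>D. (?k has_real_derivative D) (at s) \<and> D < 0" if "t \<le> s" for s
  proof (intro exI conjI)
    have s: "0 < s" "0 < s + h" "0 < s - h" using that assms by linarith+
    show "(?k has_real_derivative (ln (s + h) + 1) + (ln (s - h) + 1) - 2 * (ln s + 1)) (at s)"
      using s by (auto intro!: derivative_eq_intros DERIV_chain2[OF DERIV_xlnx])
    have "(s + h) * (s - h) < s * s" using assms(4) by (simp add: algebra_simps) (metis not_real_square_gt_zero)
    then have "ln ((s + h) * (s - h)) < ln (s * s)" using s by simp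
    then show "(ln (s + h) + 1) + (ln (s - h) + 1) - 2 * (ln s + 1) < 0"
      using s by (simp add: ln_mult)
  qed
  have "?k (t + r) < ?k t"
    by (rule DERIV_neg_imp_decreasing) (use assms d in auto)
  then show ?thesis by (simp add: algebra_simps)
qed

section \<open>The objective as a sum of entropies\<close>

text \<open>Minus the entropy of \<open>F\<close>, in the same shape as \<open>cmi\<close> so that
  information quantities split term by term.\<close>

definition plogp :: "('s \<Rightarrow> real) \<Rightarrow> ('s \<Rightarrow> 'c) \<Rightarrow> real" where
  "plogp \<mu> F = (\<Sum>s\<in>supp \<mu>. \<mu> s * ln (prb \<mu> (\<lambda>s'. F s' = F s)))"

text \<open>Entropy depends only on the partition induced by the variable, so tuples may be
  reordered and regrouped.\<close>

lemma plogp_cong: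
  assumes "\<And>s s'. F s' = F s \<longleftrightarrow> F' s' = F' s"
  shows "plogp \<mu> F = plogp \<mu> F'"
  by (simp add: plogp_def assms)

lemma prb_pos:
  assumes "finite (supp \<mu>)" "\<And>s. 0 \<le> \<mu> s" "s \<in> supp \<mu>" "E s"
  shows "0 < prb \<mu> E"
proof -
  have "0 < \<mu> s" using assms by (simp add: supp_def less_le)
  also have "\<mu> s = sum \<mu> {s}" by simp
  also have "\<dots> \<le> prb \<mu> E" unfolding prb_def using assms by (intro sum_mono2) auto
  finally show ?thesis .
qed

lemma prb_eq_sum:
  assumes "finite \<Omega>" "supp \<mu> \<subseteq> \<Omega>"
  shows "prb \<mu> E = (\<Sum>s\<in>\<Omega>. if E s then \<mu> s else 0)"
proof -
  have "(\<Sum>s\<in>\<Omega>. if E s then \<mu> s else 0) = sum \<mu> {s\<in>\<Omega>. E s}"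
    by (rule sum.inter_filter[symmetric]) (rule assms)
  also have "\<dots> = prb \<mu> E" unfolding prb_def
    by (rule sum.mono_neutral_right) (use assms in \<open>auto simp: supp_def\<close>)
  finally show ?thesis ..
qed

text \<open>The support, which changes with the law, is traded for a fixed box: points without mass
  and values not taken contribute \<open>xlnx 0 = 0\<close>. Entropy becomes one formula in the
  coordinates, ready for continuity and perturbation.\<close>

lemma plogp_eq_sum_xlnx:
  assumes "finite \<Omega>" "supp \<mu> \<subseteq> \<Omega>" "finite T" "F ` \<Omega> \<subseteq> T"
  shows "plogp \<mu> F = (\<Sum>c\<in>T. xlnx (\<Sum>s\<in>\<Omega>. if F s = c then \<mu> s else 0))"
proof -
  have "plogp \<mu> F = (\<Sum>s\<in>\<Omega>. \<mu> s * ln (prb \<mu> (\<lambda>s'. F s' = F s)))"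
    unfolding plogp_def by (rule sum.mono_neutral_left) (use assms in \<open>auto simp: supp_def\<close>)
  also have "\<dots> = (\<Sum>c\<in>T. \<Sum>s\<in>{s\<in>\<Omega>. F s = c}. \<mu> s * ln (prb \<mu> (\<lambda>s'. F s' = F s)))"
    by (rule sum.group[symmetric]) (use assms in auto)
  also have "\<dots> = (\<Sum>c\<in>T. xlnx (\<Sum>s\<in>\<Omega>. if F s = c then \<mu> s else 0))"
  proof (rule sum.cong[OF refl])
    fix c
    have "(\<Sum>s\<in>{s\<in>\<Omega>. F s = c}. \<mu> s * ln (prb \<mu> (\<lambda>s'. F s' = F s)))
        = (\<Sum>s\<in>{s\<in>\<Omega>. F s = c}. \<mu> s) * ln (prb \<mu> (\<lambda>s'. F s' = c))"
      unfolding sum_distrib_right by (rule sum.cong) auto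
    then show "(\<Sum>s\<in>{s\<in>\<Omega>. F s = c}. \<mu> s * ln (prb \<mu> (\<lambda>s'. F s' = F s)))
        = xlnx (\<Sum>s\<in>\<Omega>. if F s = c then \<mu> s else 0)"
      using assms(1) by (simp add: xlnx_def prb_eq_sum[OF assms(1,2)] sum.inter_filter)
  qed
  finally show ?thesis .
qed

lemma plogp_pair:
  assumes "finite \<Omega>" "supp \<mu> \<subseteq> \<Omega>" "finite S" "finite T" "F ` \<Omega> \<subseteq> S" "G ` \<Omega> \<subseteq> T"
    and "\<And>i j. i \<in> S \<Longrightarrow> j \<in> T \<Longrightarrow> (\<Sum>s\<in>\<Omega>. if F s = i \<and> G s = j then \<mu> s else 0) = g i j"
  shows "plogp \<mu> (\<lambda>s. (F s, G s)) = (\<Sum>j\<in>T. \<Sum>i\<in>S. xlnx (g i j))"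
proof -
  have "plogp \<mu> (\<lambda>s. (F s, G s)) = (\<Sum>c\<in>S \<times> T. xlnx (\<Sum>s\<in>\<Omega>. if (F s, G s) = c then \<mu> s else 0))"
    using assms by (intro plogp_eq_sum_xlnx) auto
  also have "\<dots> = (\<Sum>i\<in>S. \<Sum>j\<in>T. xlnx (g i j))"
    using assms(7) by (simp add: sum.cartesian_product')
  finally show ?thesis using sum.swap[of "\<lambda>i j. xlnx (g i j)" T S] by simp
qed

lemma plogp_triple:
  assumes "finite \<Omega>" "supp \<mu> \<subseteq> \<Omega>" "finite S" "finite T" "finite R" "F ` \<Omega> \<subseteq> S" "G ` \<Omega> \<subseteq> T" "H ` \<Omega> \<subseteq> R"
    and "\<And>i j k. i \<in> S \<Longrightarrow> j \<in> T \<Longrightarrow> k \<in> R \<Longrightarrow> (\<Sum>s\<in>\<Omega>. if F s = i \<and> G s = j \<and> H s = k then \<mu> s else 0) = g i j k"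
  shows "plogp \<mu> (\<lambda>s. (F s, G s, H s)) = (\<Sum>k\<in>R. \<Sum>j\<in>T. \<Sum>i\<in>S. xlnx (g i j k))"
proof -
  have "plogp \<mu> (\<lambda>s. (F s, G s, H s)) = (\<Sum>c\<in>T \<times> R. \<Sum>i\<in>S. xlnx (g i (fst c) (snd c)))"
    by (rule plogp_pair[OF assms(1-3)]) (use assms in \<open>auto simp: prod_eq_iff\<close>)
  also have "\<dots> = (\<Sum>j\<in>T. \<Sum>k\<in>R. \<Sum>i\<in>S. xlnx (g i j k))" by (simp add: sum.cartesian_product')
  finally show ?thesis using sum.swap[of "\<lambda>j k. \<Sum>i\<in>S. xlnx (g i j k)" R T] by simp
qed

lemma cmi_eq_plogp:
  assumes "finite (supp \<mu>)" "\<And>s. 0 \<le> \<mu> s"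
  shows "cmi \<mu> A B C = plogp \<mu> (\<lambda>s. (A s, B s, C s)) + plogp \<mu> C
     - plogp \<mu> (\<lambda>s. (A s, C s)) - plogp \<mu> (\<lambda>s. (B s, C s))"
proof -
  have "\<mu> s * ln (prb \<mu> (\<lambda>s'. A s' = A s \<and> B s' = B s \<and> C s' = C s) * prb \<mu> (\<lambda>s'. C s' = C s)
       / (prb \<mu> (\<lambda>s'. A s' = A s \<and> C s' = C s) * prb \<mu> (\<lambda>s'. B s' = B s \<and> C s' = C s)))
     = \<mu> s * ln (prb \<mu> (\<lambda>s'. A s' = A s \<and> B s' = B s \<and> C s' = C s))
       + \<mu> s * ln (prb \<mu> (\<lambda>s'. C s' = C s))
       - \<mu> s * ln (prb \<mu> (\<lambda>s'. A s' = A s \<and> C s' = C s))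
       - \<mu> s * ln (prb \<mu> (\<lambda>s'. B s' = B s \<and> C s' = C s))" if s: "s \<in> supp \<mu>" for s
  proof -
    have "0 < prb \<mu> E" if "E s" for E using prb_pos[of \<mu> s E] assms s that by simp
    then have "0 < prb \<mu> (\<lambda>s'. A s' = A s \<and> B s' = B s \<and> C s' = C s)" "0 < prb \<mu> (\<lambda>s'. C s' = C s)"
      "0 < prb \<mu> (\<lambda>s'. A s' = A s \<and> C s' = C s)" "0 < prb \<mu> (\<lambda>s'. B s' = B s \<and> C s' = C s)"
      by simp_all
    then show ?thesis by (simp add: ln_mult ln_div algebra_simps)
  qed
  then show ?thesis
    unfolding cmi_def plogp_def prod.inject by (simp add: sum.distrib sum_subtractf cong: sum.cong)
qed

lemma plogp_const:
  assumes "is_dist \<mu>"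
  shows "plogp \<mu> (\<lambda>_. c) = 0"
  using assms by (simp add: plogp_def is_dist_def prb_def)

lemma mi_eq_plogp:
  assumes "finite (supp \<mu>)" "\<And>s. 0 \<le> \<mu> s"
  shows "mi \<mu> A B = plogp \<mu> (\<lambda>s. (A s, B s)) + plogp \<mu> (\<lambda>_. ()) - plogp \<mu> A - plogp \<mu> B"
proof -
  have "plogp \<mu> (\<lambda>s. (A s, B s, ())) = plogp \<mu> (\<lambda>s. (A s, B s))"
    "plogp \<mu> (\<lambda>s. (A s, ())) = plogp \<mu> A" "plogp \<mu> (\<lambda>s. (B s, ())) = plogp \<mu> B"
    by (rule plogp_cong; simp)+
  then show ?thesis by (simp add: mi_def cmi_eq_plogp[OF assms])
qed

section \<open>The objective in terms of blocks\<close>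

type_synonym 'x law = "nat \<times> nat \<times> nat \<times> 'x \<Rightarrow> real"

definition marg :: "('x::finite \<Rightarrow> 'y \<Rightarrow> real) \<Rightarrow> 'v set \<Rightarrow> ('u \<Rightarrow> 'v \<Rightarrow> 'x \<Rightarrow> real) \<Rightarrow> 'u \<Rightarrow> 'y \<Rightarrow> real" where
  "marg a B P u y = (\<Sum>v\<in>B. \<Sum>x\<in>UNIV. P u v x * a x y)"

definition outp :: "('x::finite \<Rightarrow> 'y \<Rightarrow> real) \<Rightarrow> 'u set \<Rightarrow> 'v set \<Rightarrow> ('u \<Rightarrow> 'v \<Rightarrow> 'x \<Rightarrow> real) \<Rightarrow> 'y \<Rightarrow> real" where
  "outp a A B P y = (\<Sum>u\<in>A. marg a B P u y)"

definition flip :: "('u \<Rightarrow> 'v \<Rightarrow> 'x \<Rightarrow> real) \<Rightarrow> 'v \<Rightarrow> 'u \<Rightarrow> 'x \<Rightarrow> real" where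
  "flip P = (\<lambda>v u x. P u v x)"

definition side :: "real \<Rightarrow> ('x::finite \<Rightarrow> 'y::finite \<Rightarrow> real) \<Rightarrow> 'u set \<Rightarrow> 'v set \<Rightarrow> ('u \<Rightarrow> 'v \<Rightarrow> 'x \<Rightarrow> real) \<Rightarrow> real" where
  "side c a A B P = (\<Sum>y\<in>UNIV. \<Sum>u\<in>A. xlnx (marg a B P u y)) - c * (\<Sum>y\<in>UNIV. xlnx (outp a A B P y))"

text \<open>This is the function \<open>F\<close> of the introduction; \<open>side\<close> collects the terms of one receiver, and \<open>flip\<close>
  exchanges the roles of \<open>U\<close> and \<open>V\<close>.\<close>

definition blk :: "real \<Rightarrow> ('x::finite \<Rightarrow> 'y::finite \<Rightarrow> real) \<Rightarrow> ('x \<Rightarrow> 'z::finite \<Rightarrow> real) \<Rightarrow>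
    'u set \<Rightarrow> 'v set \<Rightarrow> ('u \<Rightarrow> 'v \<Rightarrow> 'x \<Rightarrow> real) \<Rightarrow> real" where
  "blk lam a b A B P = side (1 - lam) a A B P + side lam b B A (flip P)
     - (\<Sum>u\<in>A. \<Sum>v\<in>B. xlnx (\<Sum>x\<in>UNIV. P u v x))"

definition slice :: "('u \<times> 'v \<times> 'w \<times> 'x \<Rightarrow> real) \<Rightarrow> 'w \<Rightarrow> 'u \<Rightarrow> 'v \<Rightarrow> 'x \<Rightarrow> real" where
  "slice p = (\<lambda>w u v x. p (u, v, w, x))"

definition tot :: "('x::finite \<Rightarrow> 'y::finite \<Rightarrow> real) \<Rightarrow> 'u set \<Rightarrow> 'v set \<Rightarrow> 'w set \<Rightarrow>
    ('w \<Rightarrow> 'u \<Rightarrow> 'v \<Rightarrow> 'x \<Rightarrow> real) \<Rightarrow> real" where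
  "tot a A B C Q = (\<Sum>y\<in>UNIV. xlnx (\<Sum>w\<in>C. outp a A B (Q w) y))"

definition gobj :: "real \<Rightarrow> ('x::finite \<Rightarrow> 'y::finite \<Rightarrow> real) \<Rightarrow> ('x \<Rightarrow> 'z::finite \<Rightarrow> real) \<Rightarrow>
    'u set \<Rightarrow> 'v set \<Rightarrow> 'w set \<Rightarrow> ('w \<Rightarrow> 'u \<Rightarrow> 'v \<Rightarrow> 'x \<Rightarrow> real) \<Rightarrow> real" where
  "gobj lam a b A B C Q = (\<Sum>w\<in>C. blk lam a b A B (Q w))
     - lam * tot a A B C Q - (1 - lam) * tot b A B C Q"

lemma flip_flip [simp]: "flip (flip P) = P"
  by (simp add: flip_def)

lemma outp_flip: "outp b B A (flip P) z = outp b A B P z"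
  unfolding outp_def marg_def flip_def by (rule sum.swap)

lemma blk_flip: "blk (1 - lam) b a B A (flip P) = blk lam a b A B P"
  unfolding blk_def by (simp add: flip_def sum.swap[of _ B A])

lemma gobj_flip: "gobj (1 - lam) b a B A C (\<lambda>w. flip (Q w)) = gobj lam a b A B C Q"
  unfolding gobj_def by (simp add: blk_flip tot_def outp_flip)

lemma is_dist_joint:
  fixes q :: "'x::finite \<Rightarrow> 'y::finite \<Rightarrow> 'z::finite \<Rightarrow> real"
  assumes "is_bc q" "is_dist p"
  shows "is_dist (joint p q)"
proof -
  let ?S = "supp p \<times> (UNIV :: ('y \<times> 'z) set)"
  have sub: "supp (joint p q) \<subseteq> ?S" by (auto simp: supp_def joint_def)
  have fin: "finite ?S" using assms by (simp add: is_dist_def)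
  have "sum (joint p q) (supp (joint p q)) = sum (joint p q) ?S"
    by (rule sum.mono_neutral_left[OF fin sub]) (auto simp: supp_def)
  also have "\<dots> = (\<Sum>s\<in>supp p. \<Sum>yz\<in>UNIV. joint p q (s, yz))"
    by (simp only: sum.cartesian_product')
  also have "\<dots> = (\<Sum>s\<in>supp p. p s * (\<Sum>y\<in>UNIV. \<Sum>z\<in>UNIV. q (snd (snd (snd s))) y z))"
    by (simp add: UNIV_Times_UNIV[symmetric] sum.cartesian_product' sum_distrib_left joint_def
        case_prod_beta del: UNIV_Times_UNIV)
  finally show ?thesis
    using assms finite_subset[OF sub fin] by (auto simp: is_dist_def is_bc_def joint_def)
qed

text \<open>The box is free, as cells off the support contribute nothing. Each later argument picks
  a box that suits its construction.\<close>

lemma objective_eq_gobj: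
  fixes q :: "'x::finite \<Rightarrow> 'y::finite \<Rightarrow> 'z::finite \<Rightarrow> real"
  assumes q: "is_bc q" and p: "is_dist p" and fin: "finite A" "finite B" "finite C"
    and sub: "supp p \<subseteq> A \<times> B \<times> C \<times> UNIV"
  shows "objective lam q p = gobj lam (qY q) (qZ q) A B C (slice p)"
proof -
  let ?J = "joint p q"
  let ?\<Omega> = "(A \<times> B \<times> C \<times> (UNIV :: 'x set)) \<times> (UNIV :: 'y set) \<times> (UNIV :: 'z set)"
  have J: "is_dist ?J" by (rule is_dist_joint[OF q p])
  then have J': "finite (supp ?J)" "\<And>s. 0 \<le> ?J s" by (auto simp: is_dist_def)
  have \<Omega>: "finite ?\<Omega>" using fin by simp
  have sJ: "supp ?J \<subseteq> ?\<Omega>" using sub by (force simp: supp_def joint_def)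
  have cyc: "plogp ?J (\<lambda>s. (rvW s, rvY s)) = plogp ?J (\<lambda>s. (rvY s, rvW s))"
     "plogp ?J (\<lambda>s. (rvW s, rvZ s)) = plogp ?J (\<lambda>s. (rvZ s, rvW s))"
     "plogp ?J (\<lambda>s. (rvU s, rvV s, rvW s)) = plogp ?J (\<lambda>s. (rvV s, rvU s, rvW s))"
    by (rule plogp_cong; auto)+
  \<comment> \<open>The pair (Y, W) gets -1 from I(U;Y|W) and +\<open>lam\<close> from
    \<open>lam\<close> I(W;Y), hence -(1 - \<open>lam\<close>); likewise (Z, W) gets
    -\<open>lam\<close>. These are the coefficients \<open>c\<close> in \<open>side\<close>.\<close>
  have obj: "objective lam q p = plogp ?J (\<lambda>s. (rvU s, rvY s, rvW s)) + plogp ?J (\<lambda>s. (rvV s, rvZ s, rvW s))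
     - plogp ?J (\<lambda>s. (rvV s, rvU s, rvW s)) - (1 - lam) * plogp ?J (\<lambda>s. (rvY s, rvW s))
     - lam * plogp ?J (\<lambda>s. (rvZ s, rvW s)) - lam * plogp ?J rvY - (1 - lam) * plogp ?J rvZ"
    unfolding objective_def Let_def mi_eq_plogp[OF J'] cmi_eq_plogp[OF J'] plogp_const[OF J] cyc
    by (simp add: algebra_simps)
  have sumO: "(\<Sum>s\<in>?\<Omega>. f s) = (\<Sum>u\<in>A. \<Sum>v\<in>B. \<Sum>w\<in>C. \<Sum>x\<in>UNIV. \<Sum>y\<in>UNIV. \<Sum>z\<in>UNIV. f ((u,v,w,x),y,z))"
    for f :: "_ \<Rightarrow> real"
    by (simp only: sum.cartesian_product')
  have ifc: "(\<Sum>i\<in>I. if c then f i else 0) = (if c then sum f I else 0)" for c and f :: "'i \<Rightarrow> real" and I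
    by simp
  have ifconj: "(if c \<and> d then r else 0) = (if c then if d then r else 0 else 0)" for c d and r :: real
    by simp
  note eval = sumO rvU_def rvV_def rvW_def rvY_def rvZ_def joint_def prod.case prod.inject ifconj
  have sumq: "(\<Sum>y\<in>UNIV. \<Sum>z\<in>UNIV. p s * q x y z) = p s" for s x
    using q by (simp add: is_bc_def sum_distrib_left[symmetric])
  note rv = rvU_def rvV_def rvW_def rvY_def rvZ_def
    and ev = ifc marg_def outp_def flip_def slice_def qY_def qZ_def sum_distrib_left sumq
  have 1: "plogp ?J (\<lambda>s. (rvU s, rvY s, rvW s)) = (\<Sum>w\<in>C. \<Sum>y\<in>UNIV. \<Sum>u\<in>A. xlnx (marg (qY q) B (slice p w) u y))"
    by (rule plogp_triple[OF \<Omega> sJ fin(1) finite fin(3)])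
       ((unfold eval, use fin in \<open>simp add: ev split del: if_split\<close>; fail) | force simp: rv)+
  have 2: "plogp ?J (\<lambda>s. (rvV s, rvZ s, rvW s)) = (\<Sum>w\<in>C. \<Sum>z\<in>UNIV. \<Sum>v\<in>B. xlnx (marg (qZ q) A (flip (slice p w)) v z))"
    by (rule plogp_triple[OF \<Omega> sJ fin(2) finite fin(3)])
       ((unfold eval, use fin in \<open>simp add: ev split del: if_split\<close>; fail) | force simp: rv)+
  have 3: "plogp ?J (\<lambda>s. (rvV s, rvU s, rvW s)) = (\<Sum>w\<in>C. \<Sum>u\<in>A. \<Sum>v\<in>B. xlnx (\<Sum>x\<in>UNIV. slice p w u v x))"
    by (rule plogp_triple[OF \<Omega> sJ fin(2) fin(1) fin(3)])
       ((unfold eval, use fin in \<open>simp add: ev split del: if_split\<close>; fail) | force simp: rv)+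
  have 4: "plogp ?J (\<lambda>s. (rvY s, rvW s)) = (\<Sum>w\<in>C. \<Sum>y\<in>UNIV. xlnx (outp (qY q) A B (slice p w) y))"
    by (rule plogp_pair[OF \<Omega> sJ finite fin(3)])
       ((unfold eval, use fin in \<open>simp add: ev split del: if_split\<close>; fail) | force simp: rv)+
  have 5: "plogp ?J (\<lambda>s. (rvZ s, rvW s)) = (\<Sum>w\<in>C. \<Sum>z\<in>UNIV. xlnx (outp (qZ q) A B (slice p w) z))"
    by (rule plogp_pair[OF \<Omega> sJ finite fin(3)])
       ((unfold eval, use fin in \<open>simp add: ev split del: if_split\<close>; fail) | force simp: rv)+
  have 6: "plogp ?J rvY = tot (qY q) A B C (slice p)"
  proof -
    have "(\<Sum>s\<in>?\<Omega>. if rvY s = y then ?J s else 0) = (\<Sum>w\<in>C. outp (qY q) A B (slice p w) y)" for y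
      unfolding eval using fin by (simp add: ifc marg_def outp_def slice_def qY_def sum_distrib_left
          sum.swap[of _ C A] sum.swap[of _ C B] split del: if_split)
    then show ?thesis by (subst plogp_eq_sum_xlnx[OF \<Omega> sJ, where T = UNIV]) (simp_all add: tot_def)
  qed
  have 7: "plogp ?J rvZ = tot (qZ q) A B C (slice p)"
  proof -
    have "(\<Sum>s\<in>?\<Omega>. if rvZ s = z then ?J s else 0) = (\<Sum>w\<in>C. outp (qZ q) A B (slice p w) z)" for z
      unfolding eval using fin by (simp add: ifc marg_def outp_def slice_def qZ_def sum_distrib_left
          sum.swap[of _ C A] sum.swap[of _ C B] split del: if_split)
    then show ?thesis by (subst plogp_eq_sum_xlnx[OF \<Omega> sJ, where T = UNIV]) (simp_all add: tot_def)
  qed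
  show ?thesis
    unfolding obj 1 2 3 4 5 6 7 gobj_def blk_def side_def outp_flip
    by (simp add: sum.distrib sum_subtractf sum_distrib_left)
qed

section \<open>Convexity along perturbations\<close>

definition pos_channel :: "('x \<Rightarrow> 'y::finite \<Rightarrow> real) \<Rightarrow> bool" where
  "pos_channel a \<longleftrightarrow> (\<forall>x y. 0 < a x y) \<and> (\<forall>x. (\<Sum>y\<in>UNIV. a x y) = 1)"

lemma pos_channelD:
  assumes "pos_channel a"
  shows "0 < a x y" "0 \<le> a x y" "(\<Sum>y\<in>UNIV. a x y) = 1"
  using assms by (auto simp: pos_channel_def less_imp_le)

definition mass :: "'u set \<Rightarrow> 'v set \<Rightarrow> ('u \<Rightarrow> 'v \<Rightarrow> 'x::finite \<Rightarrow> real) \<Rightarrow> real" where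
  "mass A B P = (\<Sum>u\<in>A. \<Sum>v\<in>B. \<Sum>x\<in>UNIV. P u v x)"

definition inp :: "'u set \<Rightarrow> 'v set \<Rightarrow> ('u \<Rightarrow> 'v \<Rightarrow> 'x \<Rightarrow> real) \<Rightarrow> 'x \<Rightarrow> real" where
  "inp A B P x = (\<Sum>u\<in>A. \<Sum>v\<in>B. P u v x)"

lemma marg_nonneg:
  assumes "pos_channel a" "\<And>v x. v \<in> B \<Longrightarrow> 0 \<le> P u v x"
  shows "0 \<le> marg a B P u y"
  unfolding marg_def using assms by (auto intro!: sum_nonneg mult_nonneg_nonneg simp: pos_channelD)

lemma outp_nonneg:
  assumes "pos_channel a" "\<And>u v x. u \<in> A \<Longrightarrow> v \<in> B \<Longrightarrow> 0 \<le> P u v x"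
  shows "0 \<le> outp a A B P y"
  unfolding outp_def using assms by (auto intro!: sum_nonneg marg_nonneg)

lemma sum_marg:
  assumes "pos_channel a"
  shows "(\<Sum>y\<in>UNIV. marg a B P u y) = (\<Sum>v\<in>B. \<Sum>x\<in>UNIV. P u v x)"
proof -
  have "(\<Sum>y\<in>UNIV. marg a B P u y) = (\<Sum>v\<in>B. \<Sum>x\<in>UNIV. \<Sum>y\<in>UNIV. P u v x * a x y)"
    unfolding marg_def by (subst sum.swap, intro sum.cong refl, subst sum.swap) simp
  then show ?thesis by (simp add: sum_distrib_left[symmetric] pos_channelD(3)[OF assms])
qed

lemma sum_outp:
  assumes "pos_channel a"
  shows "(\<Sum>y\<in>UNIV. outp a A B P y) = mass A B P"
  unfolding outp_def mass_def by (subst sum.swap) (simp add: sum_marg[OF assms])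

text \<open>The output depends on the block through the law of X alone. Hence H(Y) and H(Z) are
  frozen by every rearrangement that keeps that law.\<close>

lemma outp_eq_inp: "outp a A B P y = (\<Sum>x\<in>UNIV. inp A B P x * a x y)"
proof -
  have "outp a A B P y = (\<Sum>u\<in>A. \<Sum>x\<in>UNIV. \<Sum>v\<in>B. P u v x * a x y)"
    unfolding outp_def marg_def by (intro sum.cong refl sum.swap)
  also have "\<dots> = (\<Sum>x\<in>UNIV. \<Sum>u\<in>A. \<Sum>v\<in>B. P u v x * a x y)" by (rule sum.swap)
  finally show ?thesis by (simp add: inp_def sum_distrib_right)
qed

text \<open>Only the (u,x)-marginal enters, which is what the row profiles control.\<close>

lemma marg_eq_inp: "marg a B P u y = (\<Sum>x\<in>UNIV. (\<Sum>v\<in>B. P u v x) * a x y)"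
  unfolding marg_def sum_distrib_right by (rule sum.swap)

lemma mass_flip: "mass B A (flip P) = mass A B P"
  unfolding mass_def flip_def by (rule sum.swap)

lemma marg_scale: "marg a B (\<lambda>u v x. k u * P u v x) u y = k u * marg a B P u y"
  by (simp add: marg_def sum_distrib_left mult.assoc)

lemma marg_mix: "marg a B (\<lambda>u v x. s * P u v x + t * R u v x) u y = s * marg a B P u y + t * marg a B R u y"
  by (simp add: marg_def sum.distrib sum_distrib_left algebra_simps)

lemma outp_mix: "outp a A B (\<lambda>u v x. s * P u v x + t * R u v x) y = s * outp a A B P y + t * outp a A B R y"
  by (simp add: outp_def marg_mix sum.distrib sum_distrib_left)

lemma outp_scale: "outp a A B (\<lambda>u v x. c * P u v x) y = c * outp a A B P y"
  by (simp add: outp_def marg_scale[of a B "\<lambda>_. c"] sum_distrib_left)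

lemma side_scale:
  assumes a: "pos_channel a" and c: "0 \<le> c" and P: "\<And>u v x. u \<in> A \<Longrightarrow> v \<in> B \<Longrightarrow> 0 \<le> P u v x"
  shows "side l a A B (\<lambda>u v x. c * P u v x) = c * side l a A B P + (1 - l) * xlnx c * mass A B P"
proof -
  have "(\<Sum>u\<in>A. xlnx (marg a B (\<lambda>u v x. c * P u v x) u y))
      = c * (\<Sum>u\<in>A. xlnx (marg a B P u y)) + xlnx c * outp a A B P y" for y
    using c P by (simp add: marg_scale[of a B "\<lambda>_. c"] xlnx_mult marg_nonneg[OF a] sum.distrib
        sum_distrib_left outp_def cong: sum.cong)
  moreover have "xlnx (outp a A B (\<lambda>u v x. c * P u v x) y)
      = c * xlnx (outp a A B P y) + xlnx c * outp a A B P y" for y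
    using c P by (simp add: outp_scale xlnx_mult outp_nonneg[OF a])
  ultimately show ?thesis
    by (simp add: side_def sum.distrib sum_distrib_left[symmetric] sum_outp[OF a] algebra_simps)
qed

text \<open>By \<open>side_scale\<close> the two receivers deviate from homogeneity by
  \<open>lam\<close> and by 1 - \<open>lam\<close> times \<open>xlnx c * mass A B P\<close>.
  Together this is exactly the deviation of the (u,v) sum, which is subtracted.\<close>

lemma blk_scale:
  assumes a: "pos_channel a" and b: "pos_channel b" and c: "0 \<le> c"
    and P: "\<And>u v x. u \<in> A \<Longrightarrow> v \<in> B \<Longrightarrow> 0 \<le> P u v x"
  shows "blk lam a b A B (\<lambda>u v x. c * P u v x) = c * blk lam a b A B P"
proof -
  have "(\<Sum>u\<in>A. \<Sum>v\<in>B. xlnx (\<Sum>x\<in>UNIV. c * P u v x))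
      = c * (\<Sum>u\<in>A. \<Sum>v\<in>B. xlnx (\<Sum>x\<in>UNIV. P u v x)) + xlnx c * mass A B P"
    using c P by (simp add: sum_distrib_left[symmetric] xlnx_mult sum_nonneg sum.distrib mass_def cong: sum.cong)
  moreover have "side l b B A (\<lambda>v u x. c * flip P v u x) = c * side l b B A (flip P) + (1 - l) * xlnx c * mass A B P" for l
    using P by (subst side_scale[OF b c]) (simp_all add: mass_flip, simp add: flip_def)
  moreover have "flip (\<lambda>u v x. c * P u v x) = (\<lambda>v u x. c * flip P v u x)"
    by (simp add: flip_def)
  ultimately show ?thesis
    by (simp add: blk_def side_scale[OF a c P] algebra_simps)
qed

text \<open>All terms of one receiver. They are separated from the (u,v) sum because they are convex
  in the law, whereas that sum enters with the wrong sign.\<close>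

definition bc_part :: "real \<Rightarrow> ('x::finite \<Rightarrow> 'y::finite \<Rightarrow> real) \<Rightarrow> 'u set \<Rightarrow> 'v set \<Rightarrow> 'w set \<Rightarrow>
    ('w \<Rightarrow> 'u \<Rightarrow> 'v \<Rightarrow> 'x \<Rightarrow> real) \<Rightarrow> real" where
  "bc_part lam a A B C Q = (\<Sum>w\<in>C. side (1 - lam) a A B (Q w)) - lam * tot a A B C Q"

definition uv_part :: "'u set \<Rightarrow> 'v set \<Rightarrow> 'w set \<Rightarrow> ('w \<Rightarrow> 'u \<Rightarrow> 'v \<Rightarrow> 'x::finite \<Rightarrow> real) \<Rightarrow> real" where
  "uv_part A B C Q = (\<Sum>w\<in>C. \<Sum>u\<in>A. \<Sum>v\<in>B. xlnx (\<Sum>x\<in>UNIV. Q w u v x))"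

lemma gobj_eq_parts:
  "gobj lam a b A B C Q = bc_part lam a A B C Q + bc_part (1 - lam) b B A C (\<lambda>w. flip (Q w)) - uv_part A B C Q"
  by (simp add: gobj_def bc_part_def uv_part_def blk_def sum.distrib sum_subtractf tot_def outp_flip)

text \<open>With M, S, T the sums over (u,y,w), (y,w) and y, the expression M - (1 -
  \<open>lam\<close>) S - \<open>lam\<close> T is regrouped as (M - S) + \<open>lam\<close> (S - T).
  For a probability law this is -H(U|Y,W) - \<open>lam\<close> H(W|Y), convex for \<open>lam\<close>
  >= 0.\<close>

lemma bc_part_eq_psi:
  "bc_part lam a A B C Q = (\<Sum>w\<in>C. \<Sum>y\<in>UNIV. psi A (\<lambda>u. marg a B (Q w) u y))
     + lam * (\<Sum>y\<in>UNIV. psi C (\<lambda>w. outp a A B (Q w) y))"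
proof -
  let ?M = "\<Sum>w\<in>C. \<Sum>y\<in>UNIV. \<Sum>u\<in>A. xlnx (marg a B (Q w) u y)"
  let ?S = "\<Sum>w\<in>C. \<Sum>y\<in>UNIV. xlnx (outp a A B (Q w) y)"
  have e1: "(\<Sum>w\<in>C. side (1 - lam) a A B (Q w)) = ?M - (1 - lam) * ?S"
    unfolding side_def sum_subtractf sum_distrib_left ..
  have e2: "(\<Sum>w\<in>C. \<Sum>y\<in>UNIV. psi A (\<lambda>u. marg a B (Q w) u y)) = ?M - ?S"
    unfolding psi_def outp_def sum_subtractf ..
  have e3: "(\<Sum>y\<in>UNIV. psi C (\<lambda>w. outp a A B (Q w) y)) = ?S - tot a A B C Q"
    unfolding psi_def tot_def sum_subtractf by (simp add: sum.swap[of _ UNIV C])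
  show ?thesis unfolding bc_part_def e1 e2 e3 by (simp add: algebra_simps)
qed

lemma bc_part_convex:
  assumes fin: "finite A" "finite B" "finite C" and a: "pos_channel a" and lam: "0 \<le> lam"
    and t: "0 \<le> t" "t \<le> 1"
    and Q1: "\<And>w u v x. w \<in> C \<Longrightarrow> u \<in> A \<Longrightarrow> v \<in> B \<Longrightarrow> 0 \<le> Q1 w u v x"
    and Q2: "\<And>w u v x. w \<in> C \<Longrightarrow> u \<in> A \<Longrightarrow> v \<in> B \<Longrightarrow> 0 \<le> Q2 w u v x"
  shows "bc_part lam a A B C (\<lambda>w u v x. t * Q1 w u v x + (1 - t) * Q2 w u v x)
     \<le> t * bc_part lam a A B C Q1 + (1 - t) * bc_part lam a A B C Q2"
proof -
  define Q where "Q = (\<lambda>w u v x. t * Q1 w u v x + (1 - t) * Q2 w u v x)"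
  let ?m = "\<lambda>Q w y. psi A (\<lambda>u. marg a B (Q w) u y)" and ?o = "\<lambda>Q y. psi C (\<lambda>w. outp a A B (Q w) y)"
  let ?M = "\<lambda>Q. \<Sum>w\<in>C. \<Sum>y\<in>UNIV. ?m Q w y" and ?O = "\<lambda>Q. \<Sum>y\<in>UNIV. ?o Q y"
  have "?m Q w y \<le> t * ?m Q1 w y + (1 - t) * ?m Q2 w y" if "w \<in> C" for w y
    unfolding Q_def marg_mix using fin t Q1 Q2 that by (intro psi_convex) (auto intro: marg_nonneg[OF a])
  then have "?M Q \<le> (\<Sum>w\<in>C. \<Sum>y\<in>UNIV. t * ?m Q1 w y + (1 - t) * ?m Q2 w y)"
    by (intro sum_mono)
  also have "\<dots> = t * ?M Q1 + (1 - t) * ?M Q2"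
    unfolding sum.distrib sum_distrib_left ..
  finally have M: "?M Q \<le> t * ?M Q1 + (1 - t) * ?M Q2" .
  have "?o Q y \<le> t * ?o Q1 y + (1 - t) * ?o Q2 y" for y
    unfolding Q_def outp_mix using fin t Q1 Q2 by (intro psi_convex) (auto intro: outp_nonneg[OF a])
  then have "?O Q \<le> (\<Sum>y\<in>UNIV. t * ?o Q1 y + (1 - t) * ?o Q2 y)"
    by (intro sum_mono)
  also have "\<dots> = t * ?O Q1 + (1 - t) * ?O Q2"
    unfolding sum.distrib sum_distrib_left ..
  finally have "lam * ?O Q \<le> lam * (t * ?O Q1 + (1 - t) * ?O Q2)"
    using lam by (rule mult_left_mono)
  with M have "bc_part lam a A B C Q \<le> t * bc_part lam a A B C Q1 + (1 - t) * bc_part lam a A B C Q2"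
    unfolding bc_part_eq_psi by (simp add: algebra_simps)
  then show ?thesis by (simp add: Q_def)
qed

text \<open>Along this perturbation the marginals of \<open>(U, W, Y)\<close> and \<open>(U, V, W)\<close> are multiplied by the same
  factor, so their entropies differ by a quantity that is linear in the factor.\<close>

lemma bc_uv_part_scaleU:
  assumes a: "pos_channel a"
    and Q: "\<And>w u v x. w \<in> C \<Longrightarrow> u \<in> A \<Longrightarrow> v \<in> B \<Longrightarrow> 0 \<le> Q w u v x"
    and k: "\<And>w u. w \<in> C \<Longrightarrow> u \<in> A \<Longrightarrow> 0 \<le> k w u"
    and eq: "\<And>w y. w \<in> C \<Longrightarrow> (\<Sum>u\<in>A. k w u * marg a B (Q w) u y) = outp a A B (Q w) y"
  shows "bc_part lam a A B C (\<lambda>w u v x. k w u * Q w u v x) - uv_part A B C (\<lambda>w u v x. k w u * Q w u v x)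
    = (\<Sum>w\<in>C. \<Sum>u\<in>A. k w u * ((\<Sum>y\<in>UNIV. xlnx (marg a B (Q w) u y)) - (\<Sum>v\<in>B. xlnx (\<Sum>x\<in>UNIV. Q w u v x))))
      - (1 - lam) * (\<Sum>w\<in>C. \<Sum>y\<in>UNIV. xlnx (outp a A B (Q w) y)) - lam * tot a A B C Q"
proof -
  let ?Q = "\<lambda>w u v x. k w u * Q w u v x"
  have o: "outp a A B (?Q w) y = outp a A B (Q w) y" if "w \<in> C" for w y
    using eq[OF that] by (simp add: outp_def marg_scale)
  have m: "(\<Sum>y\<in>UNIV. xlnx (marg a B (?Q w) u y))
      = k w u * (\<Sum>y\<in>UNIV. xlnx (marg a B (Q w) u y)) + xlnx (k w u) * (\<Sum>v\<in>B. \<Sum>x\<in>UNIV. Q w u v x)"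
    if "w \<in> C" "u \<in> A" for w u
    using that Q k
    by (simp add: marg_scale xlnx_mult marg_nonneg[OF a] sum.distrib sum_distrib_left[symmetric] sum_marg[OF a])
  have uv: "(\<Sum>v\<in>B. xlnx (\<Sum>x\<in>UNIV. ?Q w u v x))
      = k w u * (\<Sum>v\<in>B. xlnx (\<Sum>x\<in>UNIV. Q w u v x)) + xlnx (k w u) * (\<Sum>v\<in>B. \<Sum>x\<in>UNIV. Q w u v x)"
    if "w \<in> C" "u \<in> A" for w u
    using that Q k
    by (simp add: sum_distrib_left[symmetric] xlnx_mult sum_nonneg sum.distrib cong: sum.cong)
  have "bc_part lam a A B C ?Q = (\<Sum>w\<in>C. \<Sum>u\<in>A. \<Sum>y\<in>UNIV. xlnx (marg a B (?Q w) u y))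
      - (1 - lam) * (\<Sum>w\<in>C. \<Sum>y\<in>UNIV. xlnx (outp a A B (?Q w) y)) - lam * tot a A B C ?Q"
    by (simp add: bc_part_def side_def sum_subtractf sum_distrib_left sum.swap[of _ A UNIV])
  also have "\<dots> = (\<Sum>w\<in>C. \<Sum>u\<in>A. \<Sum>y\<in>UNIV. xlnx (marg a B (?Q w) u y))
      - (1 - lam) * (\<Sum>w\<in>C. \<Sum>y\<in>UNIV. xlnx (outp a A B (Q w) y)) - lam * tot a A B C Q"
    by (simp add: o tot_def cong: sum.cong)
  finally show ?thesis
    by (simp add: uv_part_def m uv sum.distrib sum_subtractf right_diff_distrib cong: sum.cong)
qed

text \<open>The Y terms together with the (u,v) term are linear in the factor, since
  \<open>eq1\<close> and \<open>eq2\<close> keep the law of (Y, W). The Z terms are convex on every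
  line, so the sum is convex.\<close>

lemma gobj_convex_scaleU:
  assumes fin: "finite A" "finite B" "finite C" and a: "pos_channel a" and b: "pos_channel b"
    and lam: "lam \<le> 1" and t: "0 \<le> t" "t \<le> 1"
    and Q: "\<And>w u v x. w \<in> C \<Longrightarrow> u \<in> A \<Longrightarrow> v \<in> B \<Longrightarrow> 0 \<le> Q w u v x"
    and k1: "\<And>w u. w \<in> C \<Longrightarrow> u \<in> A \<Longrightarrow> 0 \<le> k1 w u" and k2: "\<And>w u. w \<in> C \<Longrightarrow> u \<in> A \<Longrightarrow> 0 \<le> k2 w u"
    and eq1: "\<And>w y. w \<in> C \<Longrightarrow> (\<Sum>u\<in>A. k1 w u * marg a B (Q w) u y) = outp a A B (Q w) y"
    and eq2: "\<And>w y. w \<in> C \<Longrightarrow> (\<Sum>u\<in>A. k2 w u * marg a B (Q w) u y) = outp a A B (Q w) y"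
    and mix: "\<And>w u. t * k1 w u + (1 - t) * k2 w u = 1"
  shows "gobj lam a b A B C Q \<le> t * gobj lam a b A B C (\<lambda>w u v x. k1 w u * Q w u v x)
     + (1 - t) * gobj lam a b A B C (\<lambda>w u v x. k2 w u * Q w u v x)"
proof -
  let ?Q1 = "\<lambda>w u v x. k1 w u * Q w u v x" and ?Q2 = "\<lambda>w u v x. k2 w u * Q w u v x"
  let ?f = "\<lambda>w u. (\<Sum>y\<in>UNIV. xlnx (marg a B (Q w) u y)) - (\<Sum>v\<in>B. xlnx (\<Sum>x\<in>UNIV. Q w u v x))"
  let ?c = "(1 - lam) * (\<Sum>w\<in>C. \<Sum>y\<in>UNIV. xlnx (outp a A B (Q w) y)) + lam * tot a A B C Q"
  have e1: "bc_part lam a A B C ?Q1 - uv_part A B C ?Q1 = (\<Sum>w\<in>C. \<Sum>u\<in>A. k1 w u * ?f w u) - ?c"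
    using bc_uv_part_scaleU[where k = k1 and Q = Q, OF a Q k1 eq1] by simp
  have e2: "bc_part lam a A B C ?Q2 - uv_part A B C ?Q2 = (\<Sum>w\<in>C. \<Sum>u\<in>A. k2 w u * ?f w u) - ?c"
    using bc_uv_part_scaleU[where k = k2 and Q = Q, OF a Q k2 eq2] by simp
  have e0: "bc_part lam a A B C Q - uv_part A B C Q = (\<Sum>w\<in>C. \<Sum>u\<in>A. ?f w u) - ?c"
    using bc_uv_part_scaleU[where k = "\<lambda>_ _. 1" and Q = Q, OF a Q] by (simp add: outp_def)
  have "(\<Sum>w\<in>C. \<Sum>u\<in>A. ?f w u) = (\<Sum>w\<in>C. \<Sum>u\<in>A. (t * k1 w u + (1 - t) * k2 w u) * ?f w u)"
    by (simp add: mix)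
  also have "\<dots> = t * (\<Sum>w\<in>C. \<Sum>u\<in>A. k1 w u * ?f w u) + (1 - t) * (\<Sum>w\<in>C. \<Sum>u\<in>A. k2 w u * ?f w u)"
    unfolding distrib_right sum.distrib by (simp add: sum_distrib_left mult.assoc)
  finally have lin: "bc_part lam a A B C Q - uv_part A B C Q
      = t * (bc_part lam a A B C ?Q1 - uv_part A B C ?Q1) + (1 - t) * (bc_part lam a A B C ?Q2 - uv_part A B C ?Q2)"
    unfolding e0 e1 e2 by (simp add: algebra_simps)
  have "t * k1 w u * Q w u v x + (1 - t) * k2 w u * Q w u v x = Q w u v x" for w u v x
    using mix[of w u] by (metis distrib_right mult_1)
  then have "(\<lambda>w. flip (Q w)) = (\<lambda>w v u x. t * flip (?Q1 w) v u x + (1 - t) * flip (?Q2 w) v u x)"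
    by (simp add: flip_def mult.assoc)
  then have "bc_part (1 - lam) b B A C (\<lambda>w. flip (Q w))
      \<le> t * bc_part (1 - lam) b B A C (\<lambda>w. flip (?Q1 w)) + (1 - t) * bc_part (1 - lam) b B A C (\<lambda>w. flip (?Q2 w))"
    using bc_part_convex[where ?Q1.0 = "\<lambda>w. flip (?Q1 w)" and ?Q2.0 = "\<lambda>w. flip (?Q2 w)" and t = t,
        OF fin(2,1,3) b _ t] lam Q k1 k2 by (simp add: flip_def)
  with lin show ?thesis by (simp add: gobj_eq_parts algebra_simps)
qed

text \<open>With the (u,v,w) law fixed, the subtracted sum is constant and only the two convex parts
  remain.\<close>

lemma gobj_convex_fixed_UV:
  assumes fin: "finite A" "finite B" "finite C" and a: "pos_channel a" and b: "pos_channel b"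
    and lam: "0 \<le> lam" "lam \<le> 1" and t: "0 \<le> t" "t \<le> 1"
    and Q1: "\<And>w u v x. w \<in> C \<Longrightarrow> u \<in> A \<Longrightarrow> v \<in> B \<Longrightarrow> 0 \<le> Q1 w u v x"
    and Q2: "\<And>w u v x. w \<in> C \<Longrightarrow> u \<in> A \<Longrightarrow> v \<in> B \<Longrightarrow> 0 \<le> Q2 w u v x"
    and eq: "\<And>w u v. (\<Sum>x\<in>UNIV. Q1 w u v x) = (\<Sum>x\<in>UNIV. Q2 w u v x)"
  shows "gobj lam a b A B C (\<lambda>w u v x. t * Q1 w u v x + (1 - t) * Q2 w u v x)
     \<le> t * gobj lam a b A B C Q1 + (1 - t) * gobj lam a b A B C Q2"
proof -
  define Q where "Q = (\<lambda>w u v x. t * Q1 w u v x + (1 - t) * Q2 w u v x)"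
  have "(\<Sum>x\<in>UNIV. Q w u v x) = (\<Sum>x\<in>UNIV. Q2 w u v x)" for w u v
    unfolding Q_def sum.distrib sum_distrib_left[symmetric] eq by (simp add: algebra_simps)
  then have uv: "uv_part A B C Q = uv_part A B C Q2" "uv_part A B C Q1 = uv_part A B C Q2"
    by (simp_all add: uv_part_def eq)
  have "(\<lambda>w. flip (Q w)) = (\<lambda>w v u x. t * flip (Q1 w) v u x + (1 - t) * flip (Q2 w) v u x)"
    by (simp add: Q_def flip_def)
  then have "bc_part (1 - lam) b B A C (\<lambda>w. flip (Q w))
      \<le> t * bc_part (1 - lam) b B A C (\<lambda>w. flip (Q1 w)) + (1 - t) * bc_part (1 - lam) b B A C (\<lambda>w. flip (Q2 w))"
    using bc_part_convex[where ?Q1.0 = "\<lambda>w. flip (Q1 w)" and ?Q2.0 = "\<lambda>w. flip (Q2 w)" and t = t,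
        OF fin(2,1,3) b _ t] lam Q1 Q2 by (simp add: flip_def)
  moreover have "bc_part lam a A B C Q \<le> t * bc_part lam a A B C Q1 + (1 - t) * bc_part lam a A B C Q2"
    using bc_part_convex[OF fin a lam(1) t] Q1 Q2 by (simp add: Q_def)
  ultimately have "gobj lam a b A B C Q \<le> t * gobj lam a b A B C Q1 + (1 - t) * gobj lam a b A B C Q2"
    by (simp add: gobj_eq_parts uv algebra_simps)
  then show ?thesis by (simp add: Q_def)
qed

lemma sum_outp_eq_inp: "(\<Sum>w\<in>C. outp c A B (Q w) y) = (\<Sum>x\<in>UNIV. (\<Sum>w\<in>C. inp A B (Q w) x) * c x y)"
  unfolding outp_eq_inp sum_distrib_right by (rule sum.swap)

text \<open>Neither the decomposition over W nor the alphabets matter, only the total law of X; so W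
  may be split or replaced freely.\<close>

lemma tot_cong_inp:
  assumes "\<And>x. (\<Sum>w\<in>C. inp A B (Q w) x) = (\<Sum>w\<in>C'. inp A' B' (Q' w) x)"
  shows "tot c A B C Q = tot c A' B' C' Q'"
  unfolding tot_def sum_outp_eq_inp assms ..

text \<open>Homogeneity makes the blocks linear in the weights, and \<open>eq\<close> freezes the
  output entropies: the objective is affine along such lines.\<close>

lemma gobj_scaleW:
  assumes a: "pos_channel a" and b: "pos_channel b"
    and Q: "\<And>w u v x. w \<in> C \<Longrightarrow> u \<in> A \<Longrightarrow> v \<in> B \<Longrightarrow> 0 \<le> Q w u v x"
    and k: "\<And>w. w \<in> C \<Longrightarrow> 0 \<le> k w"
    and eq: "\<And>x. (\<Sum>w\<in>C. k w * inp A B (Q w) x) = (\<Sum>w\<in>C. inp A B (Q w) x)"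
  shows "gobj lam a b A B C (\<lambda>w u v x. k w * Q w u v x)
    = (\<Sum>w\<in>C. k w * blk lam a b A B (Q w)) - lam * tot a A B C Q - (1 - lam) * tot b A B C Q"
proof -
  have "inp A B (\<lambda>u v x. k w * Q w u v x) x = k w * inp A B (Q w) x" for w x
    by (simp add: inp_def sum_distrib_left)
  with eq have "tot a A B C (\<lambda>w u v x. k w * Q w u v x) = tot a A B C Q"
    "tot b A B C (\<lambda>w u v x. k w * Q w u v x) = tot b A B C Q"
    by (simp_all add: tot_def sum_outp_eq_inp)
  then show ?thesis
    using Q k by (simp add: gobj_def blk_scale[OF a b] cong: sum.cong)
qed

section \<open>Reduction of the support\<close>

lemma ray_endpoint:
  fixes p d :: "'s \<Rightarrow> real"
  assumes fin: "finite (supp p)" and p: "\<And>s. 0 \<le> p s" and sub: "supp d \<subseteq> supp p" and s0: "d s0 < 0"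
  shows "\<exists>e>0. (\<forall>s. 0 \<le> p s + e * d s) \<and> supp (\<lambda>s. p s + e * d s) \<subset> supp p"
proof -
  let ?S = "{s. d s < 0}"
  have S: "?S \<subseteq> supp p" using sub by (auto simp: supp_def subset_iff)
  then have finS: "finite ?S" using fin finite_subset by blast
  \<comment> \<open>The first time at which a decreasing coordinate reaches 0; the minimising
    coordinate leaves the support.\<close>
  define e where "e = Min ((\<lambda>s. p s / (- d s)) ` ?S)"
  have "e \<in> (\<lambda>s. p s / (- d s)) ` ?S" unfolding e_def using finS s0 by (intro Min_in) auto
  then obtain s1 where s1: "d s1 < 0" "e = p s1 / (- d s1)" by auto
  then have s1p: "s1 \<in> supp p" using S by auto
  then have "0 < p s1" using p[of s1] by (simp add: supp_def)
  with s1 have e: "e > 0" by (simp add: divide_pos_neg)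
  have "0 \<le> p s + e * d s" for s
  proof (cases "d s < 0")
    case True
    then have "e \<le> p s / (- d s)" unfolding e_def using finS by (intro Min_le) auto
    then have "e * (- d s) \<le> p s" using True by (simp add: field_simps)
    then show ?thesis by simp
  next
    case False
    then show ?thesis using e p[of s] by simp
  qed
  moreover have "supp (\<lambda>s. p s + e * d s) \<subseteq> supp p" using sub by (auto simp: supp_def)
  moreover have "s1 \<notin> supp (\<lambda>s. p s + e * d s)" using s1 by (simp add: supp_def)
  ultimately show ?thesis using e s1p by blast
qed

definition shrinkable :: "(('s \<Rightarrow> real) \<Rightarrow> real) \<Rightarrow> ('s \<Rightarrow> real) \<Rightarrow> bool" where
  "shrinkable g p \<longleftrightarrow> (\<exists>p'. is_dist p' \<and> supp p' \<subset> supp p \<and> g p \<le> g p')"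

text \<open>A function that is convex along a line inside the simplex is at least as large at one of the two
  ends of the line, where some coordinate has vanished.\<close>

lemma shrink_support:
  fixes p d :: "'s \<Rightarrow> real"
  assumes p: "is_dist p" and sub: "supp d \<subseteq> supp p" and d: "d s0 \<noteq> 0" and sum0: "sum d (supp p) = 0"
    and conv: "\<And>e1 e2 t. \<forall>s. 0 \<le> p s + e1 * d s \<Longrightarrow> \<forall>s. 0 \<le> p s + e2 * d s \<Longrightarrow> 0 \<le> t \<Longrightarrow> t \<le> 1 \<Longrightarrow>
      t * e1 + (1 - t) * e2 = 0 \<Longrightarrow>
      g p \<le> t * g (\<lambda>s. p s + e1 * d s) + (1 - t) * g (\<lambda>s. p s + e2 * d s)"
  shows "shrinkable g p"
proof -
  have fin: "finite (supp p)" and p0: "\<And>s. 0 \<le> p s" and p1: "sum p (supp p) = 1"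
    using p by (auto simp: is_dist_def)
  have s0: "s0 \<in> supp p" using sub d by (auto simp: supp_def)
  have "\<exists>s. d s < 0"
  proof (rule ccontr)
    assume "\<not> (\<exists>s. d s < 0)"
    then have "\<And>s. 0 \<le> d s" by (meson not_le)
    then show False using sum_nonneg_eq_0_iff[of "supp p" d] fin sum0 s0 d by auto
  qed
  then obtain sn where sn: "d sn < 0" by blast
  have "\<exists>s. d s > 0"
  proof (rule ccontr)
    assume "\<not> (\<exists>s. d s > 0)"
    then have "\<And>s. d s \<le> 0" by (meson not_le)
    then show False using sum_nonneg_eq_0_iff[of "supp p" "\<lambda>s. - d s"] fin sum0 s0 d by (auto simp: sum_negf)
  qed
  then obtain sp where sp: "d sp > 0" by blast
  obtain e1 where e1: "e1 > 0" "\<forall>s. 0 \<le> p s + e1 * d s" "supp (\<lambda>s. p s + e1 * d s) \<subset> supp p"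
    using ray_endpoint[OF fin p0 sub sn] by blast
  have "supp (\<lambda>s. - d s) \<subseteq> supp p" using sub by (simp add: supp_def)
  then obtain e2 where e2: "e2 > 0" "\<forall>s. 0 \<le> p s + (- e2) * d s" "supp (\<lambda>s. p s + (- e2) * d s) \<subset> supp p"
    using ray_endpoint[OF fin p0, of "\<lambda>s. - d s" sp] sp by auto
  have dist: "is_dist (\<lambda>s. p s + e * d s)" if "\<forall>s. 0 \<le> p s + e * d s" "supp (\<lambda>s. p s + e * d s) \<subset> supp p" for e
  proof -
    have "(\<Sum>s\<in>supp (\<lambda>s. p s + e * d s). p s + e * d s) = (\<Sum>s\<in>supp p. p s + e * d s)"
      by (rule sum.mono_neutral_left) (use fin that(2) in \<open>auto simp: supp_def\<close>)
    also have "\<dots> = 1" unfolding sum.distrib sum_distrib_left[symmetric] by (simp add: p1 sum0)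
    finally show ?thesis using that fin finite_subset by (auto simp: is_dist_def)
  qed
  \<comment> \<open>Chosen so that \<open>p\<close> is the convex combination of the two ends, at
    parameters \<open>e1\<close> and \<open>- e2\<close>.\<close>
  define t where "t = e2 / (e1 + e2)"
  have t: "0 \<le> t" "t \<le> 1" "t * e1 + (1 - t) * (- e2) = 0"
    using e1(1) e2(1) by (auto simp: t_def field_simps)
  let ?g1 = "g (\<lambda>s. p s + e1 * d s)" and ?g2 = "g (\<lambda>s. p s + (- e2) * d s)"
  have "g p \<le> t * ?g1 + (1 - t) * ?g2" by (rule conv[OF e1(2) e2(2) t])
  also have "\<dots> \<le> t * max ?g1 ?g2 + (1 - t) * max ?g1 ?g2"
    using t by (intro add_mono mult_left_mono) auto
  also have "\<dots> = max ?g1 ?g2" by (simp add: algebra_simps)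
  finally have "g p \<le> ?g1 \<or> g p \<le> ?g2" by linarith
  then show ?thesis unfolding shrinkable_def using dist[OF e1(2,3)] dist[OF e2(2,3)] e1(3) e2(3) by blast
qed

text \<open>More unknowns than homogeneous equations. Elimination by induction on the equations: a
  nonzero coefficient \<open>M i0 j\<close> is used to remove the unknown \<open>i0\<close> from the
  remaining ones, and \<open>\<alpha>\<close> then restores it so that equation \<open>j\<close>
  holds.\<close>

lemma linear_dependence:
  fixes M :: "'i \<Rightarrow> 'j \<Rightarrow> real"
  assumes "finite J" "finite I" "card J < card I"
  shows "\<exists>c. (\<forall>i. i \<notin> I \<longrightarrow> c i = 0) \<and> (\<exists>i\<in>I. c i \<noteq> 0) \<and> (\<forall>j\<in>J. (\<Sum>i\<in>I. c i * M i j) = 0)"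
  using assms
proof (induction J arbitrary: I M)
  case empty
  then obtain i where "i \<in> I" by fastforce
  then show ?case by (intro exI[of _ "\<lambda>k. if k = i then 1 else 0"]) auto
next
  case (insert j J)
  show ?case
  proof (cases "\<forall>i\<in>I. M i j = 0")
    case True
    obtain c where c: "\<forall>i. i \<notin> I \<longrightarrow> c i = 0" "\<exists>i\<in>I. c i \<noteq> 0" "\<forall>j\<in>J. (\<Sum>i\<in>I. c i * M i j) = 0"
      using insert.IH[of I M] insert.prems insert.hyps by auto
    then show ?thesis using True by (intro exI[of _ c]) auto
  next
    case False
    then obtain i0 where i0: "i0 \<in> I" "M i0 j \<noteq> 0" by blast
    let ?M = "\<lambda>i k. M i k - M i j / M i0 j * M i0 k"
    have "card J < card (I - {i0})" using insert i0 by simp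
    then obtain c where c: "\<forall>i. i \<notin> I - {i0} \<longrightarrow> c i = 0" "\<exists>i\<in>I - {i0}. c i \<noteq> 0"
        "\<forall>k\<in>J. (\<Sum>i\<in>I - {i0}. c i * ?M i k) = 0"
      using insert.IH[of "I - {i0}" ?M] insert.prems by auto
    define \<alpha> where "\<alpha> = - (\<Sum>i\<in>I - {i0}. c i * M i j) / M i0 j"
    define c' where "c' = c(i0 := \<alpha>)"
    have split: "(\<Sum>i\<in>I. c' i * M i k) = \<alpha> * M i0 k + (\<Sum>i\<in>I - {i0}. c i * M i k)" for k
      using i0 insert.prems by (subst sum.remove[of I i0]) (auto simp: c'_def intro!: sum.cong)
    have "(\<Sum>i\<in>I. c' i * M i k) = 0" if "k \<in> J" for k
    proof -
      have "(\<Sum>i\<in>I - {i0}. c i * ?M i k) = (\<Sum>i\<in>I - {i0}. c i * M i k) - (\<Sum>i\<in>I - {i0}. c i * M i j) / M i0 j * M i0 k"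
        by (simp add: right_diff_distrib sum_subtractf sum_distrib_right sum_divide_distrib mult.assoc)
      then show ?thesis using c(3) that by (simp add: split \<alpha>_def)
    qed
    moreover have "(\<Sum>i\<in>I. c' i * M i j) = 0" using i0 by (simp add: split \<alpha>_def)
    moreover have "\<forall>i. i \<notin> I \<longrightarrow> c' i = 0" using c(1) i0 by (auto simp: c'_def)
    moreover have "\<exists>i\<in>I. c' i \<noteq> 0" using c(2) by (auto simp: c'_def)
    ultimately show ?thesis by blast
  qed
qed

text \<open>Counted for each w separately, because the reducing direction found below lives inside a
  single block.\<close>

definition actU :: "('u \<times> 'v \<times> 'w \<times> 'x \<Rightarrow> real) \<Rightarrow> 'w \<Rightarrow> 'u set" where
  "actU p w = {u. \<exists>v x. p (u, v, w, x) \<noteq> 0}"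

definition actV :: "('u \<times> 'v \<times> 'w \<times> 'x \<Rightarrow> real) \<Rightarrow> 'w \<Rightarrow> 'v set" where
  "actV p w = {v. \<exists>u x. p (u, v, w, x) \<noteq> 0}"

definition actW :: "('u \<times> 'v \<times> 'w \<times> 'x \<Rightarrow> real) \<Rightarrow> 'w set" where
  "actW p = {w. \<exists>u v x. p (u, v, w, x) \<noteq> 0}"

lemma sum_supp_box:
  fixes p :: "'u \<times> 'v \<times> 'w \<times> 'x::finite \<Rightarrow> real"
  assumes fin: "finite A" "finite B" "finite C" and sub: "supp p \<subseteq> A \<times> B \<times> C \<times> UNIV"
    and f: "\<And>s. p s = 0 \<Longrightarrow> f s = (0::real)"
  shows "sum f (supp p) = (\<Sum>w\<in>C. \<Sum>u\<in>A. \<Sum>v\<in>B. \<Sum>x\<in>UNIV. f (u, v, w, x))"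
proof -
  have "sum f (supp p) = sum f (A \<times> B \<times> C \<times> UNIV)"
    by (rule sum.mono_neutral_left) (use fin sub f in \<open>auto simp: supp_def\<close>)
  also have "\<dots> = (\<Sum>u\<in>A. \<Sum>v\<in>B. \<Sum>w\<in>C. \<Sum>x\<in>UNIV. f (u, v, w, x))"
    by (simp only: sum.cartesian_product')
  finally show ?thesis by (simp add: sum.swap[of _ C A] sum.swap[of _ C B])
qed

lemma actU_subset: "supp p \<subseteq> A \<times> B \<times> C \<times> UNIV \<Longrightarrow> actU p w \<subseteq> A"
  and actV_subset: "supp p \<subseteq> A \<times> B \<times> C \<times> UNIV \<Longrightarrow> actV p w \<subseteq> B"
  and actW_subset: "supp p \<subseteq> A \<times> B \<times> C \<times> UNIV \<Longrightarrow> actW p \<subseteq> C"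
  by (force simp: supp_def actU_def actV_def actW_def)+

text \<open>Block \<open>w0\<close> is multiplied by 1 + e L(u), the other blocks stay.
  Orthogonality to every column of the (u,y) law keeps (Y, W); summed over y, it keeps the total
  mass.\<close>

lemma reduceU_line:
  fixes p :: "'u \<times> 'v \<times> 'w \<times> 'x::finite \<Rightarrow> real"
  assumes fin: "finite A" "finite B" "finite C" and a: "pos_channel a" and b: "pos_channel b"
    and lam: "lam \<le> 1"
    and p: "is_dist p" and sub: "supp p \<subseteq> A \<times> B \<times> C \<times> UNIV"
    and L0: "\<And>u. u \<notin> actU p w0 \<Longrightarrow> L u = 0" and u0: "u0 \<in> actU p w0" "L u0 \<noteq> 0"
    and L: "\<And>y. (\<Sum>u\<in>A. L u * marg a B (slice p w0) u y) = 0"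
  shows "shrinkable (\<lambda>p. gobj lam a b A B C (slice p)) p" (is "shrinkable ?g p")
proof -
  define l where "l = (\<lambda>w u. if w = w0 then L u else 0)"
  define d where "d = (\<lambda>(u, v, w, x). l w u * p (u, v, w, x))"
  have p0: "\<And>s. 0 \<le> p s" using p unfolding is_dist_def by blast
  obtain v0 x0 where s0: "p (u0, v0, w0, x0) \<noteq> 0" using u0 by (auto simp: actU_def)
  have w0: "w0 \<in> C" using s0 sub by (force simp: supp_def)
  have orth: "(\<Sum>u\<in>A. l w u * marg a B (slice p w) u y) = 0" for w y
    using L by (cases "w = w0") (auto simp: l_def)
  \<comment> \<open>Nonnegativity of the law bounds the factor only where (u,w) carries mass.
    Elsewhere \<open>L\<close> vanishes and the factor is 1.\<close>
  have k_nonneg: "0 \<le> 1 + e * l w u" if "\<forall>s. 0 \<le> p s + e * d s" for e w u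
  proof (cases "w = w0 \<and> u \<in> actU p w0")
    case True
    then obtain v x where s: "p (u, v, w, x) \<noteq> 0" by (auto simp: actU_def)
    then have "0 < p (u, v, w, x)" using p0[of "(u, v, w, x)"] by linarith
    moreover have "0 \<le> (1 + e * l w u) * p (u, v, w, x)"
      using that[rule_format, of "(u, v, w, x)"] by (simp add: d_def algebra_simps)
    ultimately show ?thesis by (simp add: zero_le_mult_iff)
  qed (use L0 in \<open>auto simp: l_def\<close>)
  have sl: "slice (\<lambda>s. p s + e * d s) = (\<lambda>w u v x. (1 + e * l w u) * slice p w u v x)" for e
    by (simp add: slice_def d_def algebra_simps)
  show ?thesis
  proof (rule shrink_support[where d = d and ?s0.0 = "(u0, v0, w0, x0)"])
    show "sum d (supp p) = 0"
    proof -
      have "sum d (supp p) = (\<Sum>w\<in>C. \<Sum>u\<in>A. l w u * (\<Sum>v\<in>B. \<Sum>x\<in>UNIV. slice p w u v x))"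
        by (subst sum_supp_box[OF fin sub]) (auto simp: d_def slice_def sum_distrib_left)
      also have "\<dots> = (\<Sum>w\<in>C. \<Sum>y\<in>UNIV. \<Sum>u\<in>A. l w u * marg a B (slice p w) u y)"
        by (simp add: sum_marg[OF a, symmetric] sum_distrib_left sum.swap[of _ A UNIV])
      finally show ?thesis by (simp add: orth)
    qed
    fix e1 e2 t :: real
    assume e: "\<forall>s. 0 \<le> p s + e1 * d s" "\<forall>s. 0 \<le> p s + e2 * d s" and t: "0 \<le> t" "t \<le> 1"
      and te: "t * e1 + (1 - t) * e2 = 0"
    have eq: "(\<Sum>u\<in>A. (1 + e * l w u) * marg a B (slice p w) u y) = outp a A B (slice p w) y" for e w y
      using orth[of w y] by (simp add: outp_def distrib_right sum.distrib mult.assoc sum_distrib_left[symmetric])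
    have mix: "t * (1 + e1 * l w u) + (1 - t) * (1 + e2 * l w u) = 1" for w u
    proof -
      have "t * (1 + e1 * l w u) + (1 - t) * (1 + e2 * l w u) = 1 + (t * e1 + (1 - t) * e2) * l w u"
        by (simp add: algebra_simps)
      then show ?thesis by (simp add: te)
    qed
    show "?g p \<le> t * ?g (\<lambda>s. p s + e1 * d s) + (1 - t) * ?g (\<lambda>s. p s + e2 * d s)"
      unfolding sl
      by (rule gobj_convex_scaleU[OF fin a b lam t]) (use k_nonneg e eq mix p0 in \<open>auto simp: slice_def\<close>)
  qed (use p s0 u0 in \<open>auto simp: d_def l_def supp_def\<close>)
qed

text \<open>The minimum comes from two counts of equations. The |Y| conditions on the (u,y) law can
  be solved directly; alternatively |X| conditions on the (u,x) law suffice, since Y depends on U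
  only through X.\<close>

lemma reduceU:
  fixes p :: "'u \<times> 'v \<times> 'w \<times> 'x::finite \<Rightarrow> real"
    and a :: "'x \<Rightarrow> 'y::finite \<Rightarrow> real"
  assumes fin: "finite A" "finite B" "finite C" and a: "pos_channel a" and b: "pos_channel b"
    and lam: "lam \<le> 1"
    and p: "is_dist p" and sub: "supp p \<subseteq> A \<times> B \<times> C \<times> UNIV"
    and card: "min (CARD('x)) (CARD('y)) < card (actU p w0)"
  shows "shrinkable (\<lambda>p. gobj lam a b A B C (slice p)) p" (is "shrinkable ?g p")
proof -
  have sU: "actU p w0 \<subseteq> A" by (rule actU_subset[OF sub])
  then have finU: "finite (actU p w0)" using fin finite_subset by blast
  have ext: "(\<Sum>u\<in>A. L u * f u) = (\<Sum>u\<in>actU p w0. L u * f u)"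
    if "\<forall>u. u \<notin> actU p w0 \<longrightarrow> L u = 0" for L f :: "'u \<Rightarrow> real"
    by (rule sum.mono_neutral_right) (use that sU fin in auto)
  consider "CARD('y) < card (actU p w0)" | "CARD('x) < card (actU p w0)"
    using card by linarith
  then have "\<exists>L. (\<forall>u. u \<notin> actU p w0 \<longrightarrow> L u = 0) \<and> (\<exists>u\<in>actU p w0. L u \<noteq> 0)
      \<and> (\<forall>y. (\<Sum>u\<in>A. L u * marg a B (slice p w0) u y) = 0)"
  proof cases
    case 1
    then obtain L where "\<forall>u. u \<notin> actU p w0 \<longrightarrow> L u = 0" "\<exists>u\<in>actU p w0. L u \<noteq> 0"
        "\<forall>y\<in>UNIV. (\<Sum>u\<in>actU p w0. L u * marg a B (slice p w0) u y) = 0"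
      using linear_dependence[OF finite finU, where M = "marg a B (slice p w0)"] by blast
    then show ?thesis by (intro exI[of _ L]) (simp add: ext)
  next
    case 2
    then obtain L where L: "\<forall>u. u \<notin> actU p w0 \<longrightarrow> L u = 0" "\<exists>u\<in>actU p w0. L u \<noteq> 0"
        "\<forall>x\<in>UNIV. (\<Sum>u\<in>actU p w0. L u * (\<Sum>v\<in>B. slice p w0 u v x)) = 0"
      using linear_dependence[OF finite finU, where M = "\<lambda>u x. \<Sum>v\<in>B. slice p w0 u v x"] by blast
    have "(\<Sum>u\<in>A. L u * marg a B (slice p w0) u y)
        = (\<Sum>x\<in>UNIV. (\<Sum>u\<in>A. L u * (\<Sum>v\<in>B. slice p w0 u v x)) * a x y)" for y
      unfolding marg_eq_inp sum_distrib_left[of "L _"] sum_distrib_right[of _ A]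
      by (subst sum.swap) (simp add: sum_distrib_left[symmetric] mult.assoc)
    then show ?thesis using L by (intro exI[of _ L]) (simp add: ext)
  qed
  then obtain L where "\<forall>u. u \<notin> actU p w0 \<longrightarrow> L u = 0" "\<exists>u\<in>actU p w0. L u \<noteq> 0"
    "\<forall>y. (\<Sum>u\<in>A. L u * marg a B (slice p w0) u y) = 0" by blast
  then show ?thesis using reduceU_line[OF fin a b lam p sub, of w0 L] by blast
qed

section \<open>Exchanging the roles of U and V\<close>

lemma bij_betw_supp:
  assumes "bij \<phi>"
  shows "bij_betw \<phi> {s \<in> supp (\<mu> \<circ> \<phi>). E (\<phi> s)} {s \<in> supp \<mu>. E s}"
  using assms by (auto simp: bij_betw_def supp_def inj_on_def bij_def surj_def image_iff)

lemma is_dist_bij: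
  assumes p: "is_dist p" and \<phi>: "bij \<phi>"
  shows "is_dist (p \<circ> \<phi>)"
proof -
  have s: "bij_betw \<phi> (supp (p \<circ> \<phi>)) (supp p)"
    using bij_betw_supp[OF \<phi>, of p "\<lambda>_. True"] by simp
  then have "finite (supp (p \<circ> \<phi>))" using p bij_betw_finite[OF s] by (simp add: is_dist_def)
  moreover have "sum (p \<circ> \<phi>) (supp (p \<circ> \<phi>)) = sum p (supp p)"
    using sum.reindex_bij_betw[OF s, of p] by (simp add: o_def)
  ultimately show ?thesis using p unfolding is_dist_def by simp
qed

definition swapUV :: "'u \<times> 'v \<times> 'w \<times> 'x \<Rightarrow> 'v \<times> 'u \<times> 'w \<times> 'x" where
  "swapUV = (\<lambda>(u, v, w, x). (v, u, w, x))"

lemma swapUV_swapUV [simp]: "swapUV (swapUV s) = s"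
  by (simp add: swapUV_def split_def)

lemma supp_swapUV: "supp (p \<circ> swapUV) = swapUV ` supp p"
  by (force simp: supp_def image_iff)

lemma bij_swapUV: "bij swapUV"
  by (rule o_bij[of swapUV]) (simp_all add: fun_eq_iff)

lemma inj_swapUV: "inj_on swapUV S"
  by (metis inj_onI swapUV_swapUV)

lemma is_dist_swapUV: "is_dist p \<Longrightarrow> is_dist (p \<circ> swapUV)"
  by (rule is_dist_bij[OF _ bij_swapUV])

lemma slice_swapUV: "slice (p \<circ> swapUV) = (\<lambda>w. flip (slice p w))"
  by (simp add: slice_def flip_def swapUV_def o_def)

lemma reduceV:
  fixes p :: "'u \<times> 'v \<times> 'w \<times> 'x::finite \<Rightarrow> real"
    and b :: "'x \<Rightarrow> 'z::finite \<Rightarrow> real"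
  assumes fin: "finite A" "finite B" "finite C" and a: "pos_channel a" and b: "pos_channel b"
    and lam: "0 \<le> lam"
    and p: "is_dist p" and sub: "supp p \<subseteq> A \<times> B \<times> C \<times> UNIV"
    and card: "min (CARD('x)) (CARD('z)) < card (actV p w0)"
  shows "shrinkable (\<lambda>p. gobj lam a b A B C (slice p)) p" (is "shrinkable ?g p")
proof -
  have "actU (p \<circ> swapUV) w0 = actV p w0" by (simp add: actU_def actV_def swapUV_def)
  moreover have "supp (p \<circ> swapUV) \<subseteq> B \<times> A \<times> C \<times> UNIV"
    using sub unfolding supp_swapUV by (auto simp: swapUV_def dest!: subsetD)
  ultimately obtain p' where p': "is_dist p'" "supp p' \<subset> supp (p \<circ> swapUV)"
      "gobj (1 - lam) b a B A C (slice (p \<circ> swapUV)) \<le> gobj (1 - lam) b a B A C (slice p')"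
    using reduceU[OF fin(2,1,3) b a _ is_dist_swapUV[OF p], of "1 - lam" w0] card lam
    unfolding shrinkable_def by auto
  have "p' = (p' \<circ> swapUV) \<circ> swapUV" by (simp add: o_def)
  then have "slice p' = (\<lambda>w. flip (slice (p' \<circ> swapUV) w))" by (metis slice_swapUV)
  then have "gobj lam a b A B C (slice p) \<le> gobj lam a b A B C (slice (p' \<circ> swapUV))"
    using p'(3) by (simp add: slice_swapUV[of p] gobj_flip)
  moreover have "supp (p' \<circ> swapUV) \<subset> supp p"
  proof -
    have "swapUV ` supp p' \<subset> swapUV ` (swapUV ` supp p)"
      using p'(2) by (simp add: supp_swapUV inj_image_subset_iff[OF inj_swapUV] psubset_eq inj_image_eq_iff[OF inj_swapUV])
    then show ?thesis by (simp add: supp_swapUV image_image)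
  qed
  ultimately show ?thesis unfolding shrinkable_def using is_dist_swapUV[OF p'(1)] by blast
qed

text \<open>The |X| equations say that reweighting the blocks keeps the law of X. By
  \<open>gobj_scaleW\<close> the objective is then affine in \<open>e\<close>, so the required
  inequality holds with equality.\<close>

lemma reduceW:
  fixes p :: "'u \<times> 'v \<times> 'w \<times> 'x::finite \<Rightarrow> real"
  assumes fin: "finite A" "finite B" "finite C" and a: "pos_channel a" and b: "pos_channel b"
    and p: "is_dist p" and sub: "supp p \<subseteq> A \<times> B \<times> C \<times> UNIV"
    and card: "CARD('x) < card (actW p)"
  shows "shrinkable (\<lambda>p. gobj lam a b A B C (slice p)) p" (is "shrinkable ?g p")
proof -
  have sW: "actW p \<subseteq> C" by (rule actW_subset[OF sub])
  then have finW: "finite (actW p)" using fin finite_subset by blast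
  obtain L where L0: "\<forall>w. w \<notin> actW p \<longrightarrow> L w = 0" and "\<exists>w\<in>actW p. L w \<noteq> 0"
    and L: "\<forall>x\<in>UNIV. (\<Sum>w\<in>actW p. L w * inp A B (slice p w) x) = 0"
    using linear_dependence[OF finite finW card, where M = "\<lambda>w. inp A B (slice p w)"] by blast
  then obtain u0 v0 w0 x0 where s0: "p (u0, v0, w0, x0) \<noteq> 0" "L w0 \<noteq> 0" by (auto simp: actW_def)
  have orth: "(\<Sum>w\<in>C. L w * inp A B (slice p w) x) = 0" for x
  proof -
    have "(\<Sum>w\<in>C. L w * inp A B (slice p w) x) = (\<Sum>w\<in>actW p. L w * inp A B (slice p w) x)"
      by (rule sum.mono_neutral_right) (use L0 sW fin in auto)
    then show ?thesis using L by simp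
  qed
  define d where "d = (\<lambda>(u, v, w, x). L w * p (u, v, w, x))"
  have p0: "\<And>s. 0 \<le> p s" using p unfolding is_dist_def by blast
  have k_nonneg: "0 \<le> 1 + e * L w" if "\<forall>s. 0 \<le> p s + e * d s" for e w
  proof (cases "w \<in> actW p")
    case True
    then obtain u v x where s: "p (u, v, w, x) \<noteq> 0" by (auto simp: actW_def)
    then have "0 < p (u, v, w, x)" using p0[of "(u, v, w, x)"] by linarith
    moreover have "0 \<le> (1 + e * L w) * p (u, v, w, x)"
      using that[rule_format, of "(u, v, w, x)"] by (simp add: d_def algebra_simps)
    ultimately show ?thesis by (simp add: zero_le_mult_iff)
  qed (use L0 in auto)
  have sl: "slice (\<lambda>s. p s + e * d s) = (\<lambda>w u v x. (1 + e * L w) * slice p w u v x)" for e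
    by (simp add: slice_def d_def algebra_simps)
  show ?thesis
  proof (rule shrink_support[where d = d and ?s0.0 = "(u0, v0, w0, x0)"])
    show "sum d (supp p) = 0"
    proof -
      have "sum d (supp p) = (\<Sum>w\<in>C. \<Sum>u\<in>A. \<Sum>v\<in>B. \<Sum>x\<in>UNIV. L w * slice p w u v x)"
        by (subst sum_supp_box[OF fin sub]) (auto simp: d_def slice_def)
      also have "\<dots> = (\<Sum>x\<in>UNIV. \<Sum>w\<in>C. L w * inp A B (slice p w) x)"
        unfolding inp_def sum_distrib_left
        by (simp add: sum.swap[of _ C UNIV] sum.swap[of _ A UNIV] sum.swap[of _ B UNIV])
      finally show ?thesis by (simp add: orth)
    qed
    fix e1 e2 t :: real
    assume e: "\<forall>s. 0 \<le> p s + e1 * d s" "\<forall>s. 0 \<le> p s + e2 * d s" and t: "0 \<le> t" "t \<le> 1"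
      and te: "t * e1 + (1 - t) * e2 = 0"
    let ?c = "lam * tot a A B C (slice p) + (1 - lam) * tot b A B C (slice p)"
    have G: "?g (\<lambda>s. p s + e * d s) = (\<Sum>w\<in>C. (1 + e * L w) * blk lam a b A B (slice p w)) - ?c"
      if "\<forall>s. 0 \<le> p s + e * d s" for e
      unfolding sl using orth
      by (subst gobj_scaleW[OF a b])
         (use k_nonneg[OF that] p0 in \<open>auto simp: slice_def distrib_right sum.distrib mult.assoc sum_distrib_left[symmetric]\<close>)
    have G': "?g (\<lambda>s. p s + e * d s) = ?g p + e * (\<Sum>w\<in>C. L w * blk lam a b A B (slice p w))"
      if "\<forall>s. 0 \<le> p s + e * d s" for e
      unfolding G[OF that] by (simp add: gobj_def distrib_right sum.distrib mult.assoc sum_distrib_left)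
    let ?D = "\<Sum>w\<in>C. L w * blk lam a b A B (slice p w)"
    have "t * (?g p + e1 * ?D) + (1 - t) * (?g p + e2 * ?D)
        = ?g p + (t * e1 + (1 - t) * e2) * ?D"
      by (simp add: algebra_simps)
    then show "?g p \<le> t * ?g (\<lambda>s. p s + e1 * d s) + (1 - t) * ?g (\<lambda>s. p s + e2 * d s)"
      unfolding G'[OF e(1)] G'[OF e(2)] te by simp
  qed (use p s0 in \<open>auto simp: d_def supp_def\<close>)
qed

text \<open>Mass moves between two inputs at the same (u,v,w), so the law of (U, V, W) is fixed and
  \<open>gobj_convex_fixed_UV\<close> applies.\<close>

lemma reduceX:
  fixes p :: "'u \<times> 'v \<times> 'w \<times> 'x::finite \<Rightarrow> real"
  assumes fin: "finite A" "finite B" "finite C" and a: "pos_channel a" and b: "pos_channel b"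
    and lam: "0 \<le> lam" "lam \<le> 1"
    and p: "is_dist p"
    and x: "p (u0, v0, w0, x0) \<noteq> 0" "p (u0, v0, w0, x1) \<noteq> 0" "x0 \<noteq> x1"
  shows "shrinkable (\<lambda>p. gobj lam a b A B C (slice p)) p" (is "shrinkable ?g p")
proof -
  let ?s0 = "(u0, v0, w0, x0)" and ?s1 = "(u0, v0, w0, x1)"
  define d :: "'u \<times> 'v \<times> 'w \<times> 'x \<Rightarrow> real" where "d = (\<lambda>s. (if s = ?s0 then 1 else 0) - (if s = ?s1 then 1 else 0))"
  have finp: "finite (supp p)" using p by (simp add: is_dist_def)
  show ?thesis
  proof (rule shrink_support[where d = d and ?s0.0 = ?s0])
    show "sum d (supp p) = 0" using x finp by (simp add: d_def sum_subtractf supp_def)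
    fix e1 e2 t :: real
    assume e: "\<forall>s. 0 \<le> p s + e1 * d s" "\<forall>s. 0 \<le> p s + e2 * d s" and t: "0 \<le> t" "t \<le> 1"
      and te: "t * e1 + (1 - t) * e2 = 0"
    have d0: "(\<Sum>x\<in>UNIV. d (u, v, w, x)) = 0" for u v w
      by (cases "u = u0 \<and> v = v0 \<and> w = w0") (auto simp: d_def sum_subtractf)
    have mix: "slice p = (\<lambda>w u v x. t * slice (\<lambda>s. p s + e1 * d s) w u v x + (1 - t) * slice (\<lambda>s. p s + e2 * d s) w u v x)"
    proof (intro ext)
      fix w u v x
      have "t * (p (u, v, w, x) + e1 * d (u, v, w, x)) + (1 - t) * (p (u, v, w, x) + e2 * d (u, v, w, x))
        = p (u, v, w, x) + (t * e1 + (1 - t) * e2) * d (u, v, w, x)" by (simp add: algebra_simps)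
      then show "slice p w u v x = t * slice (\<lambda>s. p s + e1 * d s) w u v x + (1 - t) * slice (\<lambda>s. p s + e2 * d s) w u v x"
        by (simp add: slice_def te)
    qed
    show "?g p \<le> t * ?g (\<lambda>s. p s + e1 * d s) + (1 - t) * ?g (\<lambda>s. p s + e2 * d s)"
      by (subst mix, rule gobj_convex_fixed_UV[OF fin a b lam t])
         (use e d0 in \<open>auto simp: slice_def sum.distrib sum_distrib_left[symmetric]\<close>)
  qed (use p x in \<open>auto simp: d_def supp_def\<close>)
qed

text \<open>Each failing bound makes the law shrinkable, and the support size decreases. The
  inclusion of supports is kept in the conclusion because it carries over constancy of U or V given
  W.\<close>

lemma reduce:
  fixes p :: "'u \<times> 'v \<times> 'w \<times> 'x::finite \<Rightarrow> real"
    and a :: "'x \<Rightarrow> 'y::finite \<Rightarrow> real" and b :: "'x \<Rightarrow> 'z::finite \<Rightarrow> real"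
  assumes fin: "finite A" "finite B" "finite C" and a: "pos_channel a" and b: "pos_channel b"
    and lam: "0 \<le> lam" "lam \<le> 1"
    and p: "is_dist p" and sub: "supp p \<subseteq> A \<times> B \<times> C \<times> UNIV"
  shows "\<exists>p'. is_dist p' \<and> supp p' \<subseteq> supp p \<and> gobj lam a b A B C (slice p) \<le> gobj lam a b A B C (slice p')
     \<and> (\<forall>w. card (actU p' w) \<le> min (CARD('x)) (CARD('y)))
     \<and> (\<forall>w. card (actV p' w) \<le> min (CARD('x)) (CARD('z)))
     \<and> card (actW p') \<le> CARD('x)
     \<and> (\<forall>u v w x x'. p' (u, v, w, x) \<noteq> 0 \<longrightarrow> p' (u, v, w, x') \<noteq> 0 \<longrightarrow> x = x')"
  using p sub
proof (induction "card (supp p)" arbitrary: p rule: less_induct)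
  case less
  let ?good = "(\<forall>w. card (actU p w) \<le> min (CARD('x)) (CARD('y)))
     \<and> (\<forall>w. card (actV p w) \<le> min (CARD('x)) (CARD('z)))
     \<and> card (actW p) \<le> CARD('x)
     \<and> (\<forall>u v w x x'. p (u, v, w, x) \<noteq> 0 \<longrightarrow> p (u, v, w, x') \<noteq> 0 \<longrightarrow> x = x')"
  show ?case
  proof (cases ?good)
    case True
    then show ?thesis using less.prems by blast
  next
    case False
    have "shrinkable (\<lambda>p. gobj lam a b A B C (slice p)) p"
      using False reduceU[OF fin a b lam(2) less.prems] reduceV[OF fin a b lam(1) less.prems]
        reduceW[OF fin a b less.prems] reduceX[OF fin a b lam less.prems(1)]
      by (meson not_le)
    then obtain p1 where p1: "is_dist p1" "supp p1 \<subset> supp p"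
      "gobj lam a b A B C (slice p) \<le> gobj lam a b A B C (slice p1)" unfolding shrinkable_def by blast
    have "card (supp p1) < card (supp p)"
      using p1(2) less.prems(1) by (intro psubset_card_mono) (auto simp: is_dist_def)
    from less.hyps[OF this p1(1)] p1 less.prems(2) show ?thesis
      by (smt (verit, ccfv_SIG) order_trans psubset_imp_subset subset_trans)
  qed
qed

section \<open>Splitting W\<close>

lemma sum_marg_split:
  assumes "finite D" "\<And>u. u \<in> A \<Longrightarrow> (\<Sum>d\<in>D. r u d) = 1"
  shows "(\<Sum>d\<in>D. marg b A (flip (\<lambda>u v x. r u d * P u v x)) v z) = marg b A (flip P) v z"
proof -
  have "(\<Sum>d\<in>D. marg b A (flip (\<lambda>u v x. r u d * P u v x)) v z)
      = (\<Sum>u\<in>A. \<Sum>x\<in>UNIV. (\<Sum>d\<in>D. r u d) * (P u v x * b x z))"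
    unfolding marg_def flip_def sum_distrib_right
    by (subst sum.swap, intro sum.cong refl, subst sum.swap) (simp add: mult.assoc)
  then show ?thesis using assms by (simp add: marg_def flip_def)
qed

lemma outp_eq_sum_marg_flip: "outp b A B P z = (\<Sum>v\<in>B. marg b A (flip P) v z)"
  using outp_flip[of b B A P z] by (simp add: outp_def)

lemma sum_outp_split:
  assumes "finite D" "\<And>u. u \<in> A \<Longrightarrow> (\<Sum>d\<in>D. r u d) = 1"
  shows "(\<Sum>d\<in>D. outp c A B (\<lambda>u v x. r u d * P u v x) y) = outp c A B P y"
  unfolding outp_eq_sum_marg_flip by (subst sum.swap) (simp add: sum_marg_split[OF assms])

lemma sum_xlnx_outp_split:
  assumes "finite D" "\<And>u. u \<in> A \<Longrightarrow> (\<Sum>d\<in>D. r u d) = 1"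
  shows "(\<Sum>d\<in>D. \<Sum>y\<in>UNIV. xlnx (outp c A B (\<lambda>u v x. r u d * P u v x) y))
    = (\<Sum>y\<in>UNIV. xlnx (outp c A B P y)) + (\<Sum>y\<in>UNIV. psi D (\<lambda>d. outp c A B (\<lambda>u v x. r u d * P u v x) y))"
  by (subst sum.swap) (simp add: psi_def sum_outp_split[OF assms] sum_subtractf)

text \<open>Let U' be drawn from U through \<open>r\<close> and appended to W. For normalised
  \<open>P\<close> the change is I(U';VZ) - (1 - \<open>lam\<close>) I(U';Y) - \<open>lam\<close>
  I(U';Z): the \<open>psi\<close> sums are minus the conditional entropies of U', and the H(U')
  terms cancel because the weights add up to 1.\<close>

lemma blk_split:
  assumes fin: "finite A" "finite B" "finite D" and a: "pos_channel a" and b: "pos_channel b"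
    and P: "\<And>u v x. u \<in> A \<Longrightarrow> v \<in> B \<Longrightarrow> 0 \<le> P u v x"
    and r: "\<And>u d. u \<in> A \<Longrightarrow> d \<in> D \<Longrightarrow> 0 \<le> r u d" "\<And>u. u \<in> A \<Longrightarrow> (\<Sum>d\<in>D. r u d) = 1"
  shows "(\<Sum>d\<in>D. blk lam a b A B (\<lambda>u v x. r u d * P u v x)) = blk lam a b A B P
     + (\<Sum>z\<in>UNIV. \<Sum>v\<in>B. psi D (\<lambda>d. marg b A (flip (\<lambda>u v x. r u d * P u v x)) v z))
     - (1 - lam) * (\<Sum>y\<in>UNIV. psi D (\<lambda>d. outp a A B (\<lambda>u v x. r u d * P u v x) y))
     - lam * (\<Sum>z\<in>UNIV. psi D (\<lambda>d. outp b A B (\<lambda>u v x. r u d * P u v x) z))"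
proof -
  define Pd where "Pd = (\<lambda>d u v x. r u d * P u v x)"
  define R where "R = (\<lambda>u. \<Sum>d\<in>D. xlnx (r u d))"
  \<comment> \<open>\<open>R u\<close> is minus the entropy of U' given U = u. It enters the (u,y)
    and the (u,v) sums with the same total weight and therefore cancels.\<close>
  have spread: "(\<Sum>d\<in>D. xlnx (r u d * m)) = xlnx m + R u * m" if "u \<in> A" "0 \<le> m" for u m
  proof -
    have "(\<Sum>d\<in>D. xlnx (r u d * m)) = (\<Sum>d\<in>D. r u d * xlnx m + xlnx (r u d) * m)"
      using that r by (intro sum.cong refl xlnx_mult) auto
    then show ?thesis using r(2)[OF that(1)] by (simp add: sum.distrib sum_distrib_right[symmetric] R_def)
  qed
  have m0: "0 \<le> marg a B P u y" if "u \<in> A" for u y using P that by (intro marg_nonneg[OF a]) auto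
  have 1: "(\<Sum>d\<in>D. \<Sum>y\<in>UNIV. \<Sum>u\<in>A. xlnx (marg a B (Pd d) u y))
      = (\<Sum>y\<in>UNIV. \<Sum>u\<in>A. xlnx (marg a B P u y)) + (\<Sum>u\<in>A. R u * (\<Sum>v\<in>B. \<Sum>x\<in>UNIV. P u v x))"
  proof -
    have "(\<Sum>d\<in>D. \<Sum>y\<in>UNIV. \<Sum>u\<in>A. xlnx (marg a B (Pd d) u y))
        = (\<Sum>y\<in>UNIV. \<Sum>u\<in>A. \<Sum>d\<in>D. xlnx (r u d * marg a B P u y))"
      unfolding Pd_def marg_scale[where k = "\<lambda>u. r u _"]
      by (subst sum.swap, intro sum.cong refl, subst sum.swap, rule refl)
    also have "\<dots> = (\<Sum>y\<in>UNIV. \<Sum>u\<in>A. xlnx (marg a B P u y) + R u * marg a B P u y)"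
      by (intro sum.cong refl spread m0) auto
    also have "\<dots> = (\<Sum>y\<in>UNIV. \<Sum>u\<in>A. xlnx (marg a B P u y)) + (\<Sum>u\<in>A. \<Sum>y\<in>UNIV. R u * marg a B P u y)"
      unfolding sum.distrib by (subst (2) sum.swap) (rule refl)
    finally show ?thesis by (simp add: sum_distrib_left[symmetric] sum_marg[OF a])
  qed
  have 2: "(\<Sum>d\<in>D. \<Sum>u\<in>A. \<Sum>v\<in>B. xlnx (\<Sum>x\<in>UNIV. Pd d u v x))
      = (\<Sum>u\<in>A. \<Sum>v\<in>B. xlnx (\<Sum>x\<in>UNIV. P u v x)) + (\<Sum>u\<in>A. R u * (\<Sum>v\<in>B. \<Sum>x\<in>UNIV. P u v x))"
  proof -
    have "(\<Sum>d\<in>D. \<Sum>u\<in>A. \<Sum>v\<in>B. xlnx (\<Sum>x\<in>UNIV. Pd d u v x))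
        = (\<Sum>u\<in>A. \<Sum>v\<in>B. \<Sum>d\<in>D. xlnx (r u d * (\<Sum>x\<in>UNIV. P u v x)))"
      unfolding Pd_def sum_distrib_left
      by (subst sum.swap, intro sum.cong refl, subst sum.swap, rule refl)
    also have "\<dots> = (\<Sum>u\<in>A. \<Sum>v\<in>B. xlnx (\<Sum>x\<in>UNIV. P u v x) + R u * (\<Sum>x\<in>UNIV. P u v x))"
      by (intro sum.cong refl spread sum_nonneg) (use P in auto)
    finally show ?thesis by (simp add: sum.distrib sum_distrib_left[symmetric])
  qed
  have 3: "(\<Sum>d\<in>D. \<Sum>z\<in>UNIV. \<Sum>v\<in>B. xlnx (marg b A (flip (Pd d)) v z))
      = (\<Sum>z\<in>UNIV. \<Sum>v\<in>B. xlnx (marg b A (flip P) v z)) + (\<Sum>z\<in>UNIV. \<Sum>v\<in>B. psi D (\<lambda>d. marg b A (flip (Pd d)) v z))"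
  proof -
    have "(\<Sum>d\<in>D. \<Sum>z\<in>UNIV. \<Sum>v\<in>B. xlnx (marg b A (flip (Pd d)) v z))
        = (\<Sum>z\<in>UNIV. \<Sum>v\<in>B. \<Sum>d\<in>D. xlnx (marg b A (flip (Pd d)) v z))"
      by (subst sum.swap, intro sum.cong refl, subst sum.swap, rule refl)
    then show ?thesis
      by (simp add: psi_def Pd_def sum_marg_split[OF fin(3) r(2)] sum_subtractf)
  qed
  have 4: "(\<Sum>d\<in>D. \<Sum>y\<in>UNIV. xlnx (outp a A B (Pd d) y))
      = (\<Sum>y\<in>UNIV. xlnx (outp a A B P y)) + (\<Sum>y\<in>UNIV. psi D (\<lambda>d. outp a A B (Pd d) y))"
    unfolding Pd_def by (rule sum_xlnx_outp_split[OF fin(3) r(2)])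
  have 5: "(\<Sum>d\<in>D. \<Sum>z\<in>UNIV. xlnx (outp b A B (Pd d) z))
      = (\<Sum>z\<in>UNIV. xlnx (outp b A B P z)) + (\<Sum>z\<in>UNIV. psi D (\<lambda>d. outp b A B (Pd d) z))"
    unfolding Pd_def by (rule sum_xlnx_outp_split[OF fin(3) r(2)])
  have "(\<Sum>d\<in>D. blk lam a b A B (Pd d)) = (\<Sum>d\<in>D. \<Sum>y\<in>UNIV. \<Sum>u\<in>A. xlnx (marg a B (Pd d) u y))
      - (1 - lam) * (\<Sum>d\<in>D. \<Sum>y\<in>UNIV. xlnx (outp a A B (Pd d) y))
      + (\<Sum>d\<in>D. \<Sum>z\<in>UNIV. \<Sum>v\<in>B. xlnx (marg b A (flip (Pd d)) v z))
      - lam * (\<Sum>d\<in>D. \<Sum>z\<in>UNIV. xlnx (outp b A B (Pd d) z))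
      - (\<Sum>d\<in>D. \<Sum>u\<in>A. \<Sum>v\<in>B. xlnx (\<Sum>x\<in>UNIV. Pd d u v x))"
    unfolding blk_def side_def outp_flip by (simp add: sum.distrib sum_subtractf sum_distrib_left)
  also have "\<dots> = blk lam a b A B P
     + (\<Sum>z\<in>UNIV. \<Sum>v\<in>B. psi D (\<lambda>d. marg b A (flip (Pd d)) v z))
     - (1 - lam) * (\<Sum>y\<in>UNIV. psi D (\<lambda>d. outp a A B (Pd d) y))
     - lam * (\<Sum>z\<in>UNIV. psi D (\<lambda>d. outp b A B (Pd d) z))"
    unfolding 1 2 3 4 5 unfolding blk_def side_def outp_flip by (simp add: algebra_simps)
  finally show ?thesis by (simp only: Pd_def)
qed

text \<open>Conditioning reduces entropy: H(D|V,Z) <= H(D|Z) for the splitting index D.\<close>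

lemma psi_outp_le_psi_marg:
  assumes fin: "finite A" "finite B" "finite D" and b: "pos_channel b"
    and P: "\<And>d u v x. d \<in> D \<Longrightarrow> u \<in> A \<Longrightarrow> v \<in> B \<Longrightarrow> 0 \<le> P d u v x"
  shows "(\<Sum>z\<in>UNIV. psi D (\<lambda>d. outp b A B (P d) z)) \<le> (\<Sum>z\<in>UNIV. \<Sum>v\<in>B. psi D (\<lambda>d. marg b A (flip (P d)) v z))"
  unfolding outp_eq_sum_marg_flip using fin P
  by (intro sum_mono psi_sum marg_nonneg[OF b]) (auto simp: flip_def)

text \<open>At \<open>lam\<close> = 1 the gain of \<open>blk_split\<close> is I(U';VZ) - I(U';Z),
  which is nonnegative.\<close>

lemma blk_split_le:
  assumes fin: "finite A" "finite B" "finite D" and a: "pos_channel a" and b: "pos_channel b"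
    and P: "\<And>u v x. u \<in> A \<Longrightarrow> v \<in> B \<Longrightarrow> 0 \<le> P u v x"
    and r: "\<And>u d. u \<in> A \<Longrightarrow> d \<in> D \<Longrightarrow> 0 \<le> r u d" "\<And>u. u \<in> A \<Longrightarrow> (\<Sum>d\<in>D. r u d) = 1"
  shows "blk 1 a b A B P \<le> (\<Sum>d\<in>D. blk 1 a b A B (\<lambda>u v x. r u d * P u v x))"
  using psi_outp_le_psi_marg[OF fin b, where P = "\<lambda>d u v x. r u d * P u v x"] P r
  by (subst blk_split[OF fin a b P r]) auto

lemma sum_supp_inp:
  fixes f :: "'u \<times> 'v \<times> 'w \<times> 'x::finite \<Rightarrow> real"
  assumes fin: "finite A" "finite B" "finite C" and sub: "supp f \<subseteq> A \<times> B \<times> C \<times> UNIV"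
  shows "sum f (supp f) = (\<Sum>x\<in>UNIV. \<Sum>w\<in>C. inp A B (slice f w) x)"
proof -
  have "(\<Sum>x\<in>UNIV. \<Sum>w\<in>C. inp A B (slice f w) x) = (\<Sum>w\<in>C. \<Sum>u\<in>A. \<Sum>x\<in>UNIV. \<Sum>v\<in>B. f (u, v, w, x))"
    unfolding inp_def slice_def by (subst sum.swap, intro sum.cong refl, subst sum.swap) (rule refl)
  also have "\<dots> = (\<Sum>w\<in>C. \<Sum>u\<in>A. \<Sum>v\<in>B. \<Sum>x\<in>UNIV. f (u, v, w, x))"
    by (intro sum.cong refl sum.swap)
  finally show ?thesis by (subst sum_supp_box[OF assms]) auto
qed

text \<open>The identity channel \<open>r\<close> splits each block into its rows, so the new W is
  the pair (W, U), coded by \<open>prod_encode\<close>. Given the pair, U is constant. The alphabet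
  of W grows, so its size has to be reduced afterwards.\<close>

lemma absorbU:
  fixes p :: "('x::finite) law"
  assumes fin: "finite A" "finite B" "finite C" and a: "pos_channel a" and b: "pos_channel b"
    and p: "is_dist p" and sub: "supp p \<subseteq> A \<times> B \<times> C \<times> UNIV"
  shows "\<exists>(p' :: 'x law) C'. finite C' \<and> is_dist p' \<and> supp p' \<subseteq> A \<times> B \<times> C' \<times> UNIV
     \<and> gobj 1 a b A B C (slice p) \<le> gobj 1 a b A B C' (slice p')
     \<and> (\<forall>u v w x u' v' x'. p' (u, v, w, x) \<noteq> 0 \<longrightarrow> p' (u', v', w, x') \<noteq> 0 \<longrightarrow> u = u')"
proof -
  define r :: "nat \<Rightarrow> nat \<Rightarrow> real" where "r = (\<lambda>u d. if u = d then 1 else 0)"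
  define p' where "p' = (\<lambda>(u, v, w', x). case prod_decode w' of (w, d) \<Rightarrow> r u d * p (u, v, w, x))"
  define C' where "C' = prod_encode ` (C \<times> A)"
  have p0: "\<And>s. 0 \<le> p s" using p unfolding is_dist_def by blast
  have sl: "slice p' (prod_encode (w, d)) = (\<lambda>u v x. r u d * slice p w u v x)" for w d
    by (simp add: slice_def p'_def)
  have sumC: "(\<Sum>w\<in>C'. f w) = (\<Sum>w\<in>C. \<Sum>d\<in>A. f (prod_encode (w, d)))" for f :: "nat \<Rightarrow> real"
    unfolding C'_def by (subst sum.reindex) (simp_all only: inj_prod_encode sum.cartesian_product' o_def)
  have r1: "(\<Sum>d\<in>A. r u d) = 1" if "u \<in> A" for u using that fin by (simp add: r_def)
  have r0: "0 \<le> r u d" for u d by (simp add: r_def)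
  have sub': "supp p' \<subseteq> A \<times> B \<times> C' \<times> UNIV"
  proof
    fix s assume "s \<in> supp p'"
    moreover obtain u v w' x where s: "s = (u, v, w', x)" by (cases s)
    moreover obtain w d where wd: "prod_decode w' = (w, d)" by fastforce
    moreover have w: "w' = prod_encode (w, d)" using prod_decode_inverse[of w'] wd by simp
    ultimately have "u = d" "p (u, v, w, x) \<noteq> 0" by (auto simp: supp_def p'_def r_def split: if_splits)
    then have "(u, v, w, x) \<in> A \<times> B \<times> C \<times> UNIV" using sub by (auto simp: supp_def)
    then show "s \<in> A \<times> B \<times> C' \<times> UNIV" using \<open>u = d\<close> by (auto simp: s w C'_def)
  qed
  have finC': "finite C'" using fin by (simp add: C'_def)
  have inp': "(\<Sum>w\<in>C'. inp A B (slice p' w) x) = (\<Sum>w\<in>C. inp A B (slice p w) x)" for x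
  proof -
    have "(\<Sum>d\<in>A. inp A B (\<lambda>u v x. r u d * slice p w u v x) x) = inp A B (slice p w) x" for w
      unfolding inp_def
      by (subst sum.swap, rule sum.cong[OF refl], subst sum.swap) (simp add: sum_distrib_right[symmetric] r1)
    then show ?thesis by (simp add: sumC sl)
  qed
  have dist: "is_dist p'"
  proof -
    have "sum p' (supp p') = 1"
      using sum_supp_inp[OF fin(1,2) finC' sub'] sum_supp_inp[OF fin sub] inp' p by (simp add: is_dist_def)
    moreover have "finite (supp p')" using sub' fin finC' by (auto intro: finite_subset)
    moreover have "0 \<le> p' s" for s
      using p0 r0 by (cases s) (simp add: p'_def split_def)
    ultimately show ?thesis unfolding is_dist_def by blast
  qed
  have ge: "gobj 1 a b A B C (slice p) \<le> gobj 1 a b A B C' (slice p')"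
  proof -
    have "(\<Sum>w\<in>C. blk 1 a b A B (slice p w)) \<le> (\<Sum>w\<in>C'. blk 1 a b A B (slice p' w))"
      unfolding sumC sl using p0 r0 r1
      by (intro sum_mono blk_split_le[OF fin(1,2,1) a b]) (auto simp: slice_def)
    moreover have "tot a A B C' (slice p') = tot a A B C (slice p)"
      by (rule tot_cong_inp) (rule inp')
    ultimately show ?thesis by (simp add: gobj_def)
  qed
  have "u = u'" if "p' (u, v, w, x) \<noteq> 0" "p' (u', v', w, x') \<noteq> 0" for u v w x u' v' x'
    using that by (cases "prod_decode w") (simp add: p'_def r_def split: if_splits)
  then have uniq: "\<forall>u v w x u' v' x'. p' (u, v, w, x) \<noteq> 0 \<longrightarrow> p' (u', v', w, x') \<noteq> 0 \<longrightarrow> u = u'"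
    by simp
  show ?thesis by (rule exI[of _ p'], rule exI[of _ C']) (intro conjI finC' dist sub' ge uniq)
qed

section \<open>Normal form\<close>

lemma absorbV:
  fixes p :: "('x::finite) law"
  assumes fin: "finite A" "finite B" "finite C" and a: "pos_channel a" and b: "pos_channel b"
    and p: "is_dist p" and sub: "supp p \<subseteq> A \<times> B \<times> C \<times> UNIV"
  shows "\<exists>(p' :: 'x law) C'. finite C' \<and> is_dist p' \<and> supp p' \<subseteq> A \<times> B \<times> C' \<times> UNIV
     \<and> gobj 0 a b A B C (slice p) \<le> gobj 0 a b A B C' (slice p')
     \<and> (\<forall>u v w x u' v' x'. p' (u, v, w, x) \<noteq> 0 \<longrightarrow> p' (u', v', w, x') \<noteq> 0 \<longrightarrow> v = v')"
proof -
  have "supp (p \<circ> swapUV) \<subseteq> B \<times> A \<times> C \<times> UNIV"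
    using sub unfolding supp_swapUV by (auto simp: swapUV_def dest!: subsetD)
  then obtain p' :: "'x law" and C' where p': "finite C'" "is_dist p'" "supp p' \<subseteq> B \<times> A \<times> C' \<times> UNIV"
      "gobj 1 b a B A C (slice (p \<circ> swapUV)) \<le> gobj 1 b a B A C' (slice p')"
      "\<forall>u v w x u' v' x'. p' (u, v, w, x) \<noteq> 0 \<longrightarrow> p' (u', v', w, x') \<noteq> 0 \<longrightarrow> u = u'"
    using absorbU[OF fin(2,1,3) b a is_dist_swapUV[OF p]] by blast
  have "p' = (p' \<circ> swapUV) \<circ> swapUV" by (simp add: o_def)
  then have "slice p' = (\<lambda>w. flip (slice (p' \<circ> swapUV) w))" by (metis slice_swapUV)
  then have ge: "gobj 0 a b A B C (slice p) \<le> gobj 0 a b A B C' (slice (p' \<circ> swapUV))"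
    using p'(4) gobj_flip[of 0 b a B A C "slice p"] gobj_flip[of 0 b a B A C' "slice (p' \<circ> swapUV)"]
    by (simp add: slice_swapUV[of p])
  have sub': "supp (p' \<circ> swapUV) \<subseteq> A \<times> B \<times> C' \<times> UNIV"
    using p'(3) unfolding supp_swapUV by (auto simp: swapUV_def dest!: subsetD)
  have uniq: "\<forall>u v w x u' v' x'. (p' \<circ> swapUV) (u, v, w, x) \<noteq> 0 \<longrightarrow> (p' \<circ> swapUV) (u', v', w, x') \<noteq> 0 \<longrightarrow> v = v'"
    using p'(5) by (simp add: swapUV_def) blast
  show ?thesis
    by (rule exI[of _ "p' \<circ> swapUV"], rule exI[of _ C']) (intro conjI p'(1) is_dist_swapUV p'(2) sub' ge uniq)
qed

section \<open>Invariance under relabelling of the alphabets\<close>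

lemma marg_relabel:
  assumes "bij_betw \<rho> B B"
  shows "marg a B (\<lambda>u v x. P (\<sigma> u) (\<rho> v) x) u y = marg a B P (\<sigma> u) y"
  unfolding marg_def by (rule sum.reindex_bij_betw[OF assms])

lemma outp_relabel:
  assumes "bij_betw \<sigma> A A" "bij_betw \<rho> B B"
  shows "outp a A B (\<lambda>u v x. P (\<sigma> u) (\<rho> v) x) y = outp a A B P y"
  unfolding outp_def marg_relabel[OF assms(2)] by (rule sum.reindex_bij_betw[OF assms(1)])

lemma side_relabel:
  assumes "bij_betw \<sigma> A A" "bij_betw \<rho> B B"
  shows "side l a A B (\<lambda>u v x. P (\<sigma> u) (\<rho> v) x) = side l a A B P"
proof -
  have "(\<Sum>u\<in>A. xlnx (marg a B P (\<sigma> u) y)) = (\<Sum>u\<in>A. xlnx (marg a B P u y))" for y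
    by (rule sum.reindex_bij_betw[OF assms(1)])
  then show ?thesis unfolding side_def marg_relabel[OF assms(2)] outp_relabel[OF assms] by simp
qed

lemma blk_relabel:
  assumes "bij_betw \<sigma> A A" "bij_betw \<rho> B B"
  shows "blk lam a b A B (\<lambda>u v x. P (\<sigma> u) (\<rho> v) x) = blk lam a b A B P"
proof -
  have "(\<Sum>u\<in>A. \<Sum>v\<in>B. xlnx (\<Sum>x\<in>UNIV. P (\<sigma> u) (\<rho> v) x)) = (\<Sum>u\<in>A. \<Sum>v\<in>B. xlnx (\<Sum>x\<in>UNIV. P (\<sigma> u) v x))"
    by (intro sum.cong refl sum.reindex_bij_betw[OF assms(2)])
  also have "\<dots> = (\<Sum>u\<in>A. \<Sum>v\<in>B. xlnx (\<Sum>x\<in>UNIV. P u v x))"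
    by (rule sum.reindex_bij_betw[OF assms(1)])
  finally show ?thesis
    unfolding blk_def side_relabel[OF assms]
    using side_relabel[OF assms(2,1), of lam b "flip P"] by (simp add: flip_def)
qed

text \<open>Symbols of U and V are compared only inside a block, so their permutations may depend on
  w.\<close>

lemma gobj_relabel:
  assumes \<sigma>: "\<And>w. w \<in> C \<Longrightarrow> bij_betw (\<sigma> w) A A" and \<rho>: "\<And>w. w \<in> C \<Longrightarrow> bij_betw (\<rho> w) B B"
    and \<tau>: "bij_betw \<tau> C C"
  shows "gobj lam a b A B C (\<lambda>l u v x. Q (\<tau> l) (\<sigma> (\<tau> l) u) (\<rho> (\<tau> l) v) x) = gobj lam a b A B C Q"
proof -
  let ?R = "\<lambda>w u v x. Q w (\<sigma> w u) (\<rho> w v) x"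
  have b: "(\<Sum>l\<in>C. blk lam a b A B (?R (\<tau> l))) = (\<Sum>w\<in>C. blk lam a b A B (Q w))"
    by (subst sum.reindex_bij_betw[OF \<tau>]) (simp add: blk_relabel[OF \<sigma> \<rho>])
  have o: "(\<Sum>l\<in>C. outp a A B (?R (\<tau> l)) y) = (\<Sum>w\<in>C. outp a A B (Q w) y)" for y
    by (subst sum.reindex_bij_betw[OF \<tau>]) (simp add: outp_relabel[OF \<sigma> \<rho>])
  have o': "(\<Sum>l\<in>C. outp b A B (?R (\<tau> l)) y) = (\<Sum>w\<in>C. outp b A B (Q w) y)" for y
    by (subst sum.reindex_bij_betw[OF \<tau>]) (simp add: outp_relabel[OF \<sigma> \<rho>])
  show ?thesis unfolding gobj_def tot_def b o o' ..
qed

text \<open>Bijectivity on \<open>{..<N}\<close> reindexes the sums over the box; bijectivity on all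
  of nat preserves \<open>is_dist\<close> under composition. Outside the segment the map is the
  identity.\<close>

lemma initial_segment_permutation:
  fixes N :: nat
  assumes "F \<subseteq> {..<N}"
  shows "\<exists>\<sigma>. bij_betw \<sigma> {..<N} {..<N} \<and> bij \<sigma> \<and> \<sigma> ` {..<card F} = F"
proof -
  have fin: "finite F" using assms finite_subset by blast
  have cF: "card F \<le> N" using card_mono[OF _ assms] by simp
  obtain f where f: "bij_betw f {..<card F} F"
    using fin finite_same_card_bij[of "{..<card F}" F] by auto
  have "card {card F..<N} = card ({..<N} - F)" using assms fin by (simp add: card_Diff_subset)
  then obtain g where g: "bij_betw g {card F..<N} ({..<N} - F)"
    using finite_same_card_bij[of "{card F..<N}" "{..<N} - F"] by auto
  define h where "h = (\<lambda>i. if i \<in> {..<card F} then f i else g i)"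
  have "bij_betw h ({..<card F} \<union> {card F..<N}) (F \<union> ({..<N} - F))"
    unfolding h_def by (rule bij_betw_disjoint_Un[OF f g]) auto
  moreover have "{..<card F} \<union> {card F..<N} = {..<N}" "F \<union> ({..<N} - F) = {..<N}"
    using cF assms by auto
  ultimately have h: "bij_betw h {..<N} {..<N}" by simp
  define \<sigma> where "\<sigma> = (\<lambda>i. if i \<in> {..<N} then h i else id i)"
  have b1: "bij_betw \<sigma> {..<N} {..<N}"
    using h by (rule bij_betw_cong[THEN iffD1, rotated]) (simp add: \<sigma>_def)
  have "bij_betw \<sigma> ({..<N} \<union> {N..}) ({..<N} \<union> {N..})"
    unfolding \<sigma>_def by (rule bij_betw_disjoint_Un[OF h]) (auto simp: bij_betw_def)
  moreover have "{..<N} \<union> {N..} = UNIV" by auto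
  ultimately have b2: "bij \<sigma>" by simp
  have "\<sigma> ` {..<card F} = f ` {..<card F}" using cF by (intro image_cong) (auto simp: \<sigma>_def h_def)
  then have "\<sigma> ` {..<card F} = F" using f by (simp add: bij_betw_def)
  with b1 b2 show ?thesis by blast
qed

text \<open>Bounds per block become bounds over all w: each block has its active symbols moved to an
  initial segment by its own permutations. The shape of \<open>\<phi>\<close> is part of the
  conclusion because its injectivity in u and v transports constancy given W.\<close>

lemma relabel:
  fixes p :: "('x::finite) law"
  assumes p: "is_dist p" and sub: "supp p \<subseteq> {..<N} \<times> {..<N} \<times> {..<N} \<times> UNIV"
    and cU: "\<And>w. card (actU p w) \<le> kU" and cV: "\<And>w. card (actV p w) \<le> kV" and cW: "card (actW p) \<le> kW"
  shows "\<exists>\<phi>. bij \<phi> \<and> supp (p \<circ> \<phi>) \<subseteq> {..<kU} \<times> {..<kV} \<times> {..<kW} \<times> UNIV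
     \<and> supp (p \<circ> \<phi>) \<subseteq> {..<N} \<times> {..<N} \<times> {..<N} \<times> UNIV
     \<and> (\<forall>lam a b. gobj lam (a :: 'x \<Rightarrow> 'y::finite \<Rightarrow> real) (b :: 'x \<Rightarrow> 'z::finite \<Rightarrow> real) {..<N} {..<N} {..<N} (slice (p \<circ> \<phi>))
          = gobj lam a b {..<N} {..<N} {..<N} (slice p))
     \<and> (\<exists>\<sigma> \<rho> \<tau>. (\<forall>w. inj (\<sigma> w)) \<and> (\<forall>w. inj (\<rho> w)) \<and> \<phi> = (\<lambda>(u, v, l, x). (\<sigma> (\<tau> l) u, \<rho> (\<tau> l) v, \<tau> l, x)))"
proof -
  have "\<exists>\<sigma>. bij_betw \<sigma> {..<N} {..<N} \<and> bij \<sigma> \<and> \<sigma> ` {..<card (actU p w)} = actU p w" for w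
    by (rule initial_segment_permutation[OF actU_subset[OF sub]])
  then obtain \<sigma> where \<sigma>: "\<And>w. bij_betw (\<sigma> w) {..<N} {..<N}" "\<And>w. bij (\<sigma> w)"
      "\<And>w. \<sigma> w ` {..<card (actU p w)} = actU p w" by metis
  have "\<exists>\<rho>. bij_betw \<rho> {..<N} {..<N} \<and> bij \<rho> \<and> \<rho> ` {..<card (actV p w)} = actV p w" for w
    by (rule initial_segment_permutation[OF actV_subset[OF sub]])
  then obtain \<rho> where \<rho>: "\<And>w. bij_betw (\<rho> w) {..<N} {..<N}" "\<And>w. bij (\<rho> w)"
      "\<And>w. \<rho> w ` {..<card (actV p w)} = actV p w" by metis
  obtain \<tau> where \<tau>: "bij_betw \<tau> {..<N} {..<N}" "bij \<tau>" "\<tau> ` {..<card (actW p)} = actW p"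
    using initial_segment_permutation[OF actW_subset[OF sub]] by blast
  define \<phi> where "\<phi> = (\<lambda>(u, v, l, x :: 'x). (\<sigma> (\<tau> l) u, \<rho> (\<tau> l) v, \<tau> l, x))"
  have inj: "inj (\<sigma> w)" "inj (\<rho> w)" "inj \<tau>" for w
    using bij_is_inj[OF \<sigma>(2)] bij_is_inj[OF \<rho>(2)] bij_is_inj[OF \<tau>(2)] by blast+
  have "bij \<phi>"
  proof (rule bijI)
    show "inj \<phi>"
      by (rule injI) (clarsimp simp: \<phi>_def inj_eq[OF inj(1)] inj_eq[OF inj(2)] inj_eq[OF inj(3)] split: prod.splits)
    show "surj \<phi>"
    proof (rule surjI)
      fix s
      show "\<phi> ((\<lambda>(u, v, w, x). (inv (\<sigma> w) u, inv (\<rho> w) v, inv \<tau> w, x)) s) = s"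
        using \<sigma>(2) \<rho>(2) \<tau>(2) by (simp add: \<phi>_def split_def bij_is_surj surj_f_inv_f)
    qed
  qed
  moreover have "s \<in> {..<min kU N} \<times> {..<min kV N} \<times> {..<min kW N} \<times> UNIV" if s: "s \<in> supp (p \<circ> \<phi>)" for s
  proof -
    obtain u v l x where s': "s = (u, v, l, x)" by (cases s)
    with s have n: "p (\<sigma> (\<tau> l) u, \<rho> (\<tau> l) v, \<tau> l, x) \<noteq> 0" by (simp add: supp_def \<phi>_def)
    have card: "card F \<le> N" if "F \<subseteq> {..<N}" for F using card_mono[OF _ that] by simp
    have "\<sigma> (\<tau> l) u \<in> \<sigma> (\<tau> l) ` {..<card (actU p (\<tau> l))}" using n unfolding \<sigma>(3) by (auto simp: actU_def)
    then have "u < card (actU p (\<tau> l))" using inj(1) by (simp add: inj_image_mem_iff)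
    moreover have "\<rho> (\<tau> l) v \<in> \<rho> (\<tau> l) ` {..<card (actV p (\<tau> l))}" using n unfolding \<rho>(3) by (auto simp: actV_def)
    then have "v < card (actV p (\<tau> l))" using inj(2) by (simp add: inj_image_mem_iff)
    moreover have "\<tau> l \<in> \<tau> ` {..<card (actW p)}" using n unfolding \<tau>(3) by (auto simp: actW_def)
    then have "l < card (actW p)" using inj(3) by (simp add: inj_image_mem_iff)
    ultimately show ?thesis
      using cU[of "\<tau> l"] cV[of "\<tau> l"] cW card[OF actU_subset[OF sub, of "\<tau> l"]]
        card[OF actV_subset[OF sub, of "\<tau> l"]] card[OF actW_subset[OF sub]]
      by (simp add: s')
  qed
  then have "supp (p \<circ> \<phi>) \<subseteq> {..<kU} \<times> {..<kV} \<times> {..<kW} \<times> UNIV"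
      "supp (p \<circ> \<phi>) \<subseteq> {..<N} \<times> {..<N} \<times> {..<N} \<times> UNIV"
    by fastforce+
  moreover have "gobj lam a b {..<N} {..<N} {..<N} (slice (p \<circ> \<phi>)) = gobj lam a b {..<N} {..<N} {..<N} (slice p)"
    for lam and a :: "'x \<Rightarrow> 'y \<Rightarrow> real" and b :: "'x \<Rightarrow> 'z \<Rightarrow> real"
    using gobj_relabel[where Q = "slice p", OF \<sigma>(1) \<rho>(1) \<tau>(1), of lam a b] by (simp add: slice_def \<phi>_def)
  moreover have "(\<forall>w. inj (\<sigma> w)) \<and> (\<forall>w. inj (\<rho> w)) \<and> \<phi> = (\<lambda>(u, v, l, x). (\<sigma> (\<tau> l) u, \<rho> (\<tau> l) v, \<tau> l, x))"
    using inj by (simp add: \<phi>_def)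
  ultimately show ?thesis
    by (intro exI[of _ \<phi>] conjI allI) (assumption | rule exI)+
qed

definition functional :: "('u \<times> 'v \<times> 'w \<times> 'x \<Rightarrow> real) \<Rightarrow> bool" where
  "functional p \<longleftrightarrow> (\<forall>u v w x x'. p (u, v, w, x) \<noteq> 0 \<longrightarrow> p (u, v, w, x') \<noteq> 0 \<longrightarrow> x = x')"

definition constU :: "('u \<times> 'v \<times> 'w \<times> 'x \<Rightarrow> real) \<Rightarrow> bool" where
  "constU p \<longleftrightarrow> (\<forall>u v w x u' v' x'. p (u, v, w, x) \<noteq> 0 \<longrightarrow> p (u', v', w, x') \<noteq> 0 \<longrightarrow> u = u')"

definition constV :: "('u \<times> 'v \<times> 'w \<times> 'x \<Rightarrow> real) \<Rightarrow> bool" where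
  "constV p \<longleftrightarrow> (\<forall>u v w x u' v' x'. p (u, v, w, x) \<noteq> 0 \<longrightarrow> p (u', v', w, x') \<noteq> 0 \<longrightarrow> v = v')"

lemma supp_subset_box:
  fixes p :: "('x::finite) law"
  assumes "finite (supp p)"
  shows "\<exists>N. supp p \<subseteq> {..<N} \<times> {..<N} \<times> {..<N} \<times> UNIV"
proof -
  let ?m = "\<lambda>(u, v, w, x :: 'x). u + v + w"
  obtain N where "\<forall>s\<in>supp p. ?m s < N"
    using finite_nat_set_iff_bounded[of "?m ` supp p"] assms by auto
  then have "supp p \<subseteq> {..<N} \<times> {..<N} \<times> {..<N} \<times> UNIV" by force
  then show ?thesis ..
qed

lemma pos_channel_bc:
  assumes "is_bc q" "\<forall>x y. 0 < qY q x y" "\<forall>x z. 0 < qZ q x z"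
  shows "pos_channel (qY q)" "pos_channel (qZ q)"
proof -
  have 1: "(\<Sum>y\<in>UNIV. \<Sum>z\<in>UNIV. q x y z) = 1" for x using assms by (simp add: is_bc_def)
  then have "(\<Sum>z\<in>UNIV. \<Sum>y\<in>UNIV. q x y z) = 1" for x by (subst sum.swap)
  with 1 assms show "pos_channel (qY q)" "pos_channel (qZ q)"
    by (simp_all add: pos_channel_def qY_def qZ_def)
qed

text \<open>The order matters. Absorbing U or V at an end value of \<open>lam\<close> enlarges the
  alphabet of W; reduction afterwards only removes support points, and relabelling is injective
  within blocks, so neither destroys the constancy gained.\<close>

lemma normal_form:
  fixes q :: "'x::finite \<Rightarrow> 'y::finite \<Rightarrow> 'z::finite \<Rightarrow> real" and p :: "'x law"
  assumes q: "is_bc q" and a: "pos_channel (qY q)" and b: "pos_channel (qZ q)"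
    and lam: "0 \<le> lam" "lam \<le> 1" and p: "is_dist p"
  shows "\<exists>p' :: 'x law. is_dist p' \<and> objective lam q p \<le> objective lam q p' \<and>
     supp p' \<subseteq> {..<min (CARD('x)) (CARD('y))} \<times>
       {..<min (CARD('x)) (CARD('z))} \<times> {..<CARD('x)} \<times> UNIV \<and>
     functional p' \<and> (lam = 1 \<longrightarrow> constU p') \<and> (lam = 0 \<longrightarrow> constV p')"
proof -
  let ?box = "\<lambda>N. {..<N} \<times> {..<N} \<times> {..<N} \<times> (UNIV :: 'x set)"
  have "\<exists>p1 :: 'x law. is_dist p1 \<and> objective lam q p \<le> objective lam q p1
      \<and> (lam = 1 \<longrightarrow> constU p1) \<and> (lam = 0 \<longrightarrow> constV p1)"
  proof -
    obtain N where N: "supp p \<subseteq> ?box N" using supp_subset_box[of p] p unfolding is_dist_def by blast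
    let ?G = "\<lambda>l C p. gobj l (qY q) (qZ q) {..<N} {..<N} C (slice p)"
    have P: "objective lam q p = ?G lam {..<N} p"
      by (rule objective_eq_gobj[OF q p _ _ _ N]) simp_all
    have fin: "finite {..<N}" by simp
    consider "lam = 1" | "lam = 0" | "lam \<noteq> 0" "lam \<noteq> 1" by blast
    then show ?thesis
    proof cases
      case 1
      obtain p1 :: "'x law" and C' where p1: "finite C'" "is_dist p1"
        "supp p1 \<subseteq> {..<N} \<times> {..<N} \<times> C' \<times> UNIV"
        "?G 1 {..<N} p \<le> ?G 1 C' p1"
        "constU p1"
        using absorbU[OF fin fin fin a b p N] unfolding constU_def by blast
      have "objective lam q p1 = ?G lam C' p1"
        by (rule objective_eq_gobj[OF q p1(2) fin fin p1(1) p1(3)])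
      then show ?thesis using p1 1 P by auto
    next
      case 2
      obtain p1 :: "'x law" and C' where p1: "finite C'" "is_dist p1"
        "supp p1 \<subseteq> {..<N} \<times> {..<N} \<times> C' \<times> UNIV"
        "?G 0 {..<N} p \<le> ?G 0 C' p1"
        "constV p1"
        using absorbV[OF fin fin fin a b p N] unfolding constV_def by blast
      have "objective lam q p1 = ?G lam C' p1"
        by (rule objective_eq_gobj[OF q p1(2) fin fin p1(1) p1(3)])
      then show ?thesis using p1 2 P by auto
    next
      case 3
      then show ?thesis using p by auto
    qed
  qed
  then obtain p1 :: "'x law" where p1: "is_dist p1" "objective lam q p \<le> objective lam q p1"
      "lam = 1 \<longrightarrow> constU p1" "lam = 0 \<longrightarrow> constV p1" by blast
  obtain N where N: "supp p1 \<subseteq> ?box N" using supp_subset_box[of p1] p1(1) unfolding is_dist_def by blast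
  let ?G = "\<lambda>p. gobj lam (qY q) (qZ q) {..<N} {..<N} {..<N} (slice p)"
  obtain p2 where p2: "is_dist p2" "supp p2 \<subseteq> supp p1"
    "?G p1 \<le> ?G p2"
    "\<And>w. card (actU p2 w) \<le> min (CARD('x)) (CARD('y))"
    "\<And>w. card (actV p2 w) \<le> min (CARD('x)) (CARD('z))"
    "card (actW p2) \<le> CARD('x)" "functional p2"
    using reduce[OF finite_lessThan finite_lessThan finite_lessThan a b lam p1(1) N] unfolding functional_def by blast
  have N2: "supp p2 \<subseteq> ?box N" using p2(2) N by simp
  obtain \<phi> \<sigma> \<rho> \<tau> where \<phi>: "bij \<phi>"
    "supp (p2 \<circ> \<phi>) \<subseteq> {..<min (CARD('x)) (CARD('y))} \<times>
       {..<min (CARD('x)) (CARD('z))} \<times> {..<CARD('x)} \<times> UNIV"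
    "supp (p2 \<circ> \<phi>) \<subseteq> ?box N"
    "?G (p2 \<circ> \<phi>) = ?G p2"
    and inj: "\<forall>w. inj (\<sigma> w)" "\<forall>w. inj (\<rho> w)" and \<phi>_eq: "\<phi> = (\<lambda>(u, v, l, x). (\<sigma> (\<tau> l) u, \<rho> (\<tau> l) v, \<tau> l, x))"
    using relabel[where ?'y = 'y and ?'z = 'z, OF p2(1) N2 p2(4-6)] by blast
  define p3 where "p3 = p2 \<circ> \<phi>"
  have p3: "is_dist p3" unfolding p3_def by (rule is_dist_bij[OF p2(1) \<phi>(1)])
  have ev: "p3 (u, v, l, x) = p2 (\<sigma> (\<tau> l) u, \<rho> (\<tau> l) v, \<tau> l, x)" for u v l x
    by (simp add: p3_def \<phi>_eq)
  have "objective lam q p1 = ?G p1"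
    by (rule objective_eq_gobj[OF q p1(1) _ _ _ N]) simp_all
  also have "\<dots> \<le> ?G p3"
    using p2(3) \<phi>(4) by (simp add: p3_def)
  also have "\<dots> = objective lam q p3"
    by (rule objective_eq_gobj[OF q p3, symmetric]) (use \<phi>(3) in \<open>simp_all add: p3_def\<close>)
  finally have "objective lam q p \<le> objective lam q p3" using p1(2) by simp
  moreover have "functional p3"
    using p2(7) unfolding functional_def ev by blast
  moreover have sub21: "p1 (u, v, w, x) \<noteq> 0" if "p2 (u, v, w, x) \<noteq> 0" for u v w x
    using p2(2) that by (auto simp: supp_def)
  have "constU p3" if "constU p1"
    unfolding constU_def ev
  proof (intro allI impI)
    fix u v w x u' v' x'
    assume "p2 (\<sigma> (\<tau> w) u, \<rho> (\<tau> w) v, \<tau> w, x) \<noteq> 0" "p2 (\<sigma> (\<tau> w) u', \<rho> (\<tau> w) v', \<tau> w, x') \<noteq> 0"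
    then have "\<sigma> (\<tau> w) u = \<sigma> (\<tau> w) u'" using that sub21 unfolding constU_def by blast
    then show "u = u'" using inj(1) by (simp add: inj_eq)
  qed
  moreover have "constV p3" if "constV p1"
    unfolding constV_def ev
  proof (intro allI impI)
    fix u v w x u' v' x'
    assume "p2 (\<sigma> (\<tau> w) u, \<rho> (\<tau> w) v, \<tau> w, x) \<noteq> 0" "p2 (\<sigma> (\<tau> w) u', \<rho> (\<tau> w) v', \<tau> w, x') \<noteq> 0"
    then have "\<rho> (\<tau> w) v = \<rho> (\<tau> w) v'" using that sub21 unfolding constV_def by blast
    then show "v = v'" using inj(2) by (simp add: inj_eq)
  qed
  ultimately show ?thesis using p3 \<phi>(2) p1(3,4) unfolding p3_def[symmetric] by (intro exI[of _ p3]) simp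
qed

section \<open>Existence of a maximiser and optimality of its blocks\<close>

lemma continuous_on_xlnx' [continuous_intros]:
  "continuous_on S f \<Longrightarrow> continuous_on S (\<lambda>x. xlnx (f x))"
  by (rule continuous_on_compose2[OF continuous_on_xlnx]) auto

lemma continuous_on_gobj_slice: "continuous_on UNIV (\<lambda>p. gobj lam a b A B C (slice p))"
  unfolding gobj_def blk_def side_def tot_def outp_def marg_def flip_def slice_def
  by (intro continuous_intros continuous_on_product_coordinates)

text \<open>The box in \<open>normal_form\<close> does not depend on the law, so every value is
  dominated by one on a fixed box. There the laws form a compact set in the product
  topology.\<close>

lemma exists_max:
  fixes q :: "'x::finite \<Rightarrow> 'y::finite \<Rightarrow> 'z::finite \<Rightarrow> real"
  assumes q: "is_bc q" and a: "pos_channel (qY q)" and b: "pos_channel (qZ q)"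
    and lam: "0 \<le> lam" "lam \<le> 1"
  shows "\<exists>p :: 'x law. is_dist p \<and> (\<forall>p'. is_dist p' \<longrightarrow> objective lam q p' \<le> objective lam q p)"
proof -
  let ?n = "CARD('x)"
  let ?N = "{..<?n}"
  let ?box = "?N \<times> ?N \<times> ?N \<times> (UNIV :: 'x set)"
  let ?S = "\<lambda>s. if s \<in> ?box then {0..1} else {0 :: real}"
  define K where "K = {p :: 'x law. is_dist p \<and> supp p \<subseteq> ?box}"
  \<comment> \<open>Off the box the factor is the one-point set {0}, so Tychonoff applies to all
    coordinates at once; the total mass cuts out a closed set.\<close>
  have K_eq: "K = (PiE UNIV ?S) \<inter> {p. sum p ?box = 1}"
  proof (intro set_eqI iffI)
    fix p assume "p \<in> K"
    then have p: "is_dist p" "supp p \<subseteq> ?box" by (auto simp: K_def)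
    have "sum p (supp p) = sum p ?box"
      by (rule sum.mono_neutral_left[OF _ p(2)]) (simp_all add: supp_def)
    then have s: "sum p ?box = 1" using p(1) by (simp add: is_dist_def)
    have p0: "0 \<le> p s" for s using p(1) unfolding is_dist_def by blast
    have "p s \<le> 1" if "s \<in> ?box" for s
    proof -
      have "p s = sum p {s}" by simp
      also have "\<dots> \<le> sum p ?box" by (rule sum_mono2) (use that p0 in auto)
      finally show ?thesis using s by simp
    qed
    moreover have "p s = 0" if "s \<notin> ?box" for s
    proof -
      have "s \<notin> supp p" using p(2) that by blast
      then show ?thesis by (simp add: supp_def)
    qed
    ultimately show "p \<in> (PiE UNIV ?S) \<inter> {p. sum p ?box = 1}" using p0 s by auto
  next
    fix p assume p: "p \<in> (PiE UNIV ?S) \<inter> {p. sum p ?box = 1}"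
    have pS: "p s \<in> ?S s" for s by (rule PiE_mem[OF IntD1[OF p] UNIV_I])
    have p0: "0 \<le> p s" for s using pS[of s] by (auto split: if_splits)
    have sub: "supp p \<subseteq> ?box"
    proof
      fix s assume "s \<in> supp p"
      then show "s \<in> ?box" using pS[of s] by (auto simp: supp_def split: if_splits)
    qed
    have "sum p (supp p) = sum p ?box"
      by (rule sum.mono_neutral_left[OF _ sub]) (simp_all add: supp_def)
    moreover have "finite (supp p)" using sub by (rule finite_subset) simp
    ultimately show "p \<in> K" using p p0 sub unfolding K_def is_dist_def by simp
  qed
  have "compactin (product_topology (\<lambda>s. euclidean) UNIV) (PiE UNIV ?S)"
    by (subst compactin_PiE) auto
  then have "compact (PiE UNIV ?S)" by (simp add: euclidean_product_topology)
  moreover have "closed {p :: 'x law. sum p ?box = 1}"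
    by (intro closed_Collect_eq continuous_intros continuous_on_product_coordinates)
  ultimately have "compact K" unfolding K_eq by (rule compact_Int_closed)
  moreover have "K \<noteq> {}"
  proof -
    define s0 :: "nat \<times> nat \<times> nat \<times> 'x" where "s0 = (0, 0, 0, undefined)"
    define p0 :: "'x law" where "p0 = (\<lambda>s. if s = s0 then 1 else 0)"
    have "supp p0 = {s0}" by (auto simp: supp_def p0_def)
    then have "p0 \<in> K" by (simp add: K_def is_dist_def p0_def) (simp add: s0_def card_gt_0_iff)
    then show ?thesis by blast
  qed
  ultimately obtain p where p: "p \<in> K" and max: "\<forall>p'\<in>K. gobj lam (qY q) (qZ q) ?N ?N ?N (slice p') \<le> gobj lam (qY q) (qZ q) ?N ?N ?N (slice p)"
    using continuous_attains_sup[OF _ _ continuous_on_subset[OF continuous_on_gobj_slice subset_UNIV]] by blast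
  have obj: "objective lam q p' = gobj lam (qY q) (qZ q) ?N ?N ?N (slice p')" if "p' \<in> K" for p'
    by (rule objective_eq_gobj[OF q]) (use that in \<open>auto simp: K_def\<close>)
  have "objective lam q p' \<le> objective lam q p" if p': "is_dist p'" for p' :: "'x law"
  proof -
    obtain p1 :: "'x law" where p1: "is_dist p1" "objective lam q p' \<le> objective lam q p1"
      "supp p1 \<subseteq> {..<min (CARD('x)) (CARD('y))} \<times>
       {..<min (CARD('x)) (CARD('z))} \<times> {..<CARD('x)} \<times> UNIV"
      using normal_form[OF q a b lam p'] by blast
    have "supp p1 \<subseteq> ?box" using p1(3) by (rule subset_trans) auto
    then have "p1 \<in> K" using p1(1) by (simp add: K_def)
    then show ?thesis using p1(2) max obj p by fastforce
  qed
  then show ?thesis using p by (auto simp: K_def)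
qed

section \<open>Optimality of a single block\<close>

lemma blk_cong:
  assumes "\<And>u v x. u \<in> A \<Longrightarrow> v \<in> B \<Longrightarrow> P u v x = P' u v x"
  shows "blk lam a b A B P = blk lam a b A B P'"
  unfolding blk_def side_def outp_def marg_def flip_def using assms by (simp cong: sum.cong)

lemma inp_cong:
  assumes "\<And>u v x. u \<in> A \<Longrightarrow> v \<in> B \<Longrightarrow> P u v x = P' u v x"
  shows "inp A B P x = inp A B P' x"
  unfolding inp_def using assms by (simp cong: sum.cong)

text \<open>The supporting-line property of the upper concave envelope: replacing \<open>p(u, v, x | w)\<close> by a family of
  (unnormalised) laws with the same total law of \<open>X\<close> does not help.\<close>

definition blk_optimal :: "real \<Rightarrow> ('x::finite \<Rightarrow> 'y::finite \<Rightarrow> real) \<Rightarrow> ('x \<Rightarrow> 'z::finite \<Rightarrow> real) \<Rightarrow>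
    'u set \<Rightarrow> 'v set \<Rightarrow> ('u \<Rightarrow> 'v \<Rightarrow> 'x \<Rightarrow> real) \<Rightarrow> bool" where
  "blk_optimal lam a b A B P \<longleftrightarrow> (\<forall>(D :: nat set) R. finite D \<longrightarrow>
     (\<forall>d\<in>D. \<forall>u\<in>A. \<forall>v\<in>B. \<forall>x. 0 \<le> R d u v x) \<longrightarrow>
     (\<forall>x. (\<Sum>d\<in>D. inp A B (R d) x) = inp A B P x) \<longrightarrow> (\<Sum>d\<in>D. blk lam a b A B (R d)) \<le> blk lam a b A B P)"

lemma blk_optimalD:
  fixes D :: "nat set"
  assumes "blk_optimal lam a b A B P" "finite D" "\<And>d u v x. d \<in> D \<Longrightarrow> u \<in> A \<Longrightarrow> v \<in> B \<Longrightarrow> 0 \<le> R d u v x"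
    "\<And>x. (\<Sum>d\<in>D. inp A B (R d) x) = inp A B P x"
  shows "(\<Sum>d\<in>D. blk lam a b A B (R d)) \<le> blk lam a b A B P"
  using assms unfolding blk_optimal_def by blast

text \<open>A better family, inserted in place of block \<open>w\<close> under fresh values of W,
  would beat the maximiser: other blocks are untouched and the law of X, hence both output
  entropies, is the same.\<close>

lemma blk_optimal_slice:
  fixes p :: "('x::finite) law"
  assumes q: "is_bc q" and p: "is_dist p" and fin: "finite A" "finite B" "finite C"
    and sub: "supp p \<subseteq> A \<times> B \<times> C \<times> UNIV" and w: "w \<in> C"
    and max: "\<forall>p'. is_dist p' \<longrightarrow> objective lam q p' \<le> objective lam q p"
  shows "blk_optimal lam (qY q) (qZ q) A B (slice p w)"
  unfolding blk_optimal_def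
proof (intro allI impI)
  fix D :: "nat set" and R
  assume D: "finite D" and R: "\<forall>d\<in>D. \<forall>u\<in>A. \<forall>v\<in>B. \<forall>x. 0 \<le> R d u v x"
    and eq: "\<forall>x. (\<Sum>d\<in>D. inp A B (R d) x) = inp A B (slice p w) x"
  \<comment> \<open>Values below \<open>M\<close> are old and values from \<open>M\<close> on are
    new, so the comparison \<open>l < M\<close> tells the two kinds apart.\<close>
  obtain M where M: "\<forall>l\<in>C. l < M" using fin(3) finite_nat_set_iff_bounded by blast
  define e where "e = (\<lambda>d :: nat. M + d)"
  define C' where "C' = (C - {w}) \<union> e ` D"
  define p' where "p' = (\<lambda>(u, v, l, x). if u \<in> A \<and> v \<in> B \<and> l \<in> C' then
      (if l < M then p (u, v, l, x) else R (l - M) u v x) else 0)"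
  have p0: "0 \<le> p s" for s using p unfolding is_dist_def by blast
  have sumC': "(\<Sum>l\<in>C'. f l) = (\<Sum>l\<in>C - {w}. f l) + (\<Sum>d\<in>D. f (e d))" for f :: "nat \<Rightarrow> real"
  proof -
    have "(\<Sum>l\<in>C'. f l) = (\<Sum>l\<in>C - {w}. f l) + (\<Sum>l\<in>e ` D. f l)"
      unfolding C'_def using D fin M by (intro sum.union_disjoint) (auto simp: e_def)
    also have "(\<Sum>l\<in>e ` D. f l) = (\<Sum>d\<in>D. f (e d))"
      by (subst sum.reindex) (auto simp: e_def inj_on_def)
    finally show ?thesis .
  qed
  have v1: "slice p' l u v x = slice p l u v x" if "l \<in> C - {w}" "u \<in> A" "v \<in> B" for l u v x
    using that M by (auto simp: slice_def p'_def C'_def)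
  have v2: "slice p' (e d) u v x = R d u v x" if "d \<in> D" "u \<in> A" "v \<in> B" for d u v x
    using that M by (auto simp: slice_def p'_def C'_def e_def)
  have blk': "(\<Sum>l\<in>C'. blk lam (qY q) (qZ q) A B (slice p' l))
      = (\<Sum>l\<in>C - {w}. blk lam (qY q) (qZ q) A B (slice p l)) + (\<Sum>d\<in>D. blk lam (qY q) (qZ q) A B (R d))"
    unfolding sumC' by (intro arg_cong2[where f = "(+)"] sum.cong refl blk_cong v1 v2)
  have inp': "(\<Sum>l\<in>C'. inp A B (slice p' l) x) = (\<Sum>l\<in>C. inp A B (slice p l) x)" for x
  proof -
    have "(\<Sum>l\<in>C'. inp A B (slice p' l) x) = (\<Sum>l\<in>C - {w}. inp A B (slice p l) x) + (\<Sum>d\<in>D. inp A B (R d) x)"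
      unfolding sumC' by (intro arg_cong2[where f = "(+)"] sum.cong refl inp_cong v1 v2)
    also have "\<dots> = (\<Sum>l\<in>C. inp A B (slice p l) x)"
      using eq sum.remove[OF fin(3) w, of "\<lambda>l. inp A B (slice p l) x"] by simp
    finally show ?thesis .
  qed
  have fin': "finite C'" using fin D by (simp add: C'_def)
  have sub': "supp p' \<subseteq> A \<times> B \<times> C' \<times> UNIV"
    by (auto simp: supp_def p'_def split: if_splits)
  have dist': "is_dist p'"
  proof -
    have "sum p' (supp p') = 1"
      using sum_supp_inp[OF fin(1,2) fin' sub'] sum_supp_inp[OF fin sub] inp' p by (simp add: is_dist_def)
    moreover have "finite (supp p')" using sub' fin fin' by (auto intro: finite_subset)
    moreover have "0 \<le> p' s" for s
      using p0 R M by (cases s) (auto simp: p'_def C'_def e_def)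
    ultimately show ?thesis unfolding is_dist_def by blast
  qed
  have "objective lam q p' \<le> objective lam q p" using max dist' by blast
  then have "gobj lam (qY q) (qZ q) A B C' (slice p') \<le> gobj lam (qY q) (qZ q) A B C (slice p)"
    using objective_eq_gobj[OF q dist' fin(1,2) fin' sub'] objective_eq_gobj[OF q p fin sub] by simp
  moreover have "tot (qY q) A B C' (slice p') = tot (qY q) A B C (slice p)"
    "tot (qZ q) A B C' (slice p') = tot (qZ q) A B C (slice p)"
    by (rule tot_cong_inp, rule inp')+
  ultimately show "(\<Sum>d\<in>D. blk lam (qY q) (qZ q) A B (R d)) \<le> blk lam (qY q) (qZ q) A B (slice p w)"
    using sum.remove[OF fin(3) w, of "\<lambda>l. blk lam (qY q) (qZ q) A B (slice p l)"] blk' by (simp add: gobj_def)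
qed

lemma blk_optimal_scale:
  assumes opt: "blk_optimal lam a b A B P" and a: "pos_channel a" and b: "pos_channel b" and c: "0 < c"
    and P: "\<And>u v x. u \<in> A \<Longrightarrow> v \<in> B \<Longrightarrow> 0 \<le> P u v x"
  shows "blk_optimal lam a b A B (\<lambda>u v x. c * P u v x)"
  unfolding blk_optimal_def
proof (intro allI impI)
  fix D :: "nat set" and R
  assume D: "finite D" and R: "\<forall>d\<in>D. \<forall>u\<in>A. \<forall>v\<in>B. \<forall>x. 0 \<le> R d u v x"
    and eq: "\<forall>x. (\<Sum>d\<in>D. inp A B (R d) x) = inp A B (\<lambda>u v x. c * P u v x) x"
  have sc: "inp A B (\<lambda>u v x. k * S u v x) x = k * inp A B S x" for k S x
    by (simp add: inp_def sum_distrib_left)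
  have "(\<Sum>d\<in>D. blk lam a b A B (\<lambda>u v x. (1 / c) * R d u v x)) \<le> blk lam a b A B P"
  proof (rule blk_optimalD[OF opt D])
    show "0 \<le> (1 / c) * R d u v x" if "d \<in> D" "u \<in> A" "v \<in> B" for d u v x using R c that by simp
    show "(\<Sum>d\<in>D. inp A B (\<lambda>u v x. (1 / c) * R d u v x) x) = inp A B P x" for x
      using eq c unfolding sc sum_distrib_left[symmetric] by simp
  qed
  moreover have "(\<Sum>d\<in>D. blk lam a b A B (\<lambda>u v x. (1 / c) * R d u v x)) = (\<Sum>d\<in>D. (1 / c) * blk lam a b A B (R d))"
    using R c by (intro sum.cong refl blk_scale[OF a b]) auto
  ultimately have "(1 / c) * (\<Sum>d\<in>D. blk lam a b A B (R d)) \<le> blk lam a b A B P"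
    by (simp only: sum_distrib_left)
  then show "(\<Sum>d\<in>D. blk lam a b A B (R d)) \<le> blk lam a b A B (\<lambda>u v x. c * P u v x)"
    using c P by (subst blk_scale[OF a b]) (auto simp: field_simps)
qed

lemma side_restrict:
  assumes fin: "finite A" "finite B" and sub: "A' \<subseteq> A" "B' \<subseteq> B"
    and P: "\<And>u v x. u \<in> A \<Longrightarrow> v \<in> B \<Longrightarrow> \<not> (u \<in> A' \<and> v \<in> B') \<Longrightarrow> P u v x = 0"
  shows "side l a A B P = side l a A' B' P"
proof -
  have m: "marg a B P u y = marg a B' P u y" if "u \<in> A" for u y
    unfolding marg_def by (rule sum.mono_neutral_right) (use fin sub P that in auto)
  have m0: "marg a B' P u y = 0" if "u \<in> A - A'" for u y
    unfolding marg_def using sub P that by (auto intro!: sum.neutral)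
  have o: "outp a A B P y = outp a A' B' P y" for y
    unfolding outp_def using m m0 fin sub by (subst sum.mono_neutral_right[of A A']) (auto intro!: sum.cong)
  have "(\<Sum>u\<in>A. xlnx (marg a B P u y)) = (\<Sum>u\<in>A'. xlnx (marg a B' P u y))" for y
    using m m0 fin sub by (subst sum.mono_neutral_right[of A A']) (auto intro!: sum.cong)
  then show ?thesis by (simp add: side_def o)
qed

lemma blk_restrict:
  assumes fin: "finite A" "finite B" and sub: "A' \<subseteq> A" "B' \<subseteq> B"
    and P: "\<And>u v x. u \<in> A \<Longrightarrow> v \<in> B \<Longrightarrow> \<not> (u \<in> A' \<and> v \<in> B') \<Longrightarrow> P u v x = 0"
  shows "blk lam a b A B P = blk lam a b A' B' P"
proof -
  have "(\<Sum>v\<in>B. xlnx (\<Sum>x\<in>UNIV. P u v x)) = (\<Sum>v\<in>B'. xlnx (\<Sum>x\<in>UNIV. P u v x))" if "u \<in> A" for u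
    by (rule sum.mono_neutral_right) (use fin sub P that in auto)
  then have "(\<Sum>u\<in>A. \<Sum>v\<in>B. xlnx (\<Sum>x\<in>UNIV. P u v x)) = (\<Sum>u\<in>A. \<Sum>v\<in>B'. xlnx (\<Sum>x\<in>UNIV. P u v x))"
    by simp
  also have "\<dots> = (\<Sum>u\<in>A'. \<Sum>v\<in>B'. xlnx (\<Sum>x\<in>UNIV. P u v x))"
    by (rule sum.mono_neutral_right) (use fin sub P in \<open>auto intro!: sum.neutral\<close>)
  moreover have "side lam b B A (flip P) = side lam b B' A' (flip P)"
    by (rule side_restrict) (use fin sub P in \<open>auto simp: flip_def\<close>)
  ultimately show ?thesis
    unfolding blk_def using side_restrict[OF fin sub P] by simp
qed

lemma inp_restrict:
  assumes fin: "finite A" "finite B" and sub: "A' \<subseteq> A" "B' \<subseteq> B"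
    and P: "\<And>u v x. u \<in> A \<Longrightarrow> v \<in> B \<Longrightarrow> \<not> (u \<in> A' \<and> v \<in> B') \<Longrightarrow> P u v x = 0"
  shows "inp A B P x = inp A' B' P x"
proof -
  have "(\<Sum>v\<in>B. P u v x) = (\<Sum>v\<in>B'. P u v x)" if "u \<in> A" for u
    by (rule sum.mono_neutral_right) (use fin sub P that in auto)
  then have "inp A B P x = (\<Sum>u\<in>A. \<Sum>v\<in>B'. P u v x)" by (simp add: inp_def)
  also have "\<dots> = inp A' B' P x" unfolding inp_def
    by (rule sum.mono_neutral_right) (use fin sub P in \<open>auto intro!: sum.neutral\<close>)
  finally show ?thesis .
qed

text \<open>Leads from a common box to the active symbols of a block, where every row and column
  carries mass and the logarithms of the output marginals are taken at positive numbers.\<close>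

lemma blk_optimal_restrict:
  assumes opt: "blk_optimal lam a b A B P" and fin: "finite A" "finite B" and sub: "A' \<subseteq> A" "B' \<subseteq> B"
    and P: "\<And>u v x. u \<in> A \<Longrightarrow> v \<in> B \<Longrightarrow> \<not> (u \<in> A' \<and> v \<in> B') \<Longrightarrow> P u v x = 0"
  shows "blk_optimal lam a b A' B' P"
  unfolding blk_optimal_def
proof (intro allI impI)
  fix D :: "nat set" and R
  assume D: "finite D" and R: "\<forall>d\<in>D. \<forall>u\<in>A'. \<forall>v\<in>B'. \<forall>x. 0 \<le> R d u v x"
    and eq: "\<forall>x. (\<Sum>d\<in>D. inp A' B' (R d) x) = inp A' B' P x"
  \<comment> \<open>Competitors on the smaller box are extended by zero.\<close>
  define S where "S = (\<lambda>d u v x. if u \<in> A' \<and> v \<in> B' then R d u v x else 0)"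
  have b: "blk lam a b A B (S d) = blk lam a b A' B' (R d)" for d
  proof -
    have "blk lam a b A B (S d) = blk lam a b A' B' (S d)"
      by (rule blk_restrict[OF fin sub]) (auto simp: S_def)
    also have "\<dots> = blk lam a b A' B' (R d)" by (rule blk_cong) (simp add: S_def)
    finally show ?thesis .
  qed
  have i: "inp A B (S d) x = inp A' B' (R d) x" for d x
  proof -
    have "inp A B (S d) x = inp A' B' (S d) x"
      by (rule inp_restrict[OF fin sub]) (auto simp: S_def)
    also have "\<dots> = inp A' B' (R d) x" by (rule inp_cong) (simp add: S_def)
    finally show ?thesis .
  qed
  have "(\<Sum>d\<in>D. blk lam a b A B (S d)) \<le> blk lam a b A B P"
  proof (rule blk_optimalD[OF opt D])
    show "0 \<le> S d u v x" if "d \<in> D" for d u v x using R that by (simp add: S_def)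
    show "(\<Sum>d\<in>D. inp A B (S d) x) = inp A B P x" for x
      using eq inp_restrict[where P = P, OF fin sub P] by (simp add: i)
  qed
  then show "(\<Sum>d\<in>D. blk lam a b A' B' (R d)) \<le> blk lam a b A' B' P"
    using blk_restrict[where P = P and lam = lam and a = a and b = b, OF fin sub P] by (simp add: b)
qed

section \<open>First-order conditions and strict convexity in a block\<close>

lemma marg_pos:
  assumes "finite B" "pos_channel a" "\<And>v x. v \<in> B \<Longrightarrow> 0 \<le> P u v x" "v0 \<in> B" "0 < P u v0 x0"
  shows "0 < marg a B P u y"
proof -
  have "0 < P u v0 x0 * a x0 y" using assms by (simp add: pos_channelD)
  also have "\<dots> \<le> (\<Sum>x\<in>UNIV. P u v0 x * a x y)"
    by (rule member_le_sum) (use assms in \<open>auto simp: pos_channelD\<close>)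
  also have "\<dots> \<le> marg a B P u y"
    unfolding marg_def using assms
    by (intro member_le_sum[of v0 B "\<lambda>v. \<Sum>x\<in>UNIV. P u v x * a x y"]) (auto intro!: sum_nonneg simp: pos_channelD)
  finally show ?thesis .
qed

lemma sum_diff_delta:
  fixes f :: "'i \<Rightarrow> real"
  assumes "finite I" "i \<in> I" "j \<in> I"
  shows "(\<Sum>k\<in>I. ((if k = i then 1 else 0) - (if k = j then 1 else 0)) * f k) = f i - f j"
proof -
  have "(\<Sum>k\<in>I. ((if k = i then 1 else 0) - (if k = j then 1 else 0)) * f k)
      = (\<Sum>k\<in>I. (if k = i then f k else 0) - (if k = j then f k else 0))"
    by (rule sum.cong) auto
  then show ?thesis using assms by (simp add: sum_subtractf)
qed

definition transfer_at :: "real \<Rightarrow> 'u \<Rightarrow> 'v \<Rightarrow> 'u \<Rightarrow> 'v \<Rightarrow> 'x \<Rightarrow> ('u \<Rightarrow> 'v \<Rightarrow> 'x \<Rightarrow> real) \<Rightarrow> 'u \<Rightarrow> 'v \<Rightarrow> 'x \<Rightarrow> real" where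
  "transfer_at e u0 v0 u1 v1 x0 P = (\<lambda>u v x. P u v x
     + e * (if x = x0 then (if u = u1 \<and> v = v1 then 1 else 0) - (if u = u0 \<and> v = v0 then 1 else 0) else 0))"

lemma flip_transfer_at: "flip (transfer_at e u0 v0 u1 v1 x0 P) = transfer_at e v0 u0 v1 u1 x0 (flip P)"
  by (auto simp: flip_def transfer_at_def fun_eq_iff)

lemma marg_transfer_at:
  assumes "finite B" "v0 \<in> B" "v1 \<in> B"
  shows "marg a B (transfer_at e u0 v0 u1 v1 x0 P) u y
    = marg a B P u y + ((if u = u1 then 1 else 0) - (if u = u0 then 1 else 0)) * (e * a x0 y)"
proof -
  have "(\<Sum>v\<in>B. transfer_at e u0 v0 u1 v1 x0 P u v x)
      = (\<Sum>v\<in>B. P u v x) + (if x = x0 then e * ((if u = u1 then 1 else 0) - (if u = u0 then 1 else 0)) else 0)" for x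
    using assms by (cases "u = u1"; cases "u = u0"; cases "x = x0")
      (auto simp: transfer_at_def sum.distrib sum_distrib_left[symmetric] sum_subtractf sum_negf)
  then have "marg a B (transfer_at e u0 v0 u1 v1 x0 P) u y = (\<Sum>x\<in>UNIV. (\<Sum>v\<in>B. P u v x) * a x y
      + (if x = x0 then e * ((if u = u1 then 1 else 0) - (if u = u0 then 1 else 0)) * a x y else 0))"
    unfolding marg_eq_inp by (intro sum.cong refl) (auto simp: distrib_right)
  then show ?thesis by (simp add: sum.distrib marg_eq_inp mult_ac)
qed

text \<open>For a normalised block this is f_{u,w}(x) of condition (4), and on the flipped block
  g_{v,w}(x). Up to the constant 1 it is the derivative of the (u,y) sum with respect to the mass at
  (u, v, x).\<close>

definition cross :: "('x::finite \<Rightarrow> 'y::finite \<Rightarrow> real) \<Rightarrow> 'v set \<Rightarrow> ('u \<Rightarrow> 'v \<Rightarrow> 'x \<Rightarrow> real) \<Rightarrow> 'u \<Rightarrow> 'x \<Rightarrow> real" where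
  "cross a B P u x = (\<Sum>y\<in>UNIV. a x y * ln (marg a B P u y))"

text \<open>The input symbol is kept, so the output law does not move; the (u,y) sum is bounded
  below by its tangent at \<open>P\<close>. The +1 in the derivative of t ln t cancels between
  \<open>u1\<close> and \<open>u0\<close>.\<close>

lemma side_transfer_at:
  assumes fin: "finite A" "finite B" and a: "pos_channel a"
    and in0: "u0 \<in> A" "v0 \<in> B" and in1: "u1 \<in> A" "v1 \<in> B"
    and pos: "\<And>u y. u \<in> A \<Longrightarrow> 0 < marg a B P u y"
    and R: "\<And>u v x. u \<in> A \<Longrightarrow> v \<in> B \<Longrightarrow> 0 \<le> transfer_at e u0 v0 u1 v1 x0 P u v x"
  shows "side l a A B P + e * (cross a B P u1 x0 - cross a B P u0 x0)
    \<le> side l a A B (transfer_at e u0 v0 u1 v1 x0 P)"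
proof -
  let ?R = "transfer_at e u0 v0 u1 v1 x0 P"
  let ?i = "\<lambda>u. (if u = u1 then 1 else 0) - (if u = u0 then 1 else 0) :: real"
  note mR = marg_transfer_at[OF fin(2) in0(2) in1(2), of a e u0 u1 x0 P]
  have o: "outp a A B ?R y = outp a A B P y" for y
    unfolding outp_def mR sum.distrib sum_diff_delta[OF fin(1) in1(1) in0(1)] by simp
  have "xlnx (marg a B P u y) + ?i u * (e * a x0 y * (ln (marg a B P u y) + 1)) \<le> xlnx (marg a B ?R u y)" if "u \<in> A" for u y
  proof -
    have "0 \<le> marg a B ?R u y" by (rule marg_nonneg[OF a]) (use R that in auto)
    then have "xlnx (marg a B P u y) + (marg a B ?R u y - marg a B P u y) * (ln (marg a B P u y) + 1) \<le> xlnx (marg a B ?R u y)"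
      using pos[OF that] by (intro xlnx_tangent)
    moreover have "marg a B ?R u y - marg a B P u y = ?i u * (e * a x0 y)" unfolding mR by simp
    ultimately show ?thesis by (simp only: mult.assoc)
  qed
  then have "(\<Sum>u\<in>A. xlnx (marg a B P u y) + ?i u * (e * a x0 y * (ln (marg a B P u y) + 1))) \<le> (\<Sum>u\<in>A. xlnx (marg a B ?R u y))" for y
    by (intro sum_mono)
  then have "(\<Sum>u\<in>A. xlnx (marg a B P u y)) + e * (a x0 y * ln (marg a B P u1 y) - a x0 y * ln (marg a B P u0 y))
      \<le> (\<Sum>u\<in>A. xlnx (marg a B ?R u y))" for y
    unfolding sum.distrib sum_diff_delta[OF fin(1) in1(1) in0(1)] by (simp add: algebra_simps)
  then have "(\<Sum>y\<in>UNIV. (\<Sum>u\<in>A. xlnx (marg a B P u y)) + e * (a x0 y * ln (marg a B P u1 y) - a x0 y * ln (marg a B P u0 y)))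
      \<le> (\<Sum>y\<in>UNIV. \<Sum>u\<in>A. xlnx (marg a B ?R u y))"
    by (rule sum_mono)
  then show ?thesis
    unfolding side_def o cross_def by (simp add: sum.distrib sum_subtractf sum_distrib_left[symmetric])
qed

text \<open>Optimality forbids a gain from moving mass e between two cells at the same input. One
  limit e -> 0 gives both claims: the target cell cannot be empty, and the source cell minimises the
  expression defining h_w(x).\<close>

lemma exchange:
  assumes opt: "blk_optimal lam a b A B P"
    and fin: "finite A" "finite B" and a: "pos_channel a" and b: "pos_channel b"
    and P: "\<And>u v x. u \<in> A \<Longrightarrow> v \<in> B \<Longrightarrow> 0 \<le> P u v x"
    and posU: "\<And>u. u \<in> A \<Longrightarrow> \<exists>v\<in>B. \<exists>x. 0 < P u v x" and posV: "\<And>v. v \<in> B \<Longrightarrow> \<exists>u\<in>A. \<exists>x. 0 < P u v x"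
    and in0: "u0 \<in> A" "v0 \<in> B" and in1: "u1 \<in> A" "v1 \<in> B" and x0: "0 < P u0 v0 x0"
  shows "0 < (\<Sum>x\<in>UNIV. P u1 v1 x)"
    and "ln (\<Sum>x\<in>UNIV. P u0 v0 x) - cross a B P u0 x0 - cross b A (flip P) v0 x0
      \<le> ln (\<Sum>x\<in>UNIV. P u1 v1 x) - cross a B P u1 x0 - cross b A (flip P) v1 x0"
proof -
  define m where "m = (\<lambda>u v. \<Sum>x\<in>UNIV. P u v x)"
  define K where "K = (cross a B P u0 x0 + cross b A (flip P) v0 x0)
     - (cross a B P u1 x0 + cross b A (flip P) v1 x0)"
  have m_ge: "P u v x \<le> m u v" if "u \<in> A" "v \<in> B" for u v x
    unfolding m_def by (rule member_le_sum) (use P that in auto)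
  have m0: "0 \<le> m u v" if "u \<in> A" "v \<in> B" for u v unfolding m_def using P that by (auto intro: sum_nonneg)
  have mpos: "0 < m u0 v0" using m_ge[OF in0, of x0] x0 by simp
  have posa: "0 < marg a B P u y" if "u \<in> A" for u y
    using posU[OF that] marg_pos[OF fin(2) a] P that by metis
  have posb: "0 < marg b A (flip P) v z" if "v \<in> B" for v z
    using posV[OF that] marg_pos[OF fin(1) b, of "flip P" v] P that unfolding flip_def by metis
  have "0 < m u1 v1 \<and> ln (m u0 v0) - ln (m u1 v1) \<le> K"
  proof (cases "u0 = u1 \<and> v0 = v1")
    case True
    then show ?thesis using mpos by (simp add: K_def)
  next
    case False
    \<comment> \<open>The first-order inequality in exponentiated form, which remains meaningful for
      \<open>m u1 v1 = 0\<close> when e tends to 0.\<close>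
    have step: "m u0 v0 - e \<le> exp K * (m u1 v1 + e)" if e: "0 < e" "e < P u0 v0 x0" for e
    proof -
      let ?R = "transfer_at e u0 v0 u1 v1 x0 P"
      let ?i = "\<lambda>u v. (if u = u1 \<and> v = v1 then 1 else 0) - (if u = u0 \<and> v = v0 then 1 else 0) :: real"
      have R: "0 \<le> ?R u v x" if "u \<in> A" "v \<in> B" for u v x
        using P[OF that] e x0 False by (auto simp: transfer_at_def add_nonneg_nonneg)
      have R': "0 \<le> transfer_at e v0 u0 v1 u1 x0 (flip P) v u x" if "v \<in> B" "u \<in> A" for u v x
        using R[OF that(2,1), of x] unfolding flip_transfer_at[symmetric] by (simp add: flip_def)
      have inpR: "inp A B ?R x = inp A B P x" for x
      proof -
        have one: "(\<Sum>u\<in>A. \<Sum>v\<in>B. if u = i \<and> v = j then 1 else 0 :: real) = 1" if "i \<in> A" "j \<in> B" for i j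
        proof -
          have "(\<Sum>v\<in>B. if u = i \<and> v = j then 1 else 0 :: real) = (if u = i then 1 else 0)" for u
            using that fin by (cases "u = i") auto
          then show ?thesis using that fin by simp
        qed
        show ?thesis using one[OF in0] one[OF in1]
          by (cases "x = x0") (simp_all add: inp_def transfer_at_def sum.distrib sum_distrib_left[symmetric] sum_subtractf)
      qed
      have opt': "blk lam a b A B ?R \<le> blk lam a b A B P"
        using blk_optimalD[OF opt, of "{0}" "\<lambda>_. ?R"] R inpR by simp
      have mR: "(\<Sum>x\<in>UNIV. ?R u v x) = m u v + ?i u v * e" for u v
        unfolding m_def transfer_at_def sum.distrib sum_distrib_left[symmetric] by simp
      have i0: "?i u0 v0 = - 1" "?i u1 v1 = 1" using False by auto
      \<comment> \<open>The (u,v) sum is subtracted, so it needs an upper bound: the tangent is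
        taken at the perturbed value, which is positive in both affected cells even if
        \<open>m u1 v1 = 0\<close>.\<close>
      have uv: "xlnx (m u v + ?i u v * e) \<le> xlnx (m u v) + ?i u v * (e * (ln (m u v + ?i u v * e) + 1))"
        if "u \<in> A" "v \<in> B" for u v
      proof (cases "?i u v = 0")
        case True
        then show ?thesis by simp
      next
        case nz: False
        have "0 < m u v + ?i u v * e"
        proof (cases "u = u1 \<and> v = v1")
          case True
          then show ?thesis using i0(2) m0[OF that] e by simp
        next
          case False
          then have "u = u0" "v = v0" using nz by (auto split: if_splits)
          then show ?thesis using i0(1) m_ge[OF in0, of x0] e by simp
        qed
        from xlnx_tangent[OF this m0[OF that]] show ?thesis by (simp add: algebra_simps)
      qed
      let ?f = "\<lambda>u v. e * (ln (m u v + ?i u v * e) + 1)"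
      have "(\<Sum>u\<in>A. \<Sum>v\<in>B. xlnx (m u v + ?i u v * e)) \<le> (\<Sum>u\<in>A. \<Sum>v\<in>B. xlnx (m u v) + ?i u v * ?f u v)"
        by (intro sum_mono uv)
      also have "\<dots> = (\<Sum>u\<in>A. \<Sum>v\<in>B. xlnx (m u v)) + (\<Sum>u\<in>A. \<Sum>v\<in>B. ?i u v * ?f u v)"
        by (simp only: sum.distrib)
      also have "(\<Sum>u\<in>A. \<Sum>v\<in>B. ?i u v * ?f u v) = ?f u1 v1 - ?f u0 v0"
      proof -
        have "(\<Sum>u\<in>A. \<Sum>v\<in>B. ?i u v * ?f u v) = (\<Sum>s\<in>A \<times> B. ((if s = (u1, v1) then 1 else 0) - (if s = (u0, v0) then 1 else 0)) * (\<lambda>(u, v). ?f u v) s)"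
          unfolding sum.cartesian_product by (rule sum.cong) (simp_all add: split_def prod_eq_iff)
        also have "\<dots> = ?f u1 v1 - ?f u0 v0"
          by (subst sum_diff_delta) (use fin in0 in1 in auto)
        finally show ?thesis .
      qed
      finally have uvR: "(\<Sum>u\<in>A. \<Sum>v\<in>B. xlnx (\<Sum>x\<in>UNIV. ?R u v x))
          \<le> (\<Sum>u\<in>A. \<Sum>v\<in>B. xlnx (m u v)) + e * (ln (m u1 v1 + e) - ln (m u0 v0 - e))"
        unfolding mR i0 by (simp add: algebra_simps)
      have s1: "side (1 - lam) a A B P + e * (cross a B P u1 x0 - cross a B P u0 x0)
          \<le> side (1 - lam) a A B ?R"
        by (rule side_transfer_at[OF fin a in0 in1 posa R])
      have s2: "side lam b B A (flip P) + e * (cross b A (flip P) v1 x0 - cross b A (flip P) v0 x0)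
          \<le> side lam b B A (flip ?R)"
        unfolding flip_transfer_at
        by (rule side_transfer_at[OF fin(2,1) b in0(2,1) in1(2,1) posb R'])
      have mP: "(\<Sum>u\<in>A. \<Sum>v\<in>B. xlnx (m u v)) = (\<Sum>u\<in>A. \<Sum>v\<in>B. xlnx (\<Sum>x\<in>UNIV. P u v x))"
        by (simp add: m_def)
      have "e * (ln (m u0 v0 - e) - ln (m u1 v1 + e)) \<le> e * K"
        using opt' s1 s2 uvR mP unfolding blk_def K_def by (simp add: algebra_simps)
      then have l: "ln (m u0 v0 - e) \<le> K + ln (m u1 v1 + e)" using e by simp
      have p0: "0 < m u0 v0 - e" using m_ge[OF in0, of x0] e by simp
      have p1: "0 < m u1 v1 + e" using m0[OF in1] e by simp
      have "m u0 v0 - e = exp (ln (m u0 v0 - e))" using p0 by simp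
      also have "\<dots> \<le> exp (K + ln (m u1 v1 + e))" using l by simp
      also have "\<dots> = exp K * (m u1 v1 + e)" using p1 by (simp add: exp_add)
      finally show ?thesis .
    qed
    have lim: "m u0 v0 \<le> exp K * m u1 v1"
    proof (rule ccontr)
      assume "\<not> ?thesis"
      then have g: "0 < m u0 v0 - exp K * m u1 v1" by simp
      \<comment> \<open>Half of the available mass keeps the step admissible; the second term makes
        (1 + exp K) e at most half of the gap, while \<open>step\<close> would need it to cover the
        whole gap.\<close>
      define e where "e = min (P u0 v0 x0 / 2) ((m u0 v0 - exp K * m u1 v1) / (2 * (1 + exp K)))"
      have K1: "0 < 1 + exp K" by (simp add: add_pos_pos)
      have e: "0 < e" "e < P u0 v0 x0" unfolding e_def using x0 g K1 by auto
      have "e \<le> (m u0 v0 - exp K * m u1 v1) / (2 * (1 + exp K))" unfolding e_def by simp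
      then have "2 * ((1 + exp K) * e) \<le> m u0 v0 - exp K * m u1 v1" using K1 by (simp add: field_simps)
      moreover have "0 < (1 + exp K) * e" using K1 e by simp
      moreover have "m u0 v0 - e \<le> exp K * (m u1 v1 + e)" by (rule step[OF e])
      ultimately show False by (simp add: algebra_simps)
    qed
    then have "0 < exp K * m u1 v1" using mpos by simp
    then have p1: "0 < m u1 v1" by (simp add: zero_less_mult_iff)
    have "ln (m u0 v0) \<le> ln (exp K * m u1 v1)" using lim mpos p1 by simp
    then have "ln (m u0 v0) \<le> K + ln (m u1 v1)" using p1 by (simp add: ln_mult)
    with p1 show ?thesis by simp
  qed
  then show "0 < (\<Sum>x\<in>UNIV. P u1 v1 x)"
    and "ln (\<Sum>x\<in>UNIV. P u0 v0 x) - cross a B P u0 x0 - cross b A (flip P) v0 x0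
      \<le> ln (\<Sum>x\<in>UNIV. P u1 v1 x) - cross a B P u1 x0 - cross b A (flip P) v1 x0"
    unfolding m_def K_def by auto
qed

text \<open>Optimality gives X <= (1 - \<open>lam\<close>) Y + \<open>lam\<close> Z for the three
  sums, and Z <= X since conditioning on V as well reduces entropy. Substituting leaves (1 -
  \<open>lam\<close>) X <= (1 - \<open>lam\<close>) Y, which can be divided as \<open>lam\<close> <
  1.\<close>

lemma split_psi_le:
  fixes D :: "nat set"
  assumes opt: "blk_optimal lam a b A B P" and lam: "0 \<le> lam" "lam < 1"
    and fin: "finite A" "finite B" "finite D" and a: "pos_channel a" and b: "pos_channel b"
    and P: "\<And>u v x. u \<in> A \<Longrightarrow> v \<in> B \<Longrightarrow> 0 \<le> P u v x"
    and r: "\<And>u d. u \<in> A \<Longrightarrow> d \<in> D \<Longrightarrow> 0 \<le> r u d" "\<And>u. u \<in> A \<Longrightarrow> (\<Sum>d\<in>D. r u d) = 1"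
  shows "(\<Sum>z\<in>UNIV. \<Sum>v\<in>B. psi D (\<lambda>d. marg b A (flip (\<lambda>u v x. r u d * P u v x)) v z))
    \<le> (\<Sum>y\<in>UNIV. psi D (\<lambda>d. outp a A B (\<lambda>u v x. r u d * P u v x) y))"
proof -
  let ?R = "\<lambda>d u v x. r u d * P u v x"
  let ?X = "\<Sum>z\<in>UNIV. \<Sum>v\<in>B. psi D (\<lambda>d. marg b A (flip (?R d)) v z)"
  let ?Y = "\<Sum>y\<in>UNIV. psi D (\<lambda>d. outp a A B (?R d) y)"
  let ?Z = "\<Sum>z\<in>UNIV. psi D (\<lambda>d. outp b A B (?R d) z)"
  have i: "(\<Sum>d\<in>D. inp A B (?R d) x) = inp A B P x" for x
    unfolding inp_def
    by (subst sum.swap, rule sum.cong[OF refl], subst sum.swap) (simp add: sum_distrib_right[symmetric] r(2))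
  have "(\<Sum>d\<in>D. blk lam a b A B (?R d)) \<le> blk lam a b A B P"
    by (rule blk_optimalD[OF opt fin(3) _ i]) (use P r in auto)
  then have "?X \<le> (1 - lam) * ?Y + lam * ?Z"
    using blk_split[where P = P and r = r and lam = lam, OF fin a b P r] by simp
  moreover have "lam * ?Z \<le> lam * ?X"
    using lam(1) by (intro mult_left_mono psi_outp_le_psi_marg[OF fin b]) (use P r in auto)
  ultimately have "(1 - lam) * ?X \<le> (1 - lam) * ?Y" by (simp add: algebra_simps)
  then show ?thesis using lam by simp
qed

section \<open>Strict convexity when a cell carries two inputs\<close>

definition swap_mass :: "real \<Rightarrow> 'u \<Rightarrow> 'v \<Rightarrow> 'x \<Rightarrow> 'x \<Rightarrow> ('u \<Rightarrow> 'v \<Rightarrow> 'x \<Rightarrow> real) \<Rightarrow> 'u \<Rightarrow> 'v \<Rightarrow> 'x \<Rightarrow> real" where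
  "swap_mass h u0 v0 x0 x1 P = (\<lambda>u v x. P u v x
     + (if u = u0 \<and> v = v0 then ((if x = x1 then 1 else 0) - (if x = x0 then 1 else 0)) * h else 0))"

lemma flip_swap_mass: "flip (swap_mass h u0 v0 x0 x1 P) = swap_mass h v0 u0 x0 x1 (flip P)"
  by (auto simp: flip_def swap_mass_def fun_eq_iff)

lemma sum_swap_mass: "(\<Sum>x\<in>UNIV. swap_mass h u0 v0 x0 x1 P u v (x :: 'x::finite)) = (\<Sum>x\<in>UNIV. P u v x)"
  using sum_diff_delta[of UNIV x1 x0 "\<lambda>_. h"]
  by (cases "u = u0 \<and> v = v0") (auto simp: swap_mass_def sum.distrib)

lemma marg_swap_mass:
  assumes "finite B" "v0 \<in> B"
  shows "marg a B (swap_mass h u0 v0 x0 x1 P) u y = marg a B P u y + (if u = u0 then h * (a x1 y - a x0 y) else 0)"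
proof -
  have "(\<Sum>v\<in>B. swap_mass h u0 v0 x0 x1 P u v x)
      = (\<Sum>v\<in>B. P u v x) + (if u = u0 then ((if x = x1 then 1 else 0) - (if x = x0 then 1 else 0)) * h else 0)" for x
    using assms by (cases "u = u0") (simp_all add: swap_mass_def sum.distrib)
  then have "marg a B (swap_mass h u0 v0 x0 x1 P) u y = (\<Sum>x\<in>UNIV. (\<Sum>v\<in>B. P u v x) * a x y
      + (if u = u0 then ((if x = x1 then 1 else 0) - (if x = x0 then 1 else 0)) * (h * a x y) else 0))"
    unfolding marg_eq_inp by (intro sum.cong refl) (simp add: distrib_right)
  then show ?thesis
    using sum_diff_delta[of UNIV x1 x0 "\<lambda>x. h * a x y"]
    by (cases "u = u0") (simp_all add: sum.distrib marg_eq_inp right_diff_distrib)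
qed

lemma xlnx_gap_nonneg:
  assumes "\<bar>k\<bar> < t"
  shows "0 \<le> xlnx (t + k) + xlnx (t - k) - 2 * xlnx t"
proof -
  have "0 < t" "0 \<le> t + k" "0 \<le> t - k" using assms by linarith+
  then have "xlnx t + k * (ln t + 1) \<le> xlnx (t + k)" "xlnx t - k * (ln t + 1) \<le> xlnx (t - k)"
    using xlnx_tangent[of t "t + k"] xlnx_tangent[of t "t - k"] by simp_all
  then show ?thesis by linarith
qed

text \<open>For each y the second difference is that of t ln t at the row mass t minus
  \<open>l\<close> times that at the output mass t + r. The second row \<open>u'\<close> makes r
  positive, so by \<open>xlnx_gap_strict\<close> the subtracted curvature is strictly smaller even
  for \<open>l\<close> = 1; with one row the two would cancel there.\<close>

lemma side_swap_mass:
  assumes fin: "finite A" "finite B" and a: "pos_channel a" and l: "l \<le> 1"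
    and P: "\<And>u v x. u \<in> A \<Longrightarrow> v \<in> B \<Longrightarrow> 0 \<le> P u v x"
    and in0: "u0 \<in> A" "v0 \<in> B" and h: "0 < h" "h < P u0 v0 x0" "h < P u0 v0 x1" and x: "x0 \<noteq> x1"
    and u': "u' \<in> A" "u' \<noteq> u0" "v' \<in> B" "0 < P u' v' x'"
  shows "2 * side l a A B P \<le> side l a A B (swap_mass h u0 v0 x0 x1 P) + side l a A B (swap_mass (- h) u0 v0 x0 x1 P)"
      (is "?s \<le> ?t")
    and "a x0 y0 \<noteq> a x1 y0 \<Longrightarrow>
      2 * side l a A B P < side l a A B (swap_mass h u0 v0 x0 x1 P) + side l a A B (swap_mass (- h) u0 v0 x0 x1 P)"
proof -
  define t where "t = (\<lambda>y. marg a B P u0 y)"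
  define r where "r = (\<lambda>y. \<Sum>u\<in>A - {u0}. marg a B P u y)"
  define rest where "rest = (\<lambda>y. \<Sum>u\<in>A - {u0}. xlnx (marg a B P u y))"
  define k where "k = (\<lambda>y. h * (a x1 y - a x0 y))"
  have marg0: "marg a B (swap_mass c u0 v0 x0 x1 P) u y = marg a B P u y" if "u \<noteq> u0" for c u y
    using that by (simp add: marg_swap_mass[OF fin(2) in0(2)])
  have o: "outp a A B (swap_mass c u0 v0 x0 x1 P) y = t y + c * (a x1 y - a x0 y) + r y" for c y
    unfolding outp_def using marg0 in0 fin
    by (subst sum.remove[of A u0]) (simp_all add: marg_swap_mass[OF fin(2) in0(2)] t_def r_def)
  have s: "(\<Sum>u\<in>A. xlnx (marg a B (swap_mass c u0 v0 x0 x1 P) u y)) = xlnx (t y + c * (a x1 y - a x0 y)) + rest y" for c y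
    using marg0 in0 fin
    by (subst sum.remove[of A u0]) (simp_all add: marg_swap_mass[OF fin(2) in0(2)] t_def rest_def)
  have side_eq: "side l a A B (swap_mass c u0 v0 x0 x1 P)
      = (\<Sum>y\<in>UNIV. xlnx (t y + c * (a x1 y - a x0 y)) + rest y - l * xlnx (t y + c * (a x1 y - a x0 y) + r y))" for c
    unfolding side_def s o by (simp add: sum_subtractf sum_distrib_left)
  have swap0: "swap_mass 0 u0 v0 x0 x1 P = P" by (auto simp: swap_mass_def fun_eq_iff)
  let ?g = "\<lambda>s y. xlnx (s + k y) + xlnx (s - k y) - 2 * xlnx s"
  have diff: "?t - ?s = (\<Sum>y\<in>UNIV. ?g (t y) y - l * ?g (t y + r y) y)"
    unfolding side_eq side_eq[of 0, unfolded swap0] sum_distrib_left sum.distrib[symmetric] sum_subtractf[symmetric]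
    by (intro sum.cong refl) (simp add: k_def algebra_simps)
  have r: "0 < r y" for y
  proof -
    have "0 < marg a B P u' y" by (rule marg_pos[where ?v0.0 = v' and ?x0.0 = x']) (use fin a P u' in auto)
    also have "\<dots> \<le> r y" unfolding r_def
      by (rule member_le_sum) (use fin u' P in \<open>auto intro: marg_nonneg[OF a]\<close>)
    finally show ?thesis .
  qed
  \<comment> \<open>t + k and t - k are the masses of row \<open>u0\<close> in the two perturbed
    arrays, and positive because each still has mass at \<open>x0\<close>.\<close>
  have kt: "\<bar>k y\<bar> < t y" for y
  proof -
    have pos: "0 < marg a B (swap_mass c u0 v0 x0 x1 P) u0 y" if "\<bar>c\<bar> = h" for c
    proof (rule marg_pos[OF fin(2) a _ in0(2)])
      show "0 \<le> swap_mass c u0 v0 x0 x1 P u0 v x" if "v \<in> B" for v x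
        using P[OF in0(1) that, of x] h x \<open>\<bar>c\<bar> = h\<close> by (auto simp: swap_mass_def)
      show "0 < swap_mass c u0 v0 x0 x1 P u0 v0 x0"
        using h x \<open>\<bar>c\<bar> = h\<close> by (auto simp: swap_mass_def)
    qed
    have "0 < t y + k y" "0 < t y - k y"
      using pos[of h] pos[of "- h"] h by (simp_all add: marg_swap_mass[OF fin(2) in0(2)] t_def k_def)
    then show ?thesis by linarith
  qed
  have g1: "0 \<le> ?g (t y + r y) y" for y
    by (rule xlnx_gap_nonneg) (use kt[of y] r[of y] in linarith)
  have g2: "?g (t y + r y) y < ?g (t y) y" if "k y \<noteq> 0" for y
    using xlnx_gap_strict[OF r[of y], of "k y" "t y"] kt[of y] that by (simp add: abs_less_iff)
  have g3: "?g (t y + r y) y \<le> ?g (t y) y" for y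
    using g2[of y] by (cases "k y = 0") auto
  have g4: "l * ?g (t y + r y) y \<le> ?g (t y + r y) y" for y
    using mult_right_mono[OF l g1[of y]] by simp
  have nn: "0 \<le> ?g (t y) y - l * ?g (t y + r y) y" for y
    using g3[of y] g4[of y] by linarith
  have "0 \<le> (\<Sum>y\<in>UNIV. ?g (t y) y - l * ?g (t y + r y) y)" by (rule sum_nonneg) (rule nn)
  then show "?s \<le> ?t"
    unfolding diff[symmetric] by simp
  assume "a x0 y0 \<noteq> a x1 y0"
  then have "k y0 \<noteq> 0" using h by (simp add: k_def)
  then have "0 < ?g (t y0) y0 - l * ?g (t y0 + r y0) y0"
    using g2[of y0] g4[of y0] by linarith
  then have "0 < (\<Sum>y\<in>UNIV. ?g (t y) y - l * ?g (t y + r y) y)"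
    by (intro sum_pos2[of _ y0]) (use nn in auto)
  then show "?s < ?t"
    unfolding diff[symmetric] by simp
qed

text \<open>The block is the average of two perturbations with opposite signs. If either receiver
  tells the two inputs apart, splitting W along this average gains strictly. A second row serves the
  Y side and a second column the Z side, as it is not known which receiver distinguishes.\<close>

lemma optimal_deterministic:
  assumes opt: "blk_optimal lam a b A B P" and lam: "0 \<le> lam" "lam \<le> 1"
    and fin: "finite A" "finite B" and a: "pos_channel a" and b: "pos_channel b"
    and P: "\<And>u v x. u \<in> A \<Longrightarrow> v \<in> B \<Longrightarrow> 0 \<le> P u v x"
    and posU: "\<And>u. u \<in> A \<Longrightarrow> \<exists>v\<in>B. \<exists>x. 0 < P u v x" and posV: "\<And>v. v \<in> B \<Longrightarrow> \<exists>u\<in>A. \<exists>x. 0 < P u v x"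
    and dist: "(\<exists>y. a x0 y \<noteq> a x1 y) \<or> (\<exists>z. b x0 z \<noteq> b x1 z)"
    and in0: "u0 \<in> A" "v0 \<in> B" and x: "0 < P u0 v0 x0" "0 < P u0 v0 x1" "x0 \<noteq> x1"
    and u': "u' \<in> A" "u' \<noteq> u0" and v': "v' \<in> B" "v' \<noteq> v0"
  shows False
proof -
  \<comment> \<open>Half of the smaller mass keeps both signs of the perturbation
    nonnegative.\<close>
  define h where "h = min (P u0 v0 x0) (P u0 v0 x1) / 2"
  have h: "0 < h" "h < P u0 v0 x0" "h < P u0 v0 x1" using x by (auto simp: h_def)
  let ?R = "\<lambda>c. swap_mass c u0 v0 x0 x1 P"
  have R: "0 \<le> ?R c u v x" if "\<bar>c\<bar> = h" "u \<in> A" "v \<in> B" for c u v x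
    using P[OF that(2,3), of x] h that(1) by (auto simp: swap_mass_def)
  obtain vu xu where u'': "vu \<in> B" "0 < P u' vu xu" using posU[OF u'(1)] by blast
  obtain uv xv where v'': "uv \<in> A" "0 < P uv v' xv" using posV[OF v'(1)] by blast
  note s1 = side_swap_mass[where l = "1 - lam", OF fin a _ P in0 h x(3) u' u'']
  have s2: "2 * side lam b B A (flip P) \<le> side lam b B A (flip (?R h)) + side lam b B A (flip (?R (- h)))"
    and s2': "b x0 z \<noteq> b x1 z \<Longrightarrow> 2 * side lam b B A (flip P) < side lam b B A (flip (?R h)) + side lam b B A (flip (?R (- h)))" for z
    unfolding flip_swap_mass
    by (rule side_swap_mass[where u' = v' and v' = uv and x' = xv, OF fin(2,1) b lam(2)];
        use P in0 h x v' v'' in \<open>simp add: flip_def\<close>)+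
  have "2 * (side (1 - lam) a A B P + side lam b B A (flip P))
      < side (1 - lam) a A B (?R h) + side (1 - lam) a A B (?R (- h)) + side lam b B A (flip (?R h)) + side lam b B A (flip (?R (- h)))"
    using dist s1 s2 s2' lam by fastforce
  then have gt: "2 * blk lam a b A B P < blk lam a b A B (?R h) + blk lam a b A B (?R (- h))"
    unfolding blk_def sum_swap_mass by simp
  define T where "T = (\<lambda>d :: nat. \<lambda>u v x. (1 / 2) * ?R (if d = 0 then h else - h) u v x)"
  have "(\<Sum>d\<in>{0, 1}. blk lam a b A B (T d)) \<le> blk lam a b A B P"
  proof (rule blk_optimalD[OF opt])
    show "0 \<le> T d u v x" if "d \<in> {0, 1}" "u \<in> A" "v \<in> B" for d u v x
      using R[OF _ that(2,3)] h by (simp add: T_def)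
    have "T 0 u v x + T 1 u v x = P u v x" for u v x by (simp add: T_def swap_mass_def algebra_simps)
    then show "(\<Sum>d\<in>{0, 1}. inp A B (T d) x) = inp A B P x" for x
      by (simp add: inp_def sum.distrib[symmetric])
  qed simp
  moreover have "blk lam a b A B (T d) = (1 / 2) * blk lam a b A B (?R (if d = 0 then h else - h))" for d
    unfolding T_def by (rule blk_scale[OF a b]) (use R h in auto)
  ultimately show False using gt by simp
qed

text \<open>The perturbed array \<open>Q\<close> has the same value and the same law of X as
  \<open>P\<close>, so it inherits optimality. Optimality of \<open>Q\<close>, not of
  \<open>P\<close>, is then contradicted by its two inputs at (\<open>u0\<close>,
  \<open>v0\<close>).\<close>

lemma profile_optimal:
  fixes A B :: "nat set" and a :: "'x::finite \<Rightarrow> 'y::finite \<Rightarrow> real" and b :: "'x \<Rightarrow> 'z::finite \<Rightarrow> real"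
  assumes opt: "blk_optimal lam a b A B P" and lam: "0 \<le> lam" "lam \<le> 1"
    and fin: "finite A" "finite B" and a: "pos_channel a" and b: "pos_channel b"
    and P: "\<And>u v x. u \<in> A \<Longrightarrow> v \<in> B \<Longrightarrow> P u v x = (if x = \<xi> u v then m u v else 0)"
    and m: "\<And>u v. u \<in> A \<Longrightarrow> v \<in> B \<Longrightarrow> 0 < m u v"
    and dist: "\<And>x0 x1. x0 \<noteq> x1 \<Longrightarrow> (\<exists>y. a x0 y \<noteq> a x1 y) \<or> (\<exists>z. b x0 z \<noteq> b x1 z)"
  shows "profile_not_convex_comb A B \<xi>"
  unfolding profile_not_convex_comb_def
proof (rule notI, elim exE conjE)
  fix M :: nat and \<alpha> :: "nat \<Rightarrow> real" and \<xi>s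
  assume ne: "\<forall>t<M. \<exists>u\<in>A. \<exists>v\<in>B. \<xi>s t u v \<noteq> \<xi> u v" and \<alpha>: "\<forall>t<M. 0 \<le> \<alpha> t" "(\<Sum>t<M. \<alpha> t) = 1"
    and row: "\<forall>u\<in>A. \<forall>x. real (row_prof B \<xi> u x) = (\<Sum>t<M. \<alpha> t * real (row_prof B (\<xi>s t) u x))"
    and col: "\<forall>v\<in>B. \<forall>x. real (col_prof A \<xi> v x) = (\<Sum>t<M. \<alpha> t * real (col_prof A (\<xi>s t) v x))"
  have "\<exists>t<M. 0 < \<alpha> t"
  proof (rule ccontr)
    assume "\<not> ?thesis"
    then have "(\<Sum>t<M. \<alpha> t) \<le> 0" by (intro sum_nonpos) (meson lessThan_iff not_less)
    then show False using \<alpha>(2) by simp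
  qed
  then obtain t0 where t0: "t0 < M" "0 < \<alpha> t0" by blast
  then obtain u0 v0 where uv0: "u0 \<in> A" "v0 \<in> B" "\<xi>s t0 u0 v0 \<noteq> \<xi> u0 v0" using ne by blast
  \<comment> \<open>The index \<open>t0\<close> has positive weight, so an average of numbers at
    most 1 that vanishes at \<open>t0\<close> stays below 1.\<close>
  have less1: "(\<Sum>t<M. \<alpha> t * c t) < 1" if "\<And>t. c t \<le> 1" "c t0 = 0" for c :: "nat \<Rightarrow> real"
  proof -
    have "(\<Sum>t<M. \<alpha> t * c t) < (\<Sum>t<M. \<alpha> t)"
    proof (rule sum_strict_mono_ex1)
      show "\<forall>t\<in>{..<M}. \<alpha> t * c t \<le> \<alpha> t" using \<alpha>(1) that(1) by (auto intro: mult_left_le)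
      show "\<exists>t\<in>{..<M}. \<alpha> t * c t < \<alpha> t" using t0 that(2) by (intro bexI[of _ t0]) auto
    qed simp
    then show ?thesis using \<alpha>(2) by simp
  qed
  \<comment> \<open>With a single row every column profile is a unit vector. An extreme point is no
    average involving a different unit vector, so the second row needed for strictness exists; the
    same holds for columns.\<close>
  have "\<exists>u'\<in>A. u' \<noteq> u0"
  proof (rule ccontr)
    assume "\<not> ?thesis"
    then have A: "A = {u0}" using uv0 by blast
    have c: "real (col_prof A \<xi>' v0 x) = (if \<xi>' u0 v0 = x then 1 else 0)" for \<xi>' :: "nat \<Rightarrow> nat \<Rightarrow> 'x" and x
      by (cases "\<xi>' u0 v0 = x") (simp_all add: col_prof_def A cong: conj_cong)
    have "(\<Sum>t<M. \<alpha> t * (if \<xi>s t u0 v0 = \<xi> u0 v0 then 1 else 0)) = 1"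
      using col[rule_format, OF uv0(2), of "\<xi> u0 v0"] unfolding c by simp
    moreover have "(\<Sum>t<M. \<alpha> t * (if \<xi>s t u0 v0 = \<xi> u0 v0 then 1 else 0)) < 1"
      by (rule less1) (use uv0(3) in auto)
    ultimately show False by simp
  qed
  then obtain u' where u': "u' \<in> A" "u' \<noteq> u0" by blast
  have "\<exists>v'\<in>B. v' \<noteq> v0"
  proof (rule ccontr)
    assume "\<not> ?thesis"
    then have B: "B = {v0}" using uv0 by blast
    have c: "real (row_prof B \<xi>' u0 x) = (if \<xi>' u0 v0 = x then 1 else 0)" for \<xi>' :: "nat \<Rightarrow> nat \<Rightarrow> 'x" and x
      by (cases "\<xi>' u0 v0 = x") (simp_all add: row_prof_def B cong: conj_cong)
    have "(\<Sum>t<M. \<alpha> t * (if \<xi>s t u0 v0 = \<xi> u0 v0 then 1 else 0)) = 1"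
      using row[rule_format, OF uv0(1), of "\<xi> u0 v0"] unfolding c by simp
    moreover have "(\<Sum>t<M. \<alpha> t * (if \<xi>s t u0 v0 = \<xi> u0 v0 then 1 else 0)) < 1"
      by (rule less1) (use uv0(3) in auto)
    ultimately show False by simp
  qed
  then obtain v' where v': "v' \<in> B" "v' \<noteq> v0" by blast
  define mix :: "nat \<Rightarrow> nat \<Rightarrow> 'x \<Rightarrow> real" where "mix = (\<lambda>u v x. \<Sum>t<M. \<alpha> t * (if \<xi>s t u v = x then 1 else 0))"
  define d where "d = (\<lambda>u v x. mix u v x - (if \<xi> u v = x then 1 else 0))"
  have card_eq: "(\<Sum>i\<in>I. if Q i then 1 else 0) = real (card {i \<in> I. Q i})" if "finite I" for I :: "nat set" and Q
    using that by (simp add: sum.inter_filter[symmetric])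
  have d_row: "(\<Sum>v\<in>B. d u v x) = 0" if "u \<in> A" for u x
  proof -
    have "(\<Sum>v\<in>B. \<Sum>t<M. \<alpha> t * (if \<xi>s t u v = x then 1 else 0)) = (\<Sum>t<M. \<alpha> t * real (row_prof B (\<xi>s t) u x))"
      by (subst sum.swap) (simp add: sum_distrib_left[symmetric] row_prof_def card_eq[OF fin(2)])
    then show ?thesis
      using row that by (simp add: d_def mix_def sum_subtractf card_eq[OF fin(2)] row_prof_def)
  qed
  have d_col: "(\<Sum>u\<in>A. d u v x) = 0" if "v \<in> B" for v x
  proof -
    have "(\<Sum>u\<in>A. \<Sum>t<M. \<alpha> t * (if \<xi>s t u v = x then 1 else 0)) = (\<Sum>t<M. \<alpha> t * real (col_prof A (\<xi>s t) v x))"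
      by (subst sum.swap) (simp add: sum_distrib_left[symmetric] col_prof_def card_eq[OF fin(1)])
    then show ?thesis
      using col that by (simp add: d_def mix_def sum_subtractf card_eq[OF fin(1)] col_prof_def)
  qed
  have d_uv: "(\<Sum>x\<in>UNIV. d u v x) = 0" for u v
  proof -
    have "(\<Sum>x\<in>UNIV. \<Sum>t<M. \<alpha> t * (if \<xi>s t u v = x then 1 else 0)) = 1"
      using \<alpha>(2) by (subst sum.swap) (simp add: sum_distrib_left[symmetric])
    then show ?thesis by (simp add: d_def mix_def sum_subtractf)
  qed
  \<comment> \<open>Half of the smallest cell mass: at most \<open>e\<close> is removed from a cell,
    so every cell keeps at least \<open>e\<close> on its original input.\<close>
  define e where "e = Min ((\<lambda>(u, v). m u v) ` (A \<times> B)) / 2"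
  have emem: "2 * e \<le> m u v" if "u \<in> A" "v \<in> B" for u v
    unfolding e_def using fin that by (auto intro!: Min_le)
  have "2 * e \<in> (\<lambda>(u, v). m u v) ` (A \<times> B)"
    unfolding e_def using fin uv0 by (simp del: Min_in) (intro Min_in, auto)
  then have e: "0 < e" using m by force
  define Q where "Q = (\<lambda>u v x. P u v x + e * d u v x)"
  have mix_nonneg: "0 \<le> mix u v x" for u v x
    unfolding mix_def using \<alpha>(1) by (intro sum_nonneg) auto
  have Q_ge: "(if x = \<xi> u v then e else 0) + e * mix u v x \<le> Q u v x"
    if "u \<in> A" "v \<in> B" for u v x
    using emem[OF that] by (auto simp: Q_def d_def P[OF that] algebra_simps)
  have Q0: "0 \<le> Q u v x" if "u \<in> A" "v \<in> B" for u v x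
    using Q_ge[OF that, of x] mix_nonneg[of u v x] e by (smt (verit, best) mult_nonneg_nonneg)
  have Qpos: "0 < Q u v (\<xi> u v)" if "u \<in> A" "v \<in> B" for u v
  proof -
    have "0 < e" "0 \<le> e * mix u v (\<xi> u v)"
      using e mix_nonneg[of u v "\<xi> u v"] by simp_all
    then show ?thesis using Q_ge[OF that, of "\<xi> u v"] by simp
  qed
  have Qpos': "0 < Q u0 v0 (\<xi>s t0 u0 v0)"
  proof -
    have "\<alpha> t0 = \<alpha> t0 * (if \<xi>s t0 u0 v0 = \<xi>s t0 u0 v0 then 1 else 0)" by simp
    also have "\<dots> \<le> mix u0 v0 (\<xi>s t0 u0 v0)"
      unfolding mix_def by (rule member_le_sum[of t0 "{..<M}" "\<lambda>t. \<alpha> t * (if \<xi>s t u0 v0 = \<xi>s t0 u0 v0 then 1 else 0)"]) (use t0 \<alpha>(1) in auto)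
    finally have "0 < e * mix u0 v0 (\<xi>s t0 u0 v0)"
      using e t0 by simp
    then show ?thesis using Q_ge[OF uv0(1,2), of "\<xi>s t0 u0 v0"] uv0(3) e by (auto split: if_splits)
  qed
  have row_eq: "(\<Sum>v\<in>B. Q u v x) = (\<Sum>v\<in>B. P u v x)" if "u \<in> A" for u x
    using d_row[OF that] by (simp add: Q_def sum.distrib sum_distrib_left[symmetric])
  have col_eq: "(\<Sum>u\<in>A. Q u v x) = (\<Sum>u\<in>A. P u v x)" if "v \<in> B" for v x
    using d_col[OF that] by (simp add: Q_def sum.distrib sum_distrib_left[symmetric])
  have uv_eq: "(\<Sum>x\<in>UNIV. Q u v x) = (\<Sum>x\<in>UNIV. P u v x)" for u v
    using d_uv by (simp add: Q_def sum.distrib sum_distrib_left[symmetric])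
  have "blk lam a b A B Q = blk lam a b A B P"
    unfolding blk_def side_def outp_def marg_eq_inp uv_eq
    by (simp add: flip_def row_eq col_eq cong: sum.cong)
  moreover have "inp A B Q x = inp A B P x" for x
    by (simp add: inp_def row_eq)
  ultimately have optQ: "blk_optimal lam a b A B Q"
    using opt by (simp add: blk_optimal_def)
  have ne': "\<xi> u0 v0 \<noteq> \<xi>s t0 u0 v0" using uv0(3) by simp
  show False
    by (rule optimal_deterministic[OF optQ lam fin a b Q0 _ _ dist[of "\<xi> u0 v0" "\<xi>s t0 u0 v0"] uv0(1,2) _ Qpos' _ u' v'])
       (use ne' uv0 Qpos in blast)+
qed

section \<open>Markov splits of U and V\<close>

lemma inp_flip: "inp B A (flip P) x = inp A B P x"
  unfolding inp_def flip_def by (rule sum.swap)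

lemma blk_optimal_flip:
  assumes "blk_optimal lam a b A B P"
  shows "blk_optimal (1 - lam) b a B A (flip P)"
  unfolding blk_optimal_def
proof (intro allI impI)
  fix D :: "nat set" and R
  assume D: "finite D" and R: "\<forall>d\<in>D. \<forall>v\<in>B. \<forall>u\<in>A. \<forall>x. 0 \<le> R d v u x"
    and eq: "\<forall>x. (\<Sum>d\<in>D. inp B A (R d) x) = inp B A (flip P) x"
  have "(\<Sum>d\<in>D. blk lam a b A B (flip (R d))) \<le> blk lam a b A B P"
  proof (rule blk_optimalD[OF assms D])
    show "0 \<le> flip (R d) u v x" if "d \<in> D" "u \<in> A" "v \<in> B" for d u v x
      using R that by (simp add: flip_def)
    show "(\<Sum>d\<in>D. inp A B (flip (R d)) x) = inp A B P x" for x
      using eq by (simp add: inp_flip)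
  qed
  then show "(\<Sum>d\<in>D. blk (1 - lam) b a B A (R d)) \<le> blk (1 - lam) b a B A (flip P)"
    using blk_flip[of lam b a B A P] blk_flip[of lam b a B A "flip (R _)"] by simp
qed

text \<open>If U is constant, U' is independent of everything else: both sides are the total mass
  times \<open>psi D (r u1)\<close>.\<close>

lemma split_psi_singleton:
  fixes D :: "nat set"
  assumes a: "pos_channel a" and b: "pos_channel b"
    and P: "\<And>v x. v \<in> B \<Longrightarrow> 0 \<le> P u1 v x" and r: "\<And>d. d \<in> D \<Longrightarrow> 0 \<le> r u1 d"
  shows "(\<Sum>z\<in>UNIV. \<Sum>v\<in>B. psi D (\<lambda>d. marg b {u1} (flip (\<lambda>u v x. r u d * P u v x)) v z))
    = (\<Sum>y\<in>UNIV. psi D (\<lambda>d. outp a {u1} B (\<lambda>u v x. r u d * P u v x) y))"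
proof -
  have "marg b {u1} (flip (\<lambda>u v x. r u d * P u v x)) v z = marg b {u1} (flip P) v z * r u1 d" for d v z
    by (simp add: marg_def flip_def sum_distrib_left sum_distrib_right mult_ac)
  moreover have "outp a {u1} B (\<lambda>u v x. r u d * P u v x) y = outp a {u1} B P y * r u1 d" for d y
    by (simp add: outp_def marg_scale[where k = "\<lambda>u. r u d"])
  moreover have "0 \<le> marg b {u1} (flip P) v z" if "v \<in> B" for v z
    using P that by (intro marg_nonneg[OF b]) (simp add: flip_def)
  moreover have "0 \<le> outp a {u1} B P y" for y using P by (intro outp_nonneg[OF a]) auto
  ultimately have "(\<Sum>z\<in>UNIV. \<Sum>v\<in>B. psi D (\<lambda>d. marg b {u1} (flip (\<lambda>u v x. r u d * P u v x)) v z))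
      = (\<Sum>z\<in>UNIV. \<Sum>v\<in>B. marg b {u1} (flip P) v z * psi D (r u1))"
    "(\<Sum>y\<in>UNIV. psi D (\<lambda>d. outp a {u1} B (\<lambda>u v x. r u d * P u v x) y)) = (\<Sum>y\<in>UNIV. outp a {u1} B P y * psi D (r u1))"
    using r by (simp_all add: psi_scale)
  then show ?thesis
    by (simp add: sum_distrib_right[symmetric] outp_eq_sum_marg_flip[symmetric] sum_outp[OF a] sum_outp[OF b])
qed

lemma split_psi_le':
  fixes D :: "nat set"
  assumes opt: "blk_optimal lam a b A B P" and lam: "0 \<le> lam" "lam \<le> 1" "lam = 1 \<longrightarrow> (\<exists>u1. A = {u1})"
    and fin: "finite A" "finite B" "finite D" and a: "pos_channel a" and b: "pos_channel b"
    and P: "\<And>u v x. u \<in> A \<Longrightarrow> v \<in> B \<Longrightarrow> 0 \<le> P u v x"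
    and r: "\<And>u d. u \<in> A \<Longrightarrow> d \<in> D \<Longrightarrow> 0 \<le> r u d" "\<And>u. u \<in> A \<Longrightarrow> (\<Sum>d\<in>D. r u d) = 1"
  shows "(\<Sum>z\<in>UNIV. \<Sum>v\<in>B. psi D (\<lambda>d. marg b A (flip (\<lambda>u v x. r u d * P u v x)) v z))
    \<le> (\<Sum>y\<in>UNIV. psi D (\<lambda>d. outp a A B (\<lambda>u v x. r u d * P u v x) y))"
proof (cases "lam = 1")
  case True
  then obtain u1 where A: "A = {u1}" using lam(3) by blast
  show ?thesis unfolding A by (rule eq_refl[OF split_psi_singleton[OF a b]]) (use P r A in auto)
next
  case False
  then show ?thesis using split_psi_le[OF opt lam(1) _ fin a b P r] lam(2) by simp
qed

text \<open>H(U') cancels in the difference, which leaves H(U'|V,Z) - H(U'|Y); the two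
  \<open>psi\<close> sums are minus these entropies.\<close>

lemma mi_diff_condU:
  fixes q :: "'x::finite \<Rightarrow> 'y::finite \<Rightarrow> 'z::finite \<Rightarrow> real" and w :: nat
  assumes q: "is_bc q" and p: "is_dist p" and r: "\<And>u. is_dist (r u)"
    and fin: "finite A" "finite B" "finite D" and c: "0 < pW p w"
    and pAB: "\<And>u v x. p (u, v, w, x) \<noteq> 0 \<Longrightarrow> u \<in> A \<and> v \<in> B" and rD: "\<And>u d. u \<in> A \<Longrightarrow> r u d \<noteq> 0 \<Longrightarrow> d \<in> D"
  shows "mi (condU p q w r) (\<lambda>(ub,u,v,x,y,z). ub) (\<lambda>(ub,u,v,x,y,z). y)
      - mi (condU p q w r) (\<lambda>(ub,u,v,x,y,z). ub) (\<lambda>(ub,u,v,x,y,z). (v,z))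
    = (\<Sum>y\<in>UNIV. psi D (\<lambda>d. outp (qY q) A B (\<lambda>u v x. r u d * (slice p w u v x / pW p w)) y))
      - (\<Sum>z\<in>UNIV. \<Sum>v\<in>B. psi D (\<lambda>d. marg (qZ q) A (flip (\<lambda>u v x. r u d * (slice p w u v x / pW p w))) v z))"
proof -
  let ?\<mu> = "condU p q w r"
  let ?\<Omega> = "D \<times> A \<times> B \<times> (UNIV :: 'x set) \<times> (UNIV :: 'y set) \<times> (UNIV :: 'z set)"
  let ?R = "\<lambda>d u v x. r u d * (slice p w u v x / pW p w)"
  have \<Omega>: "finite ?\<Omega>" using fin by simp
  have s\<mu>: "supp ?\<mu> \<subseteq> ?\<Omega>" using pAB rD by (auto simp: supp_def condU_def) blast
  have p0: "0 \<le> p s" for s using p unfolding is_dist_def by blast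
  have r0: "0 \<le> r u d" for u d using r[of u] unfolding is_dist_def by blast
  have \<mu>0: "0 \<le> ?\<mu> s" for s
    using p0 r0 q c by (cases s) (simp add: condU_def is_bc_def)
  have \<mu>f: "finite (supp ?\<mu>)" using s\<mu> \<Omega> finite_subset by blast
  have sumO: "(\<Sum>s\<in>?\<Omega>. f s) = (\<Sum>d\<in>D. \<Sum>u\<in>A. \<Sum>v\<in>B. \<Sum>x\<in>UNIV. \<Sum>y\<in>UNIV. \<Sum>z\<in>UNIV. f (d,u,v,x,y,z))"
    for f :: "_ \<Rightarrow> real"
    by (simp only: sum.cartesian_product')
  have ifc: "(\<Sum>i\<in>I. if c then f i else 0) = (if c then sum f I else 0)" for c and f :: "'i \<Rightarrow> real" and I
    by simp
  have ifconj: "(if c \<and> d then r else 0) = (if c then if d then r else 0 else 0)" for c d and r :: real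
    by simp
  note eval = sumO condU_def prod.case prod.inject ifconj
  have 1: "plogp ?\<mu> (\<lambda>s. (case s of (ub,u,v,x,y,z) \<Rightarrow> ub, case s of (ub,u,v,x,y,z) \<Rightarrow> y))
      = (\<Sum>y\<in>UNIV. \<Sum>d\<in>D. xlnx (outp (qY q) A B (?R d) y))"
    by (rule plogp_pair[OF \<Omega> s\<mu> fin(3) finite])
       ((unfold eval, use fin in \<open>simp add: ifc outp_def marg_def flip_def slice_def qY_def qZ_def sum_distrib_left
          sum_distrib_right sum_divide_distrib mult_ac split del: if_split\<close>; fail) | force)+
  have 2: "plogp ?\<mu> (\<lambda>(ub,u,v,x,y,z). y) = (\<Sum>y\<in>UNIV. xlnx (\<Sum>d\<in>D. outp (qY q) A B (?R d) y))"
  proof -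
    have "(\<Sum>s\<in>?\<Omega>. if (case s of (ub,u,v,x,y,z) \<Rightarrow> y) = y then ?\<mu> s else 0) = (\<Sum>d\<in>D. outp (qY q) A B (?R d) y)" for y
      unfolding eval using fin
      by (simp add: ifc outp_def marg_def slice_def qY_def sum_distrib_left sum_distrib_right sum_divide_distrib
          mult_ac split del: if_split)
    then show ?thesis by (subst plogp_eq_sum_xlnx[OF \<Omega> s\<mu>, where T = UNIV]) auto
  qed
  have "plogp ?\<mu> (\<lambda>s. (case s of (ub,u,v,x,y,z) \<Rightarrow> ub, case s of (ub,u,v,x,y,z) \<Rightarrow> (v,z)))
      = plogp ?\<mu> (\<lambda>s. (case s of (ub,u,v,x,y,z) \<Rightarrow> ub, case s of (ub,u,v,x,y,z) \<Rightarrow> v, case s of (ub,u,v,x,y,z) \<Rightarrow> z))"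
    by (rule plogp_cong) auto
  also have "\<dots> = (\<Sum>z\<in>UNIV. \<Sum>v\<in>B. \<Sum>d\<in>D. xlnx (marg (qZ q) A (flip (?R d)) v z))"
    by (rule plogp_triple[OF \<Omega> s\<mu> fin(3,2) finite])
       ((unfold eval, use fin in \<open>simp add: ifc outp_def marg_def flip_def slice_def qY_def qZ_def sum_distrib_left
          sum_distrib_right sum_divide_distrib mult_ac split del: if_split\<close>; fail) | force)+
  finally have 3: "plogp ?\<mu> (\<lambda>s. (case s of (ub,u,v,x,y,z) \<Rightarrow> ub, case s of (ub,u,v,x,y,z) \<Rightarrow> (v,z))) = \<dots>" .
  have "plogp ?\<mu> (\<lambda>(ub,u,v,x,y,z). (v,z))
      = plogp ?\<mu> (\<lambda>s. (case s of (ub,u,v,x,y,z) \<Rightarrow> v, case s of (ub,u,v,x,y,z) \<Rightarrow> z))"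
    by (rule plogp_cong) auto
  also have "\<dots> = (\<Sum>z\<in>UNIV. \<Sum>v\<in>B. xlnx (\<Sum>d\<in>D. marg (qZ q) A (flip (?R d)) v z))"
    by (rule plogp_pair[OF \<Omega> s\<mu> fin(2) finite])
       ((unfold eval, use fin in \<open>simp add: ifc outp_def marg_def flip_def slice_def qY_def qZ_def sum_distrib_left
          sum_distrib_right sum_divide_distrib mult_ac split del: if_split\<close>; fail) | force)+
  finally have 4: "plogp ?\<mu> (\<lambda>(ub,u,v,x,y,z). (v,z)) = \<dots>" .
  show ?thesis
    unfolding mi_eq_plogp[OF \<mu>f \<mu>0] 1 2 3 4 psi_def by (simp add: sum_subtractf)
qed

lemma prb_bij:
  assumes "bij \<phi>"
  shows "prb (\<mu> \<circ> \<phi>) (\<lambda>s. E (\<phi> s)) = prb \<mu> E"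
  unfolding prb_def o_def using sum.reindex_bij_betw[OF bij_betw_supp[OF assms], of \<mu>] by (simp add: o_def)

lemma mi_bij:
  assumes "bij \<phi>"
  shows "mi (\<mu> \<circ> \<phi>) (\<lambda>s. F (\<phi> s)) (\<lambda>s. G (\<phi> s)) = mi \<mu> F G"
proof -
  define h where "h = (\<lambda>s. \<mu> s * ln (prb \<mu> (\<lambda>s'. F s' = F s \<and> G s' = G s) * prb \<mu> (\<lambda>_. True)
     / (prb \<mu> (\<lambda>s'. F s' = F s) * prb \<mu> (\<lambda>s'. G s' = G s))))"
  have "mi (\<mu> \<circ> \<phi>) (\<lambda>s. F (\<phi> s)) (\<lambda>s. G (\<phi> s)) = (\<Sum>s\<in>supp (\<mu> \<circ> \<phi>). h (\<phi> s))"
    using prb_bij[OF assms, of \<mu> "\<lambda>s'. F s' = F _ \<and> G s' = G _"] prb_bij[OF assms, of \<mu> "\<lambda>_. True"]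
      prb_bij[OF assms, of \<mu> "\<lambda>s'. F s' = F _"] prb_bij[OF assms, of \<mu> "\<lambda>s'. G s' = G _"]
    by (simp add: mi_def cmi_def h_def)
  also have "\<dots> = mi \<mu> F G"
    using sum.reindex_bij_betw[OF bij_betw_supp[OF assms, of \<mu> "\<lambda>_. True"], of h] by (simp add: mi_def cmi_def h_def)
  finally show ?thesis .
qed

lemma pW_swapUV: "pW (p \<circ> swapUV) w = pW p w"
  unfolding pW_def using prb_bij[OF bij_swapUV, of p "\<lambda>(u, v, w', x). w' = w"]
  by (simp add: swapUV_def split_def)

text \<open>Mutual information does not change when sample points are renamed; exchanging u with v
  and y with z turns the condition on V into the one on U for the swapped law and channel.\<close>

lemma mi_condV:
  fixes q :: "'x \<Rightarrow> 'y \<Rightarrow> 'z \<Rightarrow> real"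
  defines "q' \<equiv> \<lambda>x z y. q x y z"
  shows "mi (condV p q w r) (\<lambda>(vb,u,v,x,y,z). vb) (\<lambda>(vb,u,v,x,y,z). z)
      = mi (condU (p \<circ> swapUV) q' w r) (\<lambda>(ub,u,v,x,y,z). ub) (\<lambda>(ub,u,v,x,y,z). y)"
    and "mi (condV p q w r) (\<lambda>(vb,u,v,x,y,z). vb) (\<lambda>(vb,u,v,x,y,z). (u,y))
      = mi (condU (p \<circ> swapUV) q' w r) (\<lambda>(ub,u,v,x,y,z). ub) (\<lambda>(ub,u,v,x,y,z). (v,z))"
proof -
  define \<phi> :: "nat \<times> nat \<times> nat \<times> 'x \<times> 'y \<times> 'z \<Rightarrow> nat \<times> nat \<times> nat \<times> 'x \<times> 'z \<times> 'y"
    where "\<phi> = (\<lambda>(b,u,v,x,y,z). (b,v,u,x,z,y))"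
  have \<phi>: "bij \<phi>"
    by (rule o_bij[of "\<lambda>(b,v,u,x,z,y). (b,u,v,x,y,z)"]) (auto simp: \<phi>_def fun_eq_iff)
  have c: "condV p q w r = condU (p \<circ> swapUV) q' w r \<circ> \<phi>"
    unfolding condV_def condU_def pW_swapUV by (auto simp: q'_def \<phi>_def swapUV_def fun_eq_iff)
  show "mi (condV p q w r) (\<lambda>(vb,u,v,x,y,z). vb) (\<lambda>(vb,u,v,x,y,z). z)
      = mi (condU (p \<circ> swapUV) q' w r) (\<lambda>(ub,u,v,x,y,z). ub) (\<lambda>(ub,u,v,x,y,z). y)"
    using mi_bij[OF \<phi>, of "condU (p \<circ> swapUV) q' w r" "\<lambda>(ub,u,v,x,y,z). ub" "\<lambda>(ub,u,v,x,y,z). y"]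
    unfolding c by (simp add: \<phi>_def split_def)
  show "mi (condV p q w r) (\<lambda>(vb,u,v,x,y,z). vb) (\<lambda>(vb,u,v,x,y,z). (u,y))
      = mi (condU (p \<circ> swapUV) q' w r) (\<lambda>(ub,u,v,x,y,z). ub) (\<lambda>(ub,u,v,x,y,z). (v,z))"
    using mi_bij[OF \<phi>, of "condU (p \<circ> swapUV) q' w r" "\<lambda>(ub,u,v,x,y,z). ub" "\<lambda>(ub,u,v,x,y,z). (v,z)"]
    unfolding c by (simp add: \<phi>_def split_def)
qed

section \<open>Optimality conditions of a maximiser\<close>

lemma prb_pos_iff:
  assumes "is_dist p"
  shows "0 < prb p E \<longleftrightarrow> (\<exists>s. p s \<noteq> 0 \<and> E s)"
proof
  assume "0 < prb p E"
  then have "{s \<in> supp p. E s} \<noteq> {}" unfolding prb_def by (metis less_irrefl sum.empty)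
  then show "\<exists>s. p s \<noteq> 0 \<and> E s" by (auto simp: supp_def)
next
  assume "\<exists>s. p s \<noteq> 0 \<and> E s"
  then obtain s where "s \<in> supp p" "E s" by (auto simp: supp_def)
  then show "0 < prb p E" using prb_pos[of p s E] assms unfolding is_dist_def by blast
qed

lemma Uw_eq_actU: "is_dist p \<Longrightarrow> 0 < pW p w \<Longrightarrow> Uw p w = actU p w"
  by (auto simp: Uw_def zero_less_divide_iff prb_pos_iff actU_def)

lemma Vw_eq_actV: "is_dist p \<Longrightarrow> 0 < pW p w \<Longrightarrow> Vw p w = actV p w"
  by (auto simp: Vw_def zero_less_divide_iff prb_pos_iff actV_def)

lemma prb_reindex:
  assumes "inj_on g I" "finite I" "\<And>i. i \<in> I \<Longrightarrow> E (g i)" "\<And>s. p s \<noteq> 0 \<Longrightarrow> E s \<Longrightarrow> s \<in> g ` I"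
  shows "prb p E = (\<Sum>i\<in>I. p (g i))"
proof -
  have "prb p E = sum p (g ` I)" unfolding prb_def
    by (rule sum.mono_neutral_left) (use assms in \<open>auto simp: supp_def\<close>)
  then show ?thesis by (simp add: sum.reindex[OF assms(1)])
qed

lemma prb_slice:
  fixes p :: "('x::finite) law"
  assumes p: "is_dist p"
  shows "prb p (\<lambda>(u', v', w', x'). u' = u \<and> v' = v \<and> w' = w) = (\<Sum>x\<in>UNIV. slice p w u v x)"
    and "prb p (\<lambda>(u', v', w', x'). u' = u \<and> w' = w \<and> x' = x) = (\<Sum>v\<in>actV p w. slice p w u v x)"
    and "prb p (\<lambda>(u', v', w', x'). v' = v \<and> w' = w \<and> x' = x) = (\<Sum>u\<in>actU p w. slice p w u v x)"
proof -
  have fin: "finite (supp p)" using p by (simp add: is_dist_def)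
  have fU: "finite (actU p w)" and fV: "finite (actV p w)"
  proof -
    have "actU p w \<subseteq> fst ` supp p" "actV p w \<subseteq> (fst \<circ> snd) ` supp p"
      by (force simp: actU_def actV_def supp_def image_iff)+
    then show "finite (actU p w)" "finite (actV p w)" using fin finite_subset by blast+
  qed
  show "prb p (\<lambda>(u', v', w', x'). u' = u \<and> v' = v \<and> w' = w) = (\<Sum>x\<in>UNIV. slice p w u v x)"
    by (subst prb_reindex[where g = "\<lambda>x. (u, v, w, x)" and I = UNIV]) (auto simp: inj_on_def slice_def o_def)
  show "prb p (\<lambda>(u', v', w', x'). u' = u \<and> w' = w \<and> x' = x) = (\<Sum>v\<in>actV p w. slice p w u v x)"
    by (subst prb_reindex[where g = "\<lambda>v. (u, v, w, x)" and I = "actV p w"]) (use fV in \<open>auto simp: inj_on_def slice_def o_def actV_def\<close>)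
  show "prb p (\<lambda>(u', v', w', x'). v' = v \<and> w' = w \<and> x' = x) = (\<Sum>u\<in>actU p w. slice p w u v x)"
    by (subst prb_reindex[where g = "\<lambda>u. (u, v, w, x)" and I = "actU p w"]) (use fU in \<open>auto simp: inj_on_def slice_def o_def actU_def\<close>)
qed

lemma cent_functional:
  fixes q :: "'x::finite \<Rightarrow> 'y::finite \<Rightarrow> 'z::finite \<Rightarrow> real"
  assumes q: "is_bc q" and p: "is_dist p" and f: "functional p"
  shows "cent (joint p q) rvX (\<lambda>s. (rvU s, rvV s, rvW s)) = 0"
proof -
  let ?J = "joint p q"
  have J: "finite (supp ?J)" "\<And>s. 0 \<le> ?J s" using is_dist_joint[OF q p] unfolding is_dist_def by blast+
  have "?J s * - ln (prb ?J (\<lambda>s'. rvX s' = rvX s \<and> (rvU s', rvV s', rvW s') = (rvU s, rvV s, rvW s))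
      / prb ?J (\<lambda>s'. (rvU s', rvV s', rvW s') = (rvU s, rvV s, rvW s))) = 0" if s: "s \<in> supp ?J" for s
  proof -
    have "rvX s' = rvX s" if "s' \<in> supp ?J" "(rvU s', rvV s', rvW s') = (rvU s, rvV s, rvW s)" for s'
    proof -
      obtain u v w x y z where e: "s = ((u, v, w, x), y, z)" by (metis surj_pair)
      obtain u' v' w' x' y' z' where e': "s' = ((u', v', w', x'), y', z')" by (metis surj_pair)
      have "p (u, v, w, x) \<noteq> 0" "p (u', v', w', x') \<noteq> 0"
        using s that(1) by (auto simp: supp_def joint_def e e')
      moreover have "u' = u" "v' = v" "w' = w"
        using that(2) by (simp_all add: e e' rvU_def rvV_def rvW_def)
      ultimately have "x' = x" using f unfolding functional_def by blast
      then show ?thesis by (simp add: e e' rvX_def)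
    qed
    then have "{s' \<in> supp ?J. rvX s' = rvX s \<and> (rvU s', rvV s', rvW s') = (rvU s, rvV s, rvW s)}
        = {s' \<in> supp ?J. (rvU s', rvV s', rvW s') = (rvU s, rvV s, rvW s)}" by blast
    moreover have "0 < prb ?J (\<lambda>s'. (rvU s', rvV s', rvW s') = (rvU s, rvV s, rvW s))"
      by (rule prb_pos[OF J s]) simp
    ultimately show ?thesis by (simp add: prb_def)
  qed
  then show ?thesis unfolding cent_def by (intro sum.neutral) blast
qed

lemma maximizer_conditions:
  fixes q :: "'x::finite \<Rightarrow> 'y::finite \<Rightarrow> 'z::finite \<Rightarrow> real" and p :: "'x law"
  assumes q: "is_bc q" and irr: "irreducible_bc q" and a: "pos_channel (qY q)" and b: "pos_channel (qZ q)"
    and lam: "0 \<le> lam" "lam \<le> 1" and p: "is_dist p"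
    and max: "\<forall>p'. is_dist p' \<longrightarrow> objective lam q p' \<le> objective lam q p"
    and f: "functional p" and constU: "lam = 1 \<longrightarrow> constU p" and constV: "lam = 0 \<longrightarrow> constV p"
    and w: "0 < pW p w"
  shows "profile_not_convex_comb (Uw p w) (Vw p w) (xi p w)" and "cond4 q p w" and "cond5 p q w"
proof -
  define A where "A = actU p w"
  define B where "B = actV p w"
  define c where "c = pW p w"
  define P where "P = (\<lambda>u v x. slice p w u v x / c)"
  have c: "0 < c" using w by (simp add: c_def)
  have UwA: "Uw p w = A" and VwB: "Vw p w = B"
    using Uw_eq_actU[OF p w] Vw_eq_actV[OF p w] by (simp_all add: A_def B_def)
  have p0: "0 \<le> p s" for s using p unfolding is_dist_def by blast
  obtain N where N: "supp p \<subseteq> {..<N} \<times> {..<N} \<times> {..<N} \<times> UNIV"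
    using supp_subset_box[of p] p unfolding is_dist_def by blast
  have AN: "A \<subseteq> {..<N}" and BN: "B \<subseteq> {..<N}"
    unfolding A_def B_def by (rule actU_subset[OF N], rule actV_subset[OF N])
  have fin: "finite A" "finite B" using AN BN finite_subset by blast+
  have "\<exists>s. p s \<noteq> 0 \<and> (\<lambda>(u', v', w', x'). w' = w) s"
    using w prb_pos_iff[OF p] unfolding pW_def by blast
  then obtain us vs xs where s: "p (us, vs, w, xs) \<noteq> 0" by auto
  have wN: "w \<in> {..<N}" using N s by (auto simp: supp_def)
  have P0: "0 \<le> P u v x" for u v x using p0 c by (simp add: P_def slice_def)
  have Ppos: "0 < P u v x \<longleftrightarrow> p (u, v, w, x) \<noteq> 0" for u v x
    using p0[of "(u, v, w, x)"] c by (auto simp: P_def slice_def zero_less_divide_iff less_le)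
  have off: "P u v x = 0" if "\<not> (u \<in> A \<and> v \<in> B)" for u v x
    using that by (auto simp: P_def slice_def A_def B_def actU_def actV_def)
  \<comment> \<open>Optimality of the raw slice on a box is normalised by 1 / p(w) and then
    restricted to active symbols.\<close>
  have opt: "blk_optimal lam (qY q) (qZ q) A B P"
  proof (rule blk_optimal_restrict[OF _ _ _ AN BN])
    have "blk_optimal lam (qY q) (qZ q) {..<N} {..<N} (\<lambda>u v x. (1 / c) * slice p w u v x)"
    proof (rule blk_optimal_scale[OF _ a b])
      show "blk_optimal lam (qY q) (qZ q) {..<N} {..<N} (slice p w)"
        by (rule blk_optimal_slice[OF q p _ _ _ N wN max]) simp_all
    qed (use c p0 in \<open>auto simp: slice_def\<close>)
    then show "blk_optimal lam (qY q) (qZ q) {..<N} {..<N} P" by (simp add: P_def)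
  qed (use off in auto)
  have posU: "\<exists>v\<in>B. \<exists>x. 0 < P u v x" if "u \<in> A" for u
    using that Ppos by (auto simp: A_def B_def actU_def actV_def)
  have posV: "\<exists>u\<in>A. \<exists>x. 0 < P u v x" if "v \<in> B" for v
    using that Ppos by (auto simp: A_def B_def actU_def actV_def)
  have s0: "us \<in> A" "vs \<in> B" "0 < P us vs xs"
    using s Ppos by (auto simp: A_def B_def actU_def actV_def)
  define m where "m = (\<lambda>u v. \<Sum>x\<in>UNIV. P u v x)"
  \<comment> \<open>One occupied cell forces all cells of \<open>A\<close> x \<open>B\<close> to be
    occupied. Hence \<open>xi\<close> is meaningful on the whole rectangle and the logarithms of
    p(u,v|w) in (4) are finite.\<close>
  have mpos: "0 < m u v" if "u \<in> A" "v \<in> B" for u v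
    unfolding m_def by (rule exchange(1)[OF opt fin a b P0 posU posV s0(1,2) that s0(3)])
  have ex: "\<exists>x. 0 < P u v x" if "u \<in> A" "v \<in> B" for u v
  proof (rule ccontr)
    assume "\<not> ?thesis"
    then have "m u v \<le> 0" unfolding m_def by (intro sum_nonpos) (auto simp: not_less)
    then show False using mpos[OF that] by simp
  qed
  have uniq: "x = x'" if "0 < P u v x" "0 < P u v x'" for u v x x'
    using that f unfolding Ppos functional_def by blast
  have pxi: "0 < P u v (xi p w u v)" if uv: "u \<in> A" "v \<in> B" for u v
  proof -
    obtain x where x: "0 < P u v x" using ex[OF uv] by blast
    have "0 < p (u, v, w, x') \<longleftrightarrow> 0 < P u v x'" for x'
      using p0[of "(u, v, w, x')"] unfolding Ppos by auto
    then have "xi p w u v = x" unfolding xi_def using x uniq by (intro the_equality) auto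
    then show ?thesis using x by simp
  qed
  have Pm: "P u v x = (if x = xi p w u v then m u v else 0)" if "u \<in> A" "v \<in> B" for u v x
  proof -
    have z: "P u v x' = 0" if "x' \<noteq> xi p w u v" for x'
      using uniq[of u v x' "xi p w u v"] pxi[OF \<open>u \<in> A\<close> \<open>v \<in> B\<close>] P0[of u v x'] that by (auto simp: less_le)
    have "m u v = (\<Sum>x'\<in>UNIV. if x' = xi p w u v then P u v x' else 0)"
      unfolding m_def by (rule sum.cong) (auto simp: z)
    then show ?thesis using z by simp
  qed
  have dist: "(\<exists>y. qY q x0 y \<noteq> qY q x1 y) \<or> (\<exists>z. qZ q x0 z \<noteq> qZ q x1 z)" if "x0 \<noteq> x1" for x0 x1
    using irr that unfolding irreducible_bc_def indistinguishable_def by blast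
  show "profile_not_convex_comb (Uw p w) (Vw p w) (xi p w)"
    unfolding UwA VwB by (rule profile_optimal[OF opt lam fin a b Pm mpos dist])
  have f_eq: "fUw q p u w x = cross (qY q) B P u x" for u x
    unfolding fUw_def cross_def pUXw_def prb_slice(2)[OF p] marg_eq_inp P_def c_def B_def by (simp add: sum_divide_distrib)
  have g_eq: "gVw q p v w x = cross (qZ q) A (flip P) v x" for v x
    unfolding gVw_def cross_def pVXw_def prb_slice(3)[OF p] marg_eq_inp P_def c_def A_def flip_def by (simp add: sum_divide_distrib)
  have m_eq: "pUVw p w u v = m u v" for u v
    unfolding pUVw_def prb_slice(1)[OF p] m_def P_def c_def by (simp add: sum_divide_distrib)
  have exch: "ln (m u v) - fUw q p u w x - gVw q p v w x \<le> ln (m u' v') - fUw q p u' w x - gVw q p v' w x"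
    if "u \<in> A" "v \<in> B" "0 < P u v x" "u' \<in> A" "v' \<in> B" for u v u' v' x
    unfolding f_eq g_eq m_def by (rule exchange(2)[OF opt fin a b P0 posU posV that(1,2) that(4,5) that(3)])
  let ?S = "\<lambda>x. {ln (pUVw p w u' v') - fUw q p u' w x - gVw q p v' w x | u' v'. u' \<in> Uw p w \<and> v' \<in> Vw p w}"
  have S_eq: "?S x = (\<lambda>(u', v'). ln (m u' v') - fUw q p u' w x - gVw q p v' w x) ` (A \<times> B)" for x
    unfolding UwA VwB m_eq by auto
  have finS: "finite (?S x)" for x unfolding S_eq using fin by simp
  have h_le: "hw q p w x \<le> ln (m u v) - fUw q p u w x - gVw q p v w x" if "u \<in> A" "v \<in> B" for u v x
    unfolding hw_def by (rule Min_le[OF finS]) (use that in \<open>auto simp: UwA VwB m_eq\<close>)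
  \<comment> \<open>By \<open>exch\<close> a cell that carries \<open>x\<close> attains the minimum
    defining \<open>hw\<close>. So (4) holds with equality at the input used by the cell, while
    \<open>h_le\<close> gives the upper bound at every other input.\<close>
  have h_eq: "hw q p w x = ln (m u v) - fUw q p u w x - gVw q p v w x" if "u \<in> A" "v \<in> B" "0 < P u v x" for u v x
    unfolding hw_def
  proof (rule Min_eqI[OF finS])
    show "ln (m u v) - fUw q p u w x - gVw q p v w x \<le> t" if "t \<in> ?S x" for t
      using that exch[OF \<open>u \<in> A\<close> \<open>v \<in> B\<close> \<open>0 < P u v x\<close>] unfolding S_eq by auto
    show "ln (m u v) - fUw q p u w x - gVw q p v w x \<in> ?S x"
      unfolding S_eq using that by auto
  qed
  show "cond4 q p w"
    unfolding cond4_def Let_def UwA VwB m_eq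
  proof (intro ballI conjI allI impI)
    fix u v assume uv: "u \<in> A" "v \<in> B"
    let ?F = "\<lambda>x. fUw q p u w x + gVw q p v w x + hw q p w x"
    have le: "?F x \<le> ln (m u v)" for x using h_le[OF uv, of x] by simp
    have eq: "?F x = ln (m u v)" if "0 < P u v x" for x using h_eq[OF uv that] by simp
    show "0 < m u v" by (rule mpos[OF uv])
    have "Max (range ?F) = ln (m u v)"
      by (rule Max_eqI) (use le eq[OF pxi[OF uv], symmetric] in auto)
    then show "ln (m u v) = Max (range ?F)" ..
    fix x0 x assume "pXgUVW p u v w x0 = 1"
    then have "p (u, v, w, x0) \<noteq> 0" by (auto simp: pXgUVW_def)
    then have "0 < P u v x0" by (simp add: Ppos)
    then show "?F x \<le> ?F x0" using le[of x] eq[of x0] by simp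
  qed
  have pAB: "u \<in> A \<and> v \<in> B" if "p (u, v, w, x) \<noteq> 0" for u v x
    using that by (auto simp: A_def B_def actU_def actV_def)
  have A1: "lam = 1 \<longrightarrow> (\<exists>u1. A = {u1})"
  proof
    assume "lam = 1"
    then have "u = us" if "u \<in> A" for u
      using constU s that unfolding constU_def A_def actU_def by blast
    then show "\<exists>u1. A = {u1}" using s0(1) by blast
  qed
  \<comment> \<open>For the flipped block the parameter is 1 - \<open>lam\<close>, so its degenerate
    case is \<open>lam\<close> = 0.\<close>
  have B1: "1 - lam = 1 \<longrightarrow> (\<exists>v1. B = {v1})"
  proof
    assume "1 - lam = 1"
    then have "lam = 0" by simp
    then have "v = vs" if "v \<in> B" for v
      using constV s that unfolding constV_def B_def actV_def by blast
    then show "\<exists>v1. B = {v1}" using s0(2) by blast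
  qed
  \<comment> \<open>The supports of the rows of \<open>r\<close> may be unbounded over all of nat;
    only the finitely many active rows matter, and the union of their supports serves as alphabet of
    U'.\<close>
  have chan: "\<exists>D. finite D \<and> (\<forall>i\<in>I. \<forall>d. r i d \<noteq> 0 \<longrightarrow> d \<in> D) \<and> (\<forall>i\<in>I. (\<Sum>d\<in>D. r i d) = 1)"
    if "finite I" "\<forall>i. is_dist (r i)" for I and r :: "nat \<Rightarrow> nat \<Rightarrow> real"
  proof (intro exI[of _ "\<Union>i\<in>I. supp (r i)"] conjI ballI)
    have finr: "finite (supp (r i))" for i using that(2) by (simp add: is_dist_def)
    then show "finite (\<Union>i\<in>I. supp (r i))" using that(1) by simp
    fix i assume i: "i \<in> I"
    show "\<forall>d. r i d \<noteq> 0 \<longrightarrow> d \<in> (\<Union>i\<in>I. supp (r i))" using i by (auto simp: supp_def)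
    have "(\<Sum>d\<in>(\<Union>i\<in>I. supp (r i)). r i d) = sum (r i) (supp (r i))"
      by (rule sum.mono_neutral_right) (use i finr that(1) in \<open>auto simp: supp_def\<close>)
    then show "(\<Sum>d\<in>(\<Union>i\<in>I. supp (r i)). r i d) = 1" using that(2) by (simp add: is_dist_def)
  qed
  have lam': "0 \<le> 1 - lam" "1 - lam \<le> 1" using lam by simp_all
  show "cond5 p q w"
    unfolding cond5_def
  proof (intro conjI allI impI)
    fix r :: "nat \<Rightarrow> nat \<Rightarrow> real" assume r: "\<forall>u. is_dist (r u)"
    have r0: "0 \<le> r u d" for u d using r unfolding is_dist_def by blast
    obtain D where D: "finite D" "\<forall>i\<in>A. \<forall>d. r i d \<noteq> 0 \<longrightarrow> d \<in> D" "\<forall>i\<in>A. (\<Sum>d\<in>D. r i d) = 1"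
      using chan[OF fin(1) r] by blast
    have "(\<Sum>z\<in>UNIV. \<Sum>v\<in>B. psi D (\<lambda>d. marg (qZ q) A (flip (\<lambda>u v x. r u d * P u v x)) v z))
        \<le> (\<Sum>y\<in>UNIV. psi D (\<lambda>d. outp (qY q) A B (\<lambda>u v x. r u d * P u v x) y))"
      by (rule split_psi_le'[OF opt lam A1 fin D(1) a b P0 r0]) (use D(3) in blast)
    moreover note mi_diff_condU[OF q p _ fin D(1) w pAB, of r]
    ultimately show "mi (condU p q w r) (\<lambda>(ub,u,v,x,y,z). ub) (\<lambda>(ub,u,v,x,y,z). (v,z))
        \<le> mi (condU p q w r) (\<lambda>(ub,u,v,x,y,z). ub) (\<lambda>(ub,u,v,x,y,z). y)"
      using r D(2) unfolding P_def c_def by fastforce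
  next
    fix r :: "nat \<Rightarrow> nat \<Rightarrow> real" assume r: "\<forall>v. is_dist (r v)"
    have r0: "0 \<le> r u d" for u d using r unfolding is_dist_def by blast
    obtain D where D: "finite D" "\<forall>i\<in>B. \<forall>d. r i d \<noteq> 0 \<longrightarrow> d \<in> D" "\<forall>i\<in>B. (\<Sum>d\<in>D. r i d) = 1"
      using chan[OF fin(2) r] by blast
    let ?q = "\<lambda>x z y. q x y z" and ?p = "p \<circ> swapUV"
    have q': "is_bc ?q"
      using q by (simp add: is_bc_def sum.swap[of "\<lambda>z y. q _ y z"])
    have qYZ: "qY ?q = qZ q" "qZ ?q = qY q" by (simp_all add: qY_def qZ_def fun_eq_iff)
    have w': "0 < pW ?p w" using w by (simp add: pW_swapUV)
    have pBA: "v \<in> B \<and> u \<in> A" if "?p (v, u, w, x) \<noteq> 0" for u v x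
      using pAB that by (simp add: swapUV_def)
    have flP: "flip P = (\<lambda>v u x. slice ?p w v u x / pW ?p w)"
      by (simp add: P_def c_def pW_swapUV slice_swapUV flip_def)
    have "(\<Sum>y\<in>UNIV. \<Sum>u\<in>A. psi D (\<lambda>d. marg (qY q) B (flip (\<lambda>v u x. r v d * flip P v u x)) u y))
        \<le> (\<Sum>z\<in>UNIV. psi D (\<lambda>d. outp (qZ q) B A (\<lambda>v u x. r v d * flip P v u x) z))"
      by (rule split_psi_le'[OF blk_optimal_flip[OF opt] lam' B1 fin(2,1) D(1) b a _ r0])
         (use D(3) P0 in \<open>auto simp: flip_def\<close>)
    moreover have "mi (condU ?p ?q w r) (\<lambda>(ub,u,v,x,y,z). ub) (\<lambda>(ub,u,v,x,y,z). y)
        - mi (condU ?p ?q w r) (\<lambda>(ub,u,v,x,y,z). ub) (\<lambda>(ub,u,v,x,y,z). (v,z))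
      = (\<Sum>z\<in>UNIV. psi D (\<lambda>d. outp (qZ q) B A (\<lambda>v u x. r v d * flip P v u x) z))
        - (\<Sum>y\<in>UNIV. \<Sum>u\<in>A. psi D (\<lambda>d. marg (qY q) B (flip (\<lambda>v u x. r v d * flip P v u x)) u y))"
      unfolding flP qYZ[symmetric]
      by (rule mi_diff_condU[OF q' is_dist_swapUV[OF p] _ fin(2,1) D(1)])
         (use r D(2) w' pBA in auto)
    ultimately show "mi (condV p q w r) (\<lambda>(vb,u,v,x,y,z). vb) (\<lambda>(vb,u,v,x,y,z). (u,y))
        \<le> mi (condV p q w r) (\<lambda>(vb,u,v,x,y,z). vb) (\<lambda>(vb,u,v,x,y,z). z)"
      unfolding mi_condV by linarith
  qed
qed

theorem theorem2:
  fixes q :: "'x::finite \<Rightarrow> 'y::finite \<Rightarrow> 'z::finite \<Rightarrow> real"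
    and lam :: real
  assumes "is_bc q"
    and "irreducible_bc q"
    and "\<forall>x y. 0 < qY q x y"
    and "\<forall>x z. 0 < qZ q x z"
    and "0 \<le> lam" and "lam \<le> 1"
  shows "\<exists>p :: nat \<times> nat \<times> nat \<times> 'x \<Rightarrow> real.
           is_dist p \<and>
           (\<forall>p' :: nat \<times> nat \<times> nat \<times> 'x \<Rightarrow> real. is_dist p' \<longrightarrow> objective lam q p' \<le> objective lam q p) \<and>
           card (alphU p) \<le> min (card (UNIV :: 'x set)) (card (UNIV :: 'y set)) \<and>
           card (alphV p) \<le> min (card (UNIV :: 'x set)) (card (UNIV :: 'z set)) \<and>
           card (alphW p) \<le> card (UNIV :: 'x set) \<and>
           cent (joint p q) rvX (\<lambda>s. (rvU s, rvV s, rvW s)) = 0 \<and>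
           (\<forall>w. 0 < pW p w \<longrightarrow>
              profile_not_convex_comb (Uw p w) (Vw p w) (xi p w) \<and>
              cond4 q p w \<and>
              cond5 p q w)"
proof -
  note chan = pos_channel_bc[OF assms(1,3,4)]
  obtain p0 :: "'x law" where p0: "is_dist p0"
    "\<forall>p'. is_dist p' \<longrightarrow> objective lam q p' \<le> objective lam q p0"
    using exists_max[OF assms(1) chan assms(5,6)] by blast
  \<comment> \<open>Normalising the maximiser cannot lower its value, so the result is again a
    maximiser and has the required structure in addition.\<close>
  obtain p :: "'x law" where p: "is_dist p" "objective lam q p0 \<le> objective lam q p"
    and sub: "supp p \<subseteq> {..<min (CARD('x)) (CARD('y))} \<times>
       {..<min (CARD('x)) (CARD('z))} \<times> {..<CARD('x)} \<times> UNIV"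
    and f: "functional p" "lam = 1 \<longrightarrow> constU p" "lam = 0 \<longrightarrow> constV p"
    using normal_form[OF assms(1) chan assms(5,6) p0(1)] by blast
  have max: "\<forall>p'. is_dist p' \<longrightarrow> objective lam q p' \<le> objective lam q p"
    using p0(2) p(2) by (meson order_trans)
  have "alphU p \<subseteq> {..<min (CARD('x)) (CARD('y))}"
    "alphV p \<subseteq> {..<min (CARD('x)) (CARD('z))}"
    "alphW p \<subseteq> {..<CARD('x)}"
    using sub by (auto simp: alphU_def alphV_def alphW_def prb_pos_iff[OF p(1)] supp_def)
  then have "card (alphU p) \<le> min (CARD('x)) (CARD('y))"
    "card (alphV p) \<le> min (CARD('x)) (CARD('z))"
    "card (alphW p) \<le> CARD('x)"
    by (metis card_lessThan card_mono finite_lessThan)+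
  then show ?thesis
    using p(1) max cent_functional[OF assms(1) p(1) f(1)]
      maximizer_conditions[OF assms(1,2) chan assms(5,6) p(1) max f]
    by (intro exI[of _ p]) simp
qed

end
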